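(* Let $a,b\in\mathbb{R}$ with $a<b$, let $n,d\in\mathbb{N}=\{1,2,\ldots\}$, and let $P_0,\ldots,P_n\in\mathbb{R}^{d\times d}$ satisfy $P_j^{\top}=(-1)^{j+1}P_j$ for $j\in\{0,\ldots,n\}$ and $\det P_n\neq 0$. Let $\mathcal{H}\in L_\infty(a,b;\mathbb{R}^{d\times d})$ be such that $\mathcal{H}(x)$ is symmetric for almost every $x\in[a,b]$ and there exists $c>0$ such that $$\langle\mathcal{H}(x)v,v\rangle_{\mathbb{R}^d}\ge c\|v\|_{\mathbb{R}^d}^2\quad(v\in\mathbb{R}^d,\ x\in[a,b]\text{ a.e.}).$$ Consider the operator $$A\colon\operatorname{dom}(A)\subseteq H\to H,\quad Au=\sum_{k=0}^{n}P_k\partial^k(\mathcal{H}u),$$ where $H=L_2(a,b)^d$ is equipped with the inner product $\langle u,v\rangle_H:=\int_a^b\langle\mathcal{H}(x)u(x),v(x)\rangle\,\mathrm{d}x$ for $u,v\in L_2(a,b)^d$, and $$\operatorname{dom}(A):=\{u\in H\,;\,\mathcal{H}u\in H^n(a,b)^d\}.$$ Let $B\subseteq A$ be a (possibly nonlinear) restriction. Then the following statements are equivalent: (i) $B$ is m-accretive on $H$; (ii) there exists a contraction $g\colon\mathbb{R}^{nd}\to\mathbb{R}^{nd}$ such that $$\operatorname{dom}(B)=\{u\in\operatorname{dom}(A)\,;\, g(Q_+\operatorname{tr}_b\mathcal{H}u+Q_-\operatorname{tr}_a\mathcal{H}u)=Q_-\operatorname{tr}_b\mathcal{H}u+Q_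+\operatorname{tr}_a\mathcal{H}u\}.$$
   Context: All spaces are real; $\partial$ is the weak derivative, $H^n(a,b)$ the Sobolev space of real-valued functions. Restriction: $B\subseteq A$ means that $B$ is a map on an arbitrary subset $\operatorname{dom}(B)\subseteq\operatorname{dom}(A)$ (not necessarily a subspace) with $B(u)=Au$ there. A mapping $B\colon\operatorname{dom}(B)\subseteq H\to H$ on a Hilbert space $H$ is accretive if $\langle B(u)-B(v),u-v\rangle_H\ge0$ for all $u,v\in\operatorname{dom}(B)$; it is m-accretive if it is accretive and $u\mapsto u+B(u)$ maps $\operatorname{dom}(B)$ onto $H$. A contraction is a (possibly nonlinear) map $g$ with $\|g(x)-g(y)\|\le\|x-y\|$ for all $x,y$ (Euclidean norm on $\mathbb{R}^{nd}$). Trace: for $t\in[a,b]$, $\operatorname{tr}_t\colon H^n(a,b)^d\to\mathbb{R}^{nd}$, $\operatorname{tr}_tu:=(u(t),u'(t),\ldots,u^{(n-1)}(t))^{\top}$ (well-defined by Sobolev embedding). Matrix $Q$: $Q\in\mathbb{R}^{nd\times nd}$ is the block matrix with $d\times d$ blocks $Q_{j,i}=(-1)^{j+1}P_{i+j-1}$ if $i+j-1\le n$ and $Q_{j,i}=0$ otherwise ($i,j\in\{1,\ldots,n\}$); that is, $$Q=\begin{pmatrix}P_1&P_2&\cdots&\cdots&P_n\\-P_2&-P_3&\cdots&-P_n&0\\ \vdots&&&&\vdots\\ (-1)^{n+1}P_n&0&\cdots&&0\end{pmatrix}.$$ $Q$ is symmetric and invertible. Let $E_+$ (resp. $E_-$)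 be the linear span of all eigenvectors of $Q$ with positive (resp. negative) eigenvalue, so that $\mathbb{R}^{nd}=E_+\oplus E_-$ orthogonally, and let $\iota_\pm\colon E_\pm\to\mathbb{R}^{nd}$ be the canonical embeddings. Set $$Q_+:=\iota_+(\iota_+^{*}Q\iota_+)^{1/2}\iota_+^{*},\qquad Q_-:=\iota_-(\iota_-^{*}(-Q)\iota_-)^{1/2}\iota_-^{*},$$ so that $Q=Q_+^2-Q_-^2$. *)

theory Defs
  imports "HOL-Analysis.Analysis"
begin

section \<open>Scalar Lebesgue and Sobolev spaces on an interval, at the level of functions\<close>

definition L2_fun :: "real \<Rightarrow> real \<Rightarrow> (real \<Rightarrow> real) set" where
  "L2_fun a b = {f \<in> borel_measurable (lebesgue_on {a<..<b}).
     integrable (lebesgue_on {a<..<b}) (\<lambda>x. (f x)\<^sup>2)}"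

definition test_fun :: "real \<Rightarrow> real \<Rightarrow> (real \<Rightarrow> real) set" where
  "test_fun a b = {\<phi>. (\<forall>k. ((deriv ^^ k) \<phi>) differentiable_on UNIV) \<and>
     (\<exists>K. compact K \<and> K \<subseteq> {a<..<b} \<and> (\<forall>x. x \<notin> K \<longrightarrow> \<phi> x = 0))}"

definition is_weak_deriv :: "real \<Rightarrow> real \<Rightarrow> nat \<Rightarrow> (real \<Rightarrow> real) \<Rightarrow> (real \<Rightarrow> real) \<Rightarrow> bool" where
  "is_weak_deriv a b k f h \<longleftrightarrow> f \<in> L2_fun a b \<and> h \<in> L2_fun a b \<and>
     (\<forall>\<phi>\<in>test_fun a b.
        (LINT x|lebesgue_on {a<..<b}. f x * (deriv ^^ k) \<phi> x)
        = (-1) ^ k * (LINT x|lebesgue_on {a<..<b}. h x * \<phi> x))"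

definition sobolev :: "real \<Rightarrow> real \<Rightarrow> nat \<Rightarrow> (real \<Rightarrow> real) set" where
  "sobolev a b n = {f \<in> L2_fun a b. \<forall>k\<le>n. \<exists>h. is_weak_deriv a b k f h}"

text \<open>A representative of the \<open>k\<close>-th weak derivative. It is determined only up to a null set, and
  is used below only in ways that do not depend on the choice.\<close>

definition wderiv :: "real \<Rightarrow> real \<Rightarrow> nat \<Rightarrow> (real \<Rightarrow> real) \<Rightarrow> real \<Rightarrow> real" where
  "wderiv a b k f = (SOME h. is_weak_deriv a b k f h)"

text \<open>The continuous representative, used only for almost everywhere classes that have one (Sobolev
  embedding). Its values on the closed interval, end points included, are then unique.\<close>

definition cont_rep :: "real \<Rightarrow> real \<Rightarrow> (real \<Rightarrow> real) \<Rightarrow> real \<Rightarrow> real" where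
  "cont_rep a b f = (SOME h. continuous_on {a..b} h \<and> (AE x in lebesgue_on {a<..<b}. h x = f x))"

text \<open>The \<open>d\<close>-fold product \<open>X\<^sup>d\<close> of a space \<open>X\<close> of scalar functions, with \<open>d = CARD('d)\<close>.\<close>

definition fun_pow :: "(real \<Rightarrow> real) set \<Rightarrow> (real \<Rightarrow> real^'d) set" where
  "fun_pow X = {u. \<forall>i. (\<lambda>x. u x $ i) \<in> X}"

definition vderiv :: "real \<Rightarrow> real \<Rightarrow> nat \<Rightarrow> (real \<Rightarrow> real^'d) \<Rightarrow> real \<Rightarrow> real^'d" where
  "vderiv a b k u x = (\<chi> i. wderiv a b k (\<lambda>y. u y $ i) x)"


section \<open>The weighted Hilbert space of almost everywhere classes\<close>

type_synonym 'd L2_class = "(real \<Rightarrow> real^'d) set"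

definition ae_rel :: "real \<Rightarrow> real \<Rightarrow> ((real \<Rightarrow> real^'d) \<times> (real \<Rightarrow> real^'d)) set" where
  "ae_rel a b = {(u, v). u \<in> fun_pow (L2_fun a b) \<and> v \<in> fun_pow (L2_fun a b) \<and>
     (AE x in lebesgue_on {a<..<b}. u x = v x)}"

definition L2_space :: "real \<Rightarrow> real \<Rightarrow> ('d::finite) L2_class set" where
  "L2_space a b = fun_pow (L2_fun a b) // ae_rel a b"

definition ae_class :: "real \<Rightarrow> real \<Rightarrow> (real \<Rightarrow> real^'d) \<Rightarrow> 'd L2_class" where
  "ae_class a b u = ae_rel a b `` {u}"

definition rep :: "'d L2_class \<Rightarrow> real \<Rightarrow> real^'d" where
  "rep U = (SOME u. u \<in> U)"

definition L2_add :: "real \<Rightarrow> real \<Rightarrow> 'd L2_class \<Rightarrow> 'd L2_class \<Rightarrow> ('d::finite) L2_class" where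
  "L2_add a b U V = ae_class a b (\<lambda>x. rep U x + rep V x)"

definition L2_diff :: "real \<Rightarrow> real \<Rightarrow> 'd L2_class \<Rightarrow> 'd L2_class \<Rightarrow> ('d::finite) L2_class" where
  "L2_diff a b U V = ae_class a b (\<lambda>x. rep U x - rep V x)"

definition weighted_inner ::
    "real \<Rightarrow> real \<Rightarrow> (real \<Rightarrow> real^'d^'d) \<Rightarrow> 'd L2_class \<Rightarrow> ('d::finite) L2_class \<Rightarrow> real" where
  "weighted_inner a b \<H> U V =
     (LINT x|lebesgue_on {a<..<b}. inner (\<H> x *v rep U x) (rep V x))"

text \<open>A mapping with domain \<open>D\<close> is a pair of \<open>D\<close> and a total function whose values outside \<open>D\<close> are
  irrelevant.\<close>

definition accretive ::
    "real \<Rightarrow> real \<Rightarrow> (real \<Rightarrow> real^'d^'d) \<Rightarrow> 'd L2_class set \<Rightarrow> ('d L2_class \<Rightarrow> ('d::finite) L2_class) \<Rightarrow> bool" where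
  "accretive a b \<H> D B \<longleftrightarrow>
     (\<forall>U\<in>D. \<forall>V\<in>D. weighted_inner a b \<H> (L2_diff a b (B U) (B V)) (L2_diff a b U V) \<ge> 0)"

definition m_accretive ::
    "real \<Rightarrow> real \<Rightarrow> (real \<Rightarrow> real^'d^'d) \<Rightarrow> 'd L2_class set \<Rightarrow> ('d L2_class \<Rightarrow> ('d::finite) L2_class) \<Rightarrow> bool" where
  "m_accretive a b \<H> D B \<longleftrightarrow>
     accretive a b \<H> D B \<and> (\<lambda>U. L2_add a b U (B U)) ` D = L2_space a b"


section \<open>The differential operator\<close>

definition weigh :: "(real \<Rightarrow> real^'d^'d) \<Rightarrow> ('d::finite) L2_class \<Rightarrow> real \<Rightarrow> real^'d" where
  "weigh \<H> U = (\<lambda>x. \<H> x *v rep U x)"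

definition dom_A ::
    "real \<Rightarrow> real \<Rightarrow> nat \<Rightarrow> (real \<Rightarrow> real^'d^'d) \<Rightarrow> ('d::finite) L2_class set" where
  "dom_A a b n \<H> = {U \<in> L2_space a b. weigh \<H> U \<in> fun_pow (sobolev a b n)}"

definition op_A ::
    "real \<Rightarrow> real \<Rightarrow> nat \<Rightarrow> (nat \<Rightarrow> real^'d^'d) \<Rightarrow> (real \<Rightarrow> real^'d^'d) \<Rightarrow>
     'd L2_class \<Rightarrow> ('d::finite) L2_class" where
  "op_A a b n P \<H> U = ae_class a b (\<lambda>x. \<Sum>k=0..n. P k *v vderiv a b k (weigh \<H> U) x)"


section \<open>Traces and the boundary matrix\<close>

text \<open>The block index set \<open>{1..n}\<close> is rendered by a finite linearly ordered type \<open>'n\<close> with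
  \<open>n = CARD('n)\<close>; \<open>pos\<close> is the order isomorphism onto \<open>{1..n}\<close>. Thus \<open>\<real>\<^bsup>nd\<^esup>\<close> is \<open>real^('n \<times> 'd)\<close>, the
  entry at \<open>(j, p)\<close> being the \<open>p\<close>-th entry of the \<open>j\<close>-th block, and its norm is the Euclidean one.\<close>

definition pos :: "'n::{finite,linorder} \<Rightarrow> nat" where
  "pos j = card {..j}"

definition tr ::
    "real \<Rightarrow> real \<Rightarrow> real \<Rightarrow> (real \<Rightarrow> real^'d) \<Rightarrow> real^('n::{finite,linorder} \<times> 'd::finite)" where
  "tr a b t u = (\<chi> s. case s of (j, p) \<Rightarrow>
     cont_rep a b (wderiv a b (pos j - 1) (\<lambda>x. u x $ p)) t)"

definition Qmat ::
    "(nat \<Rightarrow> real^'d^'d) \<Rightarrow> real^('n::{finite,linorder} \<times> 'd::finite)^('n \<times> 'd)" where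
  "Qmat P = (\<chi> s t. case (s, t) of ((j, p), (i, q)) \<Rightarrow>
     if pos i + pos j - 1 \<le> CARD('n)
     then (-1) ^ (pos j + 1) * P (pos i + pos j - 1) $ p $ q else 0)"

definition E_plus :: "real^'m^'m \<Rightarrow> (real^'m::finite) set" where
  "E_plus M = span {v. v \<noteq> 0 \<and> (\<exists>\<mu>>0. M *v v = \<mu> *\<^sub>R v)}"

definition E_minus :: "real^'m^'m \<Rightarrow> (real^'m::finite) set" where
  "E_minus M = span {v. v \<noteq> 0 \<and> (\<exists>\<mu><0. M *v v = \<mu> *\<^sub>R v)}"

text \<open>The adjoint \<open>\<iota>\<^sup>*\<close> of the embedding \<open>\<iota>\<close> of a subspace \<open>E\<close>. The library's \<open>adjoint\<close> concerns maps
  between types and cannot be used when the domain of the map is a subspace.\<close>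

definition emb_adj :: "'v::real_inner set \<Rightarrow> 'v \<Rightarrow> 'v" where
  "emb_adj E v = (THE w. w \<in> E \<and> (\<forall>u\<in>E. inner u w = inner u v))"

text \<open>The positive semidefinite square root of a positive semidefinite operator on the subspace \<open>E\<close>.
  Only its values on \<open>E\<close> are meaningful; they are unique, whereas the linear extension to the whole
  space is arbitrary.\<close>

definition psd_sqrt_on :: "'v::real_inner set \<Rightarrow> ('v \<Rightarrow> 'v) \<Rightarrow> 'v \<Rightarrow> 'v" where
  "psd_sqrt_on E T = (SOME S. linear S \<and>
     (\<forall>v\<in>E. S v \<in> E \<and> S (S v) = T v \<and> inner (S v) v \<ge> 0) \<and>
     (\<forall>v\<in>E. \<forall>w\<in>E. inner (S v) w = inner v (S w)))"

text \<open>\<open>\<iota> (\<iota>\<^sup>* M \<iota>)\<^bsup>1/2\<^esup> \<iota>\<^sup>*\<close>, where \<open>\<iota>\<close> is the embedding of \<open>E\<close>.\<close>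

definition compressed_sqrt :: "(real^'m) set \<Rightarrow> real^'m^'m \<Rightarrow> real^'m \<Rightarrow> real^'m::finite" where
  "compressed_sqrt E M v = psd_sqrt_on E (\<lambda>w. emb_adj E (M *v w)) (emb_adj E v)"

definition Q_plus :: "real^'m^'m \<Rightarrow> real^'m \<Rightarrow> real^'m::finite" where
  "Q_plus Q = compressed_sqrt (E_plus Q) Q"

definition Q_minus :: "real^'m^'m \<Rightarrow> real^'m \<Rightarrow> real^'m::finite" where
  "Q_minus Q = compressed_sqrt (E_minus Q) (- Q)"

definition contraction :: "(real^'m \<Rightarrow> real^'m::finite) \<Rightarrow> bool" where
  "contraction g \<longleftrightarrow> (\<forall>x y. norm (g x - g y) \<le> norm (x - y))"

end

theory Submission
  imports Defs
begin

text \<open>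
Write \<open>w = \<H> u\<close> and collect the traces of \<open>w\<close> at both end points into
\<open>F u = Q\<^sub>+ tr\<^sub>b w + Q\<^sub>- tr\<^sub>a w\<close> and \<open>G u = Q\<^sub>- tr\<^sub>b w + Q\<^sub>+ tr\<^sub>a w\<close>. Integration by parts, the sign
pattern of the \<open>P\<^sub>k\<close> and \<open>Q = Q\<^sub>+\<^sup>2 - Q\<^sub>-\<^sup>2\<close> give the balance law
\<open>2 \<langle>A u - A v, u - v\<rangle> = \<bar>F u - F v\<bar>\<^sup>2 - \<bar>G u - G v\<bar>\<^sup>2\<close> (\<open>represents_green\<close>). Hence a restriction \<open>B\<close>
of \<open>A\<close> is accretive exactly if \<open>F u \<mapsto> G u\<close> is a well-defined contraction on \<open>F (dom B)\<close>. The
content of the theorem is that m-accretivity means that this contraction is defined everywhere.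

The equation \<open>u + A u = f\<close> is a linear ordinary differential equation for \<open>w\<close> with bounded
measurable coefficients, so it has solutions with every prescribed trace at \<open>a\<close>
(\<open>ode_solution\<close>). For \<open>u\<close> in the kernel of \<open>1 + A\<close> the balance law reads
\<open>\<bar>G u\<bar>\<^sup>2 = \<bar>F u\<bar>\<^sup>2 + 2 \<parallel>u\<parallel>\<^sup>2\<close>. So \<open>G\<close> identifies the kernel with the whole trace space, and \<open>F = K G\<close>
there with a linear \<open>K\<close> of norm less than one. The solutions of \<open>u + A u = f\<close> therefore have exactly
the boundary values \<open>(F u, G u) = (x + K y, y)\<close>, where \<open>x\<close> depends on \<open>f\<close> and \<open>y\<close> is free. The same
argument for the kernel of \<open>1 - A\<close>, where \<open>F\<close> dominates \<open>G\<close>, shows that every \<open>x\<close> occurs for some \<open>f\<close>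
(\<open>range_fibres\<close>).

What remains is a statement about a contraction \<open>g\<close> and the strict linear contraction \<open>K\<close>
(\<open>contraction_parametrization\<close>). If \<open>g\<close> is defined everywhere, then \<open>y = g (x + K y)\<close> has a solution
by the Banach fixed point theorem, so \<open>1 + B\<close> is onto. Conversely, if \<open>1 + B\<close> is onto, then \<open>1 - K g\<close>
maps the domain of \<open>g\<close> onto the whole space. Deforming \<open>K\<close> to zero through \<open>t K\<close> in finitely many
steps, each of them a Banach fixed point argument, shows that the domain of \<open>g\<close> is the whole space
(\<open>perturbed_boundary_map_surjective\<close>). This takes the place of an appeal to the extension theorem
of Kirszbraun. Finally, \<open>B\<close> has no proper accretive extension inside \<open>A\<close>, so its domain is all of
the set that \<open>g\<close> describes.

Sobolev functions are handled through chains \<open>F\<^sub>0, \<dots>, F\<^sub>n\<close> in which each member is a primitive of the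
next one (\<open>sobolev_chain\<close> and its converse). This makes weak derivatives and traces literal function
values, and integration by parts becomes Fubini's theorem on a triangle (\<open>prim_by_parts\<close>).
\<close>


section \<open>Smooth bump functions\<close>

text \<open>
Note the shift: \<open>times_diff m f\<close> says that the derivatives of order \<open>0, \<dots>, m\<close> are themselves
differentiable. In this form the closure properties below follow by induction on \<open>m\<close>.
\<close>

primrec times_diff :: "nat \<Rightarrow> (real \<Rightarrow> real) \<Rightarrow> bool" where
  "times_diff 0 f \<longleftrightarrow> f differentiable_on UNIV"
| "times_diff (Suc m) f \<longleftrightarrow> f differentiable_on UNIV \<and> times_diff m (deriv f)"

lemma times_diff_deriv_iff:
  "(\<forall>k\<le>m. ((deriv ^^ k) f) differentiable_on UNIV) \<longleftrightarrow> times_diff m f"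
proof (induction m arbitrary: f)
  case (Suc m)
  have "(\<forall>k\<le>Suc m. ((deriv ^^ k) f) differentiable_on UNIV) \<longleftrightarrow>
     f differentiable_on UNIV \<and> (\<forall>k\<le>m. ((deriv ^^ Suc k) f) differentiable_on UNIV)"
    by (metis (no_types, lifting) Suc_le_mono funpow_0 le0 not0_implies_Suc)
  also have "\<dots> \<longleftrightarrow> times_diff (Suc m) f"
    using Suc.IH[of "deriv f"] by (simp add: funpow_Suc_right del: funpow.simps)
  finally show ?case .
qed simp

lemma smooth_iff_times_diff:
  "(\<forall>k. ((deriv ^^ k) f) differentiable_on UNIV) \<longleftrightarrow> (\<forall>m. times_diff m f)"
  using times_diff_deriv_iff by blast

lemma times_diff_mono: "times_diff (Suc m) f \<Longrightarrow> times_diff m f"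
  by (induction m arbitrary: f) auto

lemma DERIV_deriv_differentiable_on:
  fixes f :: "real \<Rightarrow> real"
  shows "f differentiable_on UNIV \<Longrightarrow> (f has_real_derivative deriv f x) (at x)"
  by (simp add: DERIV_deriv_iff_real_differentiable differentiable_on_def)

lemma differentiable_onI_DERIV:
  fixes f :: "real \<Rightarrow> real"
  assumes "\<And>x. (f has_real_derivative f' x) (at x)"
  shows "f differentiable_on UNIV" "deriv f = f'"
proof -
  show "f differentiable_on UNIV"
    using assms by (meson differentiable_at_imp_differentiable_on real_differentiable_def)
  show "deriv f = f'" using assms by (auto intro: DERIV_imp_deriv)
qed

lemma times_diff_SucI:
  assumes "\<And>x. (f has_real_derivative f' x) (at x)" "times_diff m f'"
  shows "times_diff (Suc m) f"
  using differentiable_onI_DERIV[OF assms(1)] assms(2) by simp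

lemma times_diff_const: "times_diff m (\<lambda>x. c)"
proof (induction m arbitrary: c)
  case (Suc m)
  show ?case by (rule times_diff_SucI[where f'="\<lambda>x. 0"]) (auto intro: Suc)
qed simp

lemma times_diff_add: "times_diff m f \<Longrightarrow> times_diff m g \<Longrightarrow> times_diff m (\<lambda>x. f x + g x)"
proof (induction m arbitrary: f g)
  case (Suc m)
  then show ?case
    by (intro times_diff_SucI[where f'="\<lambda>x. deriv f x + deriv g x"])
       (auto intro!: derivative_eq_intros DERIV_deriv_differentiable_on)
qed (simp add: differentiable_on_add)

lemma times_diff_mult: "times_diff m f \<Longrightarrow> times_diff m g \<Longrightarrow> times_diff m (\<lambda>x. f x * g x)"
proof (induction m arbitrary: f g)
  case (Suc m)
  have "times_diff m f" "times_diff m g" using Suc.prems times_diff_mono by auto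
  with Suc show ?case
    by (intro times_diff_SucI[where f'="\<lambda>x. deriv f x * g x + f x * deriv g x"] times_diff_add)
       (auto intro!: derivative_eq_intros DERIV_deriv_differentiable_on)
qed (simp add: differentiable_on_mult)

lemma times_diff_affine: "times_diff m f \<Longrightarrow> times_diff m (\<lambda>x. f (\<alpha> * x + \<beta>))"
proof (induction m arbitrary: f)
  case 0
  then have "((\<lambda>x. f (\<alpha> * x + \<beta>)) has_real_derivative deriv f (\<alpha> * x + \<beta>) * \<alpha>) (at x)" for x
    by (intro DERIV_chain2[OF DERIV_deriv_differentiable_on]) (auto intro!: derivative_eq_intros)
  from differentiable_onI_DERIV(1)[OF this] show ?case by simp
next
  case (Suc m)
  then have "((\<lambda>x. f (\<alpha> * x + \<beta>)) has_real_derivative deriv f (\<alpha> * x + \<beta>) * \<alpha>) (at x)" for x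
    by (intro DERIV_chain2[OF DERIV_deriv_differentiable_on]) (auto intro!: derivative_eq_intros)
  then show ?case
    by (rule times_diff_SucI) (use Suc in \<open>auto intro!: times_diff_mult times_diff_const\<close>)
qed

text \<open>
The functions \<open>x \<mapsto> p (1/x) exp (-1/x)\<close>, extended by zero to \<open>x \<le> 0\<close>. This class is closed under
differentiation, which makes each of its members smooth.
\<close>

definition flat_exp :: "real poly \<Rightarrow> real \<Rightarrow> real" where
  "flat_exp p x = (if x > 0 then poly p (1 / x) * exp (- 1 / x) else 0)"

lemma poly_div_exp_tendsto_0: "((\<lambda>t. poly p t / exp t) \<longlongrightarrow> (0::real)) at_top"
proof -
  have "((\<lambda>t. (\<Sum>i\<le>degree p. coeff p i * (t ^ i / exp t))) \<longlongrightarrow> (\<Sum>i\<le>degree p. coeff p i * 0)) at_top"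
    by (intro tendsto_intros tendsto_power_div_exp_0)
  then show ?thesis by (simp add: poly_altdef sum_divide_distrib)
qed

text \<open>
For \<open>x \<noteq> 0\<close> this is calculus. At the origin the difference quotient from the right is
\<open>t p(t) / exp t\<close> with \<open>t = 1/x\<close>, and the exponential wins.
\<close>

lemma flat_exp_DERIV:
  "(flat_exp p has_real_derivative flat_exp (monom 1 2 * (p - pderiv p)) x) (at x)"
proof -
  consider "x > 0" | "x < 0" | "x = 0" by linarith
  then show ?thesis
  proof cases
    case 1
    have "((\<lambda>x. poly p (1 / x) * exp (- 1 / x)) has_real_derivative
        flat_exp (monom 1 2 * (p - pderiv p)) x) (at x)"
      using 1 by (auto intro!: derivative_eq_intros simp: flat_exp_def poly_monom field_simps power2_eq_square)
    then show ?thesis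
      by (rule has_field_derivative_transform_within_open[of _ _ _ "{0<..}"])
         (use 1 in \<open>auto simp: flat_exp_def\<close>)
  next
    case 2
    have "((\<lambda>x::real. 0::real) has_real_derivative flat_exp (monom 1 2 * (p - pderiv p)) x) (at x)"
      using 2 by (auto intro!: derivative_eq_intros simp: flat_exp_def)
    then show ?thesis
      by (rule has_field_derivative_transform_within_open[of _ _ _ "{..<0}"])
         (use 2 in \<open>auto simp: flat_exp_def\<close>)
  next
    case 3
    have "((\<lambda>h. poly (pCons 0 p) (inverse h) / exp (inverse h)) \<longlongrightarrow> 0) (at_right 0)"
      by (rule filterlim_compose[OF poly_div_exp_tendsto_0 filterlim_inverse_at_top_right])
    then have r: "((\<lambda>h. flat_exp p h / h) \<longlongrightarrow> 0) (at_right 0)"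
      by (rule Lim_transform_eventually)
         (auto simp: eventually_at_filter flat_exp_def exp_minus field_simps)
    have l: "((\<lambda>h. flat_exp p h / h) \<longlongrightarrow> 0) (at_left 0)"
      by (rule Lim_transform_eventually[OF tendsto_const])
         (auto simp: eventually_at_filter flat_exp_def)
    show ?thesis using r l unfolding has_field_derivative_iff 3
      by (simp add: filterlim_split_at flat_exp_def)
  qed
qed

lemma times_diff_flat_exp: "times_diff m (flat_exp p)"
proof (induction m arbitrary: p)
  case 0 then show ?case using differentiable_onI_DERIV(1)[OF flat_exp_DERIV] by simp
next
  case (Suc m) then show ?case by (intro times_diff_SucI[OF flat_exp_DERIV])
qed

text \<open>
The product of \<open>exp (-1/y)\<close> at \<open>y = (n+1) (x - c)\<close> and at \<open>y = (n+1) (d - x)\<close>. The scaling is placed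
inside the exponential because then the functions converge to the indicator of \<open>(c, d)\<close>.
\<close>

definition bump :: "real \<Rightarrow> real \<Rightarrow> nat \<Rightarrow> real \<Rightarrow> real" where
  "bump c d n x = flat_exp 1 (real (Suc n) * x + - real (Suc n) * c) *
     flat_exp 1 (- real (Suc n) * x + real (Suc n) * d)"

lemma flat_exp_1_bounds: "0 \<le> flat_exp 1 x" "flat_exp 1 x \<le> 1"
  by (auto simp: flat_exp_def)

lemma bump_bounds: "0 \<le> bump c d n x" "bump c d n x \<le> 1"
  unfolding bump_def by (auto intro!: mult_le_one simp: flat_exp_1_bounds)

lemma bump_factor: "\<And>x c. real (Suc n) * x + - real (Suc n) * c = real (Suc n) * (x - c)"
   "\<And>x c. - real (Suc n) * x + real (Suc n) * c = real (Suc n) * (c - x)"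
  by (auto simp: algebra_simps)

lemma bump_eq: "bump c d n x = (if c < x \<and> x < d then 
   exp (- (1 / (x - c)) / real (Suc n)) * exp (- (1 / (d - x)) / real (Suc n)) else 0)"
  unfolding bump_def bump_factor flat_exp_def by (auto simp: zero_less_mult_iff mult.commute)

lemma bump_tendsto: "(\<lambda>n. bump c d n x) \<longlonglongrightarrow> indicator {c<..<d} x"
proof (cases "c < x \<and> x < d")
  case True
  have *: "(\<lambda>n. exp (- s / real (Suc n))) \<longlonglongrightarrow> exp 0" for s :: real
    by (intro tendsto_exp LIMSEQ_Suc[OF lim_const_over_n])
  from tendsto_mult[OF *[of "1 / (x - c)"] *[of "1 / (d - x)"]] show ?thesis
    using True unfolding bump_eq by simp
next
  case False
  then have "bump c d n x = 0" for n by (auto simp: bump_eq)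
  with False show ?thesis by simp
qed

lemma bump_test_fun:
  assumes "a < c" "d < b"
  shows "bump c d n \<in> test_fun a b"
proof -
  have "times_diff m (bump c d n)" for m
    unfolding bump_def by (intro times_diff_mult times_diff_affine times_diff_flat_exp)
  moreover have "\<forall>x. x \<notin> {c..d} \<longrightarrow> bump c d n x = 0"
    by (auto simp: bump_eq)
  ultimately show ?thesis using assms
    unfolding test_fun_def smooth_iff_times_diff by (intro CollectI conjI exI[of _ "{c..d}"]) auto
qed

section \<open>Square integrable functions and primitives on an interval\<close>

abbreviation leb :: "real \<Rightarrow> real \<Rightarrow> real measure" where
  "leb a b \<equiv> lebesgue_on {a<..<b}"

lemma finite_measure_leb: "finite_measure (leb a b)"
  by (rule finite_measure_lebesgue_on) (rule lmeasurable_interval)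

lemma leb_ident_measurable [measurable]: "(\<lambda>x. x) \<in> borel_measurable (leb a b)"
  using id_borel_measurable_lebesgue_on[of "{a<..<b}"] unfolding id_def .

lemma L2_measurable: "f \<in> L2_fun a b \<Longrightarrow> f \<in> borel_measurable (leb a b)"
  by (simp add: L2_fun_def)

lemma L2_integrable: "f \<in> L2_fun a b \<Longrightarrow> integrable (leb a b) f"
  unfolding L2_fun_def
  by (rule finite_measure.square_integrable_imp_integrable[OF finite_measure_leb]) auto

lemma L2_mult_integrable:
  assumes "f \<in> L2_fun a b" "g \<in> L2_fun a b"
  shows "integrable (leb a b) (\<lambda>x. f x * g x)"
proof (rule Bochner_Integration.integrable_bound)
  show "integrable (leb a b) (\<lambda>x. (f x)\<^sup>2 + (g x)\<^sup>2)"
    using assms by (simp add: L2_fun_def)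
  show "(\<lambda>x. f x * g x) \<in> borel_measurable (leb a b)"
    using assms by (intro borel_measurable_times L2_measurable)
  have "\<bar>u * v\<bar> \<le> u\<^sup>2 + v\<^sup>2" for u v :: real
  proof -
    have "2 * \<bar>u * v\<bar> \<le> u\<^sup>2 + v\<^sup>2"
      using sum_squares_bound[of "\<bar>u\<bar>" "\<bar>v\<bar>"] by (simp add: abs_mult)
    then show ?thesis by (simp add: abs_mult) (smt (verit) zero_le_mult_iff)
  qed
  then show "AE x in leb a b. norm (f x * g x) \<le> norm ((f x)\<^sup>2 + (g x)\<^sup>2)"
    by (intro AE_I2) simp
qed

lemma L2_add: "f \<in> L2_fun a b \<Longrightarrow> g \<in> L2_fun a b \<Longrightarrow> (\<lambda>x. f x + g x) \<in> L2_fun a b"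
  using L2_mult_integrable[of f a b g] borel_measurable_add[of f "leb a b" g]
  by (simp add: L2_fun_def power2_sum mult.assoc)

lemma L2_bounded_mult:
  assumes "f \<in> L2_fun a b" "m \<in> borel_measurable (leb a b)" "AE x in leb a b. \<bar>m x\<bar> \<le> K"
  shows "(\<lambda>x. m x * f x) \<in> L2_fun a b"
proof -
  have "integrable (leb a b) (\<lambda>x. (m x * f x)\<^sup>2)"
  proof (rule Bochner_Integration.integrable_bound)
    show "integrable (leb a b) (\<lambda>x. K\<^sup>2 * (f x)\<^sup>2)" using assms by (simp add: L2_fun_def)
    show "(\<lambda>x. (m x * f x)\<^sup>2) \<in> borel_measurable (leb a b)"
      using assms L2_measurable[of f] by (intro borel_measurable_power borel_measurable_times) auto
    show "AE x in leb a b. norm ((m x * f x)\<^sup>2) \<le> norm (K\<^sup>2 * (f x)\<^sup>2)"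
      using assms(3)
    proof eventually_elim
      case (elim x)
      then have "(m x)\<^sup>2 \<le> K\<^sup>2" by (metis abs_ge_zero power2_abs power_mono)
      then show ?case by (simp add: power_mult_distrib mult_right_mono)
    qed
  qed
  with assms borel_measurable_times[of m "leb a b" f] show ?thesis by (simp add: L2_fun_def)
qed

lemma L2_cmult: "f \<in> L2_fun a b \<Longrightarrow> (\<lambda>x. c * f x) \<in> L2_fun a b"
  by (rule L2_bounded_mult[where K="\<bar>c\<bar>"]) auto

lemma L2_const: "(\<lambda>x. c) \<in> L2_fun a b"
  using finite_measure.integrable_const[OF finite_measure_leb] by (simp add: L2_fun_def)

lemma L2_diff: "f \<in> L2_fun a b \<Longrightarrow> g \<in> L2_fun a b \<Longrightarrow> (\<lambda>x. f x - g x) \<in> L2_fun a b"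
  using L2_add[of f a b "\<lambda>x. (-1) * g x"] L2_cmult[of g a b "-1"] by simp

lemma L2_sum: "(\<And>i. i \<in> I \<Longrightarrow> f i \<in> L2_fun a b) \<Longrightarrow> (\<lambda>x. \<Sum>i\<in>I. f i x) \<in> L2_fun a b"
  by (induction I rule: infinite_finite_induct) (auto intro: L2_add L2_const)

lemma L2_continuous:
  assumes "continuous_on {a..b} f"
  shows "f \<in> L2_fun a b"
proof -
  have m: "f \<in> borel_measurable (leb a b)"
    by (rule continuous_imp_measurable_on_sets_lebesgue)
       (use assms in \<open>auto intro: continuous_on_subset\<close>)
  have "bounded (f ` {a..b})" using assms by (intro compact_imp_bounded compact_continuous_image) auto
  then obtain K where "\<forall>y\<in>f ` {a..b}. norm y \<le> K" unfolding bounded_iff by blast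
  then have K: "\<And>x. x \<in> {a..b} \<Longrightarrow> \<bar>f x\<bar> \<le> K" by simp
  have "(\<lambda>x. f x * 1) \<in> L2_fun a b"
    by (rule L2_bounded_mult[OF L2_const m, where K=K]) (rule AE_I2, use K in auto)
  then show ?thesis by simp
qed

lemma test_fun_DERIV:
  assumes "\<phi> \<in> test_fun a b"
  shows "(\<phi> has_real_derivative deriv \<phi> x) (at x)"
proof -
  have "((deriv ^^ 0) \<phi>) differentiable_on UNIV" using assms unfolding test_fun_def by blast
  then show ?thesis by (simp add: DERIV_deriv_differentiable_on)
qed

lemma test_fun_continuous: "\<phi> \<in> test_fun a b \<Longrightarrow> continuous_on S \<phi>"
  by (rule continuous_at_imp_continuous_on) (use DERIV_isCont[OF test_fun_DERIV] in blast)

lemma test_fun_deriv: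
  assumes "\<phi> \<in> test_fun a b"
  shows "deriv \<phi> \<in> test_fun a b"
proof -
  from assms obtain K where K: "compact K" "K \<subseteq> {a<..<b}" "\<And>x. x \<notin> K \<Longrightarrow> \<phi> x = 0"
    unfolding test_fun_def by blast
  have "deriv \<phi> x = 0" if "x \<notin> K" for x
  proof -
    have "((\<lambda>x. 0) has_real_derivative 0) (at x)" by simp
    then have "(\<phi> has_real_derivative 0) (at x)"
      by (rule has_field_derivative_transform_within_open[of _ _ _ "-K"])
         (use that K in \<open>auto simp: compact_imp_closed open_Compl\<close>)
    then show ?thesis by (rule DERIV_imp_deriv)
  qed
  moreover have "((deriv ^^ k) (deriv \<phi>)) differentiable_on UNIV" for k
  proof -
    have "((deriv ^^ Suc k) \<phi>) differentiable_on UNIV" using assms unfolding test_fun_def by blast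
    then show ?thesis by (simp add: funpow_Suc_right del: funpow.simps)
  qed
  ultimately show ?thesis using K unfolding test_fun_def
    by (intro CollectI conjI allI exI[of _ K]) auto
qed

lemma test_fun_deriv_funpow: "\<phi> \<in> test_fun a b \<Longrightarrow> (deriv ^^ k) \<phi> \<in> test_fun a b"
  by (induction k) (auto intro: test_fun_deriv)

lemma test_fun_outside: "\<phi> \<in> test_fun a b \<Longrightarrow> x \<notin> {a<..<b} \<Longrightarrow> \<phi> x = 0"
  unfolding test_fun_def by blast

lemma test_fun_L2: "\<phi> \<in> test_fun a b \<Longrightarrow> \<phi> \<in> L2_fun a b"
  by (intro L2_continuous test_fun_continuous)


text \<open>
The primitive of \<open>h\<close> that vanishes at \<open>a\<close>. The upper limit enters through an indicator function,
so that all integrals refer to one fixed finite measure; this is the form that Fubini's theorem and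
dominated convergence need.
\<close>

definition prim :: "real \<Rightarrow> real \<Rightarrow> (real \<Rightarrow> real) \<Rightarrow> real \<Rightarrow> real" where
  "prim a b h x = (LINT y|leb a b. indicator {..x} y * h y)"

lemma prim_integrable:
  fixes h :: "real \<Rightarrow> real"
  assumes "integrable (leb a b) h"
  shows "integrable (leb a b) (\<lambda>y. indicator {..x} y * h y)"
proof (rule Bochner_Integration.integrable_bound[OF assms])
  have [measurable]: "h \<in> borel_measurable (leb a b)" using assms by simp
  show "(\<lambda>y. indicator {..x} y * h y) \<in> borel_measurable (leb a b)" by measurable
qed (auto simp: indicator_def)

lemma AE_leb_neq: "AE y in leb a b. y \<noteq> x"
proof -
  have "AE y in lebesgue. y \<noteq> x"
    by (rule AE_I'[where N="{x}"]) auto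
  then have "AE y in lebesgue. y \<in> {a<..<b} \<longrightarrow> y \<noteq> x" by eventually_elim simp
  then show ?thesis by (subst AE_restrict_space_iff) auto
qed

text \<open>
Dominated convergence: for \<open>t\<^sub>i \<rightarrow> x\<close> the indicators of \<open>(-\<infinity>, t\<^sub>i]\<close> converge off the point \<open>x\<close>.
\<close>

lemma prim_continuous:
  assumes h: "integrable (leb a b) h"
  shows "continuous_on S (prim a b h)"
proof -
  have [measurable]: "h \<in> borel_measurable (leb a b)" using h by simp
  have "isCont (prim a b h) x" for x
    unfolding continuous_at_sequentially o_def prim_def
  proof (intro allI impI integral_dominated_convergence[where w="\<lambda>y. \<bar>h y\<bar>"])
    fix X :: "nat \<Rightarrow> real" assume X: "X \<longlonglongrightarrow> x"
    show "AE y in leb a b. (\<lambda>i. indicator {..X i} y * h y) \<longlonglongrightarrow> indicator {..x} y * h y"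
      using AE_leb_neq[of x a b]
    proof eventually_elim
      case (elim y)
      have "eventually (\<lambda>i. (indicator {..X i} y::real) = indicator {..x} y) sequentially"
      proof (cases "y < x")
        case True
        from order_tendstoD(1)[OF X True] show ?thesis
          by eventually_elim (use True in \<open>auto simp: indicator_def\<close>)
      next
        case False
        with elim have less: "x < y" by simp
        from order_tendstoD(2)[OF X less] show ?thesis
          by eventually_elim (use less in \<open>auto simp: indicator_def\<close>)
      qed
      then show ?case by (intro tendsto_mult tendsto_const tendsto_eventually)
    qed
    show "AE y in leb a b. norm (indicator {..X i} y * h y) \<le> \<bar>h y\<bar>" for i
      by (auto simp: indicator_def)
    have [measurable]: "(\<lambda>y. indicator {..t} y * h y) \<in> borel_measurable (leb a b)" for t
      using prim_integrable[OF h] by (rule borel_measurable_integrable)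
    show "(\<lambda>y. indicator {..x} y * h y) \<in> borel_measurable (leb a b)"
      "(\<lambda>y. indicator {..X i} y * h y) \<in> borel_measurable (leb a b)" for i by measurable
    show "integrable (leb a b) (\<lambda>y. \<bar>h y\<bar>)" using h by simp
  qed
  then show ?thesis by (simp add: continuous_at_imp_continuous_on)
qed

lemma prim_L2: "integrable (leb a b) h \<Longrightarrow> prim a b h \<in> L2_fun a b"
  by (intro L2_continuous prim_continuous)

lemma prim_left: "x \<le> a \<Longrightarrow> prim a b h x = 0"
  unfolding prim_def by (rule integral_eq_zero_AE, rule AE_I2) (simp add: indicator_def)

lemma prim_right: "b \<le> x \<Longrightarrow> prim a b h x = (LINT y|leb a b. h y)"
  unfolding prim_def by (rule Bochner_Integration.integral_cong) (auto simp: indicator_def)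

lemma prim_cong_AE:
  assumes "integrable (leb a b) f" "integrable (leb a b) g" "AE x in leb a b. f x = g x"
  shows "prim a b f = prim a b g"
proof
  fix x
  show "prim a b f x = prim a b g x" unfolding prim_def
    by (rule integral_cong_AE) (use assms prim_integrable in \<open>auto simp: borel_measurable_integrable\<close>)
qed

lemma prim_add:
  "integrable (leb a b) f \<Longrightarrow> integrable (leb a b) g \<Longrightarrow>
   prim a b (\<lambda>x. f x + g x) x = prim a b f x + prim a b g x"
  unfolding prim_def by (simp add: distrib_left prim_integrable)

lemma prim_cmult: "prim a b (\<lambda>x. c * f x) x = c * prim a b f x"
  unfolding prim_def by (simp add: mult.left_commute)

lemma prim_of_DERIV:
  assumes "a \<le> x" "x \<le> b" and d: "\<And>x. (F has_real_derivative f x) (at x)" and c: "continuous_on {a..b} f"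
  shows "F x = F a + prim a b f x"
proof -
  have int: "integrable (leb a b) f" using c by (intro L2_integrable L2_continuous)
  have "(f has_integral (F x - F a)) {a..x}"
    by (rule fundamental_theorem_of_calculus)
       (use assms in \<open>auto simp: has_real_derivative_iff_has_vector_derivative[symmetric] intro: has_field_derivative_at_within\<close>)
  then have "integral {a..x} f = F x - F a" by (rule integral_unique)
  moreover have "prim a b f x = integral {a..x} f"
  proof -
    have "prim a b f x = integral {a<..<b} (\<lambda>y. indicator {..x} y * f y)"
      unfolding prim_def by (rule lebesgue_integral_eq_integral[OF prim_integrable[OF int]]) simp
    also have "\<dots> = integral {a<..<b} (\<lambda>y. if y \<in> {..x} then f y else 0)"
      by (rule integral_cong) (auto simp: indicator_def)
    also have "\<dots> = integral ({a<..<b} \<inter> {..x}) f"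
      using Henstock_Kurzweil_Integration.integral_restrict_Int[of "{a<..<b}" "{..x}" f]
      by (simp only: Int_commute)
    also have "\<dots> = integral {a..x} f"
    proof (rule integral_subset_negligible)
      show "negligible ({a..x} - {a<..<b} \<inter> {..x})"
        by (rule negligible_subset[of "{a,b}"]) (use assms in auto)
    qed (use assms in auto)
    finally show ?thesis .
  qed
  ultimately show ?thesis by simp
qed

text \<open>
The left-hand side is the integral of \<open>f(x) g(y)\<close> over the square. The diagonal cuts the square
into two triangles, and the inner integrals over these triangles are the two primitives.
\<close>

lemma prim_by_parts:
  assumes f: "integrable (leb a b) f" and g: "integrable (leb a b) g"
  shows "prim a b f b * prim a b g b =
    (LINT x|leb a b. f x * prim a b g x + prim a b f x * g x)"
proof -
  let ?M = "leb a b"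
  interpret fm: finite_measure ?M by (rule finite_measure_leb)
  interpret pair_sigma_finite ?M ?M ..
  have [measurable]: "f \<in> borel_measurable ?M" "g \<in> borel_measurable ?M" using f g by auto
  have [measurable]: "(\<lambda>z. fst z) \<in> borel_measurable (?M \<Otimes>\<^sub>M ?M)"
    by (rule measurable_compose[OF measurable_fst leb_ident_measurable])
  have [measurable]: "(\<lambda>z. snd z) \<in> borel_measurable (?M \<Otimes>\<^sub>M ?M)"
    by (rule measurable_compose[OF measurable_snd leb_ident_measurable])
  have f1[measurable]: "(\<lambda>z. f (fst z)) \<in> borel_measurable (?M \<Otimes>\<^sub>M ?M)"
    by (rule measurable_compose[OF measurable_fst]) simp
  have g1[measurable]: "(\<lambda>z. g (snd z)) \<in> borel_measurable (?M \<Otimes>\<^sub>M ?M)"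
    by (rule measurable_compose[OF measurable_snd]) simp
  have fg: "integrable (?M \<Otimes>\<^sub>M ?M) (\<lambda>z. f (fst z) * g (snd z))"
  proof (rule Fubini_integrable)
    show "integrable ?M (\<lambda>x. \<integral>y. norm (f (fst (x, y)) * g (snd (x, y))) \<partial>?M)"
      using f g by (simp add: abs_mult)
    show "AE x in ?M. integrable ?M (\<lambda>y. f (fst (x, y)) * g (snd (x, y)))"
      using g by simp
    show "(\<lambda>z. f (fst z) * g (snd z)) \<in> borel_measurable (?M \<Otimes>\<^sub>M ?M)"
      by (rule borel_measurable_times[OF f1 g1])
  qed
  define lo where "lo = (\<lambda>x y. if y \<le> x then f x * g y else 0)"
  define up where "up = (\<lambda>x y. if y \<le> x then 0 else f x * g y)"
  have lo: "integrable (?M \<Otimes>\<^sub>M ?M) (case_prod lo)"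
  proof (rule Bochner_Integration.integrable_bound[OF fg])
    show "case_prod lo \<in> borel_measurable (?M \<Otimes>\<^sub>M ?M)"
      unfolding lo_def case_prod_beta by measurable
  qed (rule AE_I2, simp add: lo_def case_prod_beta)
  have up: "integrable (?M \<Otimes>\<^sub>M ?M) (case_prod up)"
  proof (rule Bochner_Integration.integrable_bound[OF fg])
    show "case_prod up \<in> borel_measurable (?M \<Otimes>\<^sub>M ?M)"
      unfolding up_def case_prod_beta by measurable
  qed (rule AE_I2, simp add: up_def case_prod_beta)
  have "prim a b f b * prim a b g b = (\<integral>x. (\<integral>y. f x * g y \<partial>?M) \<partial>?M)"
    by (simp add: prim_right)
  also have "\<dots> = (\<integral>z. f (fst z) * g (snd z) \<partial>(?M \<Otimes>\<^sub>M ?M))"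
    using integral_fst'[OF fg] by simp
  also have "\<dots> = (\<integral>z. case_prod lo z + case_prod up z \<partial>(?M \<Otimes>\<^sub>M ?M))"
    by (rule Bochner_Integration.integral_cong) (auto simp: lo_def up_def)
  also have "\<dots> = (\<integral>z. case_prod lo z \<partial>(?M \<Otimes>\<^sub>M ?M)) + (\<integral>z. case_prod up z \<partial>(?M \<Otimes>\<^sub>M ?M))"
    using lo up by simp
  also have "(\<integral>z. case_prod lo z \<partial>(?M \<Otimes>\<^sub>M ?M)) = (\<integral>x. (\<integral>y. lo x y \<partial>?M) \<partial>?M)"
    using integral_fst[OF lo] by simp
  also have "\<dots> = (\<integral>x. f x * prim a b g x \<partial>?M)"
  proof (rule Bochner_Integration.integral_cong)
    fix x
    have "lo x = (\<lambda>y. f x * (indicator {..x} y * g y))" by (auto simp: lo_def indicator_def)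
    then show "(\<integral>y. lo x y \<partial>?M) = f x * prim a b g x" by (simp add: prim_def)
  qed simp
  also have "(\<integral>z. case_prod up z \<partial>(?M \<Otimes>\<^sub>M ?M)) = (\<integral>y. (\<integral>x. up x y \<partial>?M) \<partial>?M)"
    using integral_snd[OF up] by simp
  also have "\<dots> = (\<integral>y. prim a b f y * g y \<partial>?M)"
  proof (rule Bochner_Integration.integral_cong)
    fix y
    have "(\<integral>x. up x y \<partial>?M) = (\<integral>x. (indicator {..y} x * f x) * g y \<partial>?M)"
    proof (rule integral_cong_AE)
      show "AE x in ?M. up x y = (indicator {..y} x * f x) * g y"
        using AE_leb_neq[of y a b] by eventually_elim (auto simp: up_def indicator_def)
    qed (auto simp: up_def)
    then show "(\<integral>x. up x y \<partial>?M) = prim a b f y * g y" by (simp add: prim_def)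
  qed simp
  finally have "prim a b f b * prim a b g b = (\<integral>x. f x * prim a b g x \<partial>?M) + (\<integral>x. prim a b f x * g x \<partial>?M)" .
  moreover have "integrable ?M (\<lambda>x. f x * prim a b g x)" 
  proof -
    have "integrable ?M (\<lambda>x. \<integral>y. lo x y \<partial>?M)" using integrable_fst[OF lo] by simp
    moreover have "(\<lambda>x. \<integral>y. lo x y \<partial>?M) = (\<lambda>x. f x * prim a b g x)"
    proof
      fix x
      have "lo x = (\<lambda>y. f x * (indicator {..x} y * g y))" by (auto simp: lo_def indicator_def)
      then show "(\<integral>y. lo x y \<partial>?M) = f x * prim a b g x" by (simp add: prim_def)
    qed
    ultimately show ?thesis by simp
  qed
  moreover have "integrable ?M (\<lambda>x. prim a b f x * g x)"
  proof -
    obtain K where "\<forall>y\<in>prim a b f ` {a..b}. norm y \<le> K"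
      using compact_imp_bounded[OF compact_continuous_image[OF prim_continuous[OF f, of "{a..b}"] compact_Icc]]
      unfolding bounded_iff by blast
    then have K: "\<And>x. x \<in> {a..b} \<Longrightarrow> \<bar>prim a b f x\<bar> \<le> K" by simp
    show ?thesis
    proof (rule Bochner_Integration.integrable_bound)
      show "integrable ?M (\<lambda>x. K * g x)" using g by simp
      show "(\<lambda>x. prim a b f x * g x) \<in> borel_measurable ?M"
        using L2_measurable[OF prim_L2[OF f]] by measurable
      show "AE x in ?M. norm (prim a b f x * g x) \<le> norm (K * g x)"
      proof (rule AE_I2)
        fix x assume "x \<in> space ?M"
        then have "\<bar>prim a b f x\<bar> \<le> \<bar>K\<bar>" using K[of x] by auto
        then show "norm (prim a b f x * g x) \<le> norm (K * g x)"
          by (simp add: abs_mult mult_right_mono)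
      qed
    qed
  qed
  ultimately show ?thesis by simp
qed

section \<open>The fundamental lemma and the lemma of du Bois-Reymond\<close>

text \<open>
Bump functions converge boundedly to indicators of intervals, so \<open>h\<close> has vanishing integral over
every compact subinterval. By Lebesgue's differentiation theorem \<open>h\<close> is almost everywhere the limit
of its averages over small intervals.
\<close>

lemma fundamental_lemma:
  assumes h: "integrable (leb a b) h"
    and z: "\<And>\<phi>. \<phi> \<in> test_fun a b \<Longrightarrow> (LINT x|leb a b. h x * \<phi> x) = 0"
  shows "AE x in leb a b. h x = 0"
proof -
  have [measurable]: "h \<in> borel_measurable (leb a b)" using h by simp
  have ind: "(LINT x|leb a b. h x * indicator {c<..<d} x) = 0" if "a < c" "d < b" for c d
  proof -
    have "(\<lambda>n. LINT x|leb a b. h x * bump c d n x) \<longlonglongrightarrow> (LINT x|leb a b. h x * indicator {c<..<d} x)"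
    proof (rule integral_dominated_convergence[where w="\<lambda>x. \<bar>h x\<bar>"])
      show "AE x in leb a b. (\<lambda>n. h x * bump c d n x) \<longlonglongrightarrow> h x * indicator {c<..<d} x"
        by (intro AE_I2 tendsto_mult tendsto_const bump_tendsto)
      show "AE x in leb a b. norm (h x * bump c d n x) \<le> \<bar>h x\<bar>" for n
        by (rule AE_I2) (simp add: abs_mult bump_bounds mult_left_le)
      show "(\<lambda>x. h x * bump c d n x) \<in> borel_measurable (leb a b)" for n
        using L2_measurable[OF test_fun_L2[OF bump_test_fun[OF that]]] by measurable
    qed (use h in auto)
    moreover have "(LINT x|leb a b. h x * bump c d n x) = 0" for n
      by (intro z bump_test_fun that)
    ultimately show ?thesis by (simp add: LIMSEQ_const_iff)
  qed
  \<comment> \<open>the differentiation theorem asks for a function that is integrable on every interval\<close>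
  define f where "f x = (if x \<in> {a<..<b} then h x else 0)" for x
  have "h integrable_on {a<..<b}" using h by (intro integrable_on_lebesgue_on) auto
  then have "f integrable_on UNIV"
    unfolding f_def by (simp only: integrable_restrict_UNIV)
  then have "f integrable_on cbox c d" for c d
    using integrable_on_subcbox by blast
  then obtain N where N: "negligible N" and lim:
    "\<And>x e. x \<notin> N \<Longrightarrow> 0 < e \<Longrightarrow> \<exists>d>0. \<forall>t. 0 < t \<and> t < d \<longrightarrow>
       norm (integral (cbox x (x + t *\<^sub>R One)) f /\<^sub>R t ^ DIM(real) - f x) < e"
    by (rule integrable_ccontinuous_explicit) (rule that)
  have "h x = 0" if x: "x \<in> {a<..<b}" "x \<notin> N" for x
  proof (rule ccontr)
    assume "h x \<noteq> 0"
    then obtain d where d: "d > 0" "\<And>t. 0 < t \<Longrightarrow> t < d \<Longrightarrow>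
       norm (integral (cbox x (x + t *\<^sub>R One)) f /\<^sub>R t ^ DIM(real) - f x) < \<bar>h x\<bar>"
      using lim[OF x(2), of "\<bar>h x\<bar>"] by auto
    define t where "t = min (d / 2) ((b - x) / 2)"
    have t: "0 < t" "t < d" "x + t < b" using d(1) x by (auto simp: t_def min_def field_simps)
    have "integral {x..x+t} f = integral {x<..<x+t} h"
    proof -
      have "integral {x..x+t} f = integral {x..x+t} h"
        by (rule integral_cong) (use x t in \<open>auto simp: f_def\<close>)
      then show ?thesis using integral_open_interval_real[of x "x+t" h] by simp
    qed
    also have "\<dots> = integral {a<..<b} (\<lambda>y. if y \<in> {x<..<x+t} then h y else 0)"
    proof -
      have "{x<..<x+t} \<inter> {a<..<b} = {x<..<x+t}" using x t by auto
      then show ?thesis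
        using Henstock_Kurzweil_Integration.integral_restrict_Int[of "{a<..<b}" "{x<..<x+t}" h] by simp
    qed
    also have "\<dots> = integral {a<..<b} (\<lambda>y. h y * indicator {x<..<x+t} y)"
      by (rule integral_cong) (auto simp: indicator_def)
    also have "\<dots> = (LINT y|leb a b. h y * indicator {x<..<x+t} y)"
    proof (rule lebesgue_integral_eq_integral[symmetric])
      show "integrable (leb a b) (\<lambda>y. h y * indicator {x<..<x+t} y)"
        by (rule Bochner_Integration.integrable_bound[OF h]) (auto simp: indicator_def)
    qed simp
    also have "\<dots> = 0" using x t by (intro ind) auto
    finally have "integral (cbox x (x + t *\<^sub>R One)) f = 0" by simp
    with d(2)[OF t(1,2)] x show False by (simp add: f_def)
  qed
  moreover have "AE x in lebesgue. x \<notin> N"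
    using N by (auto simp: negligible_iff_null_sets intro!: AE_not_in)
  ultimately have "AE x in lebesgue. x \<in> {a<..<b} \<longrightarrow> h x = 0" by (auto elim: eventually_mono)
  then show ?thesis by (subst AE_restrict_space_iff) auto
qed

text \<open>
A test function is the derivative of a test function exactly if its integral vanishes. Subtracting
a multiple of a fixed bump \<open>\<rho>\<close> from an arbitrary test function achieves this, and the multiple of
\<open>\<integral>h \<rho>\<close> that appears is the constant.
\<close>

lemma du_Bois_Reymond:
  assumes ab: "a < b" and h: "h \<in> L2_fun a b"
    and z: "\<And>\<phi>. \<phi> \<in> test_fun a b \<Longrightarrow> (LINT x|leb a b. h x * deriv \<phi> x) = 0"
  shows "\<exists>c. AE x in leb a b. h x = c"
proof -
  \<comment> \<open>any nonempty interval with closure in \<open>(a, b)\<close> would do for the normalizing bump\<close>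
  define c d where "c = (2 * a + b) / 3" and "d = (a + 2 * b) / 3"
  have cd: "a < c" "c < d" "d < b" using ab by (auto simp: c_def d_def)
  define \<rho> where "\<rho> = bump c d 0"
  have \<rho>: "\<rho> \<in> test_fun a b" unfolding \<rho>_def using cd by (intro bump_test_fun)
  define r where "r = (LINT x|leb a b. \<rho> x)"
  have \<rho>_int: "integrable (leb a b) \<rho>" by (intro L2_integrable test_fun_L2 \<rho>)
  have "r > 0"
  proof -
    have "r \<ge> 0" unfolding r_def \<rho>_def by (intro integral_nonneg_AE AE_I2 bump_bounds)
    moreover have "r \<noteq> 0"
    proof
      assume "r = 0"
      then have "AE x in leb a b. \<rho> x = 0"
        using integral_nonneg_eq_0_iff_AE[OF \<rho>_int] unfolding r_def \<rho>_def by (simp add: bump_bounds)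
      then have "AE x \<in> {a<..<b} in lebesgue. x \<in> {x. \<rho> x = 0}"
        by (subst (asm) AE_restrict_space_iff) auto
      moreover have "closed {x. \<rho> x = 0}"
        using continuous_closed_preimage_constant[OF test_fun_continuous[OF \<rho>, of UNIV] closed_UNIV]
        by simp
      moreover have "(c + d) / 2 \<in> {a<..<b}" using cd by simp
      ultimately have "(c + d) / 2 \<in> {x. \<rho> x = 0}"
        by (metis mem_closed_if_AE_lebesgue_open open_greaterThanLessThan)
      then show False using cd by (simp add: \<rho>_def bump_eq field_simps)
    qed
    ultimately show ?thesis by simp
  qed
  define C where "C = (LINT x|leb a b. h x * \<rho> x) / r"
  have hi: "integrable (leb a b) h" using h by (rule L2_integrable)
  have "AE x in leb a b. h x - C = 0"
  proof (rule fundamental_lemma)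
    show "integrable (leb a b) (\<lambda>x. h x - C)" by (intro L2_integrable L2_diff h L2_const)
    fix \<psi> assume \<psi>: "\<psi> \<in> test_fun a b"
    define s where "s = (LINT x|leb a b. \<psi> x) / r"
    define \<eta> where "\<eta> = (\<lambda>x. \<psi> x - s * \<rho> x)"
    have \<psi>_int: "integrable (leb a b) \<psi>" by (intro L2_integrable test_fun_L2 \<psi>)
    have \<eta>_int: "integrable (leb a b) \<eta>" unfolding \<eta>_def using \<psi>_int \<rho>_int by simp
    have \<eta>0: "(LINT x|leb a b. \<eta> x) = 0"
      unfolding \<eta>_def using \<psi>_int \<rho>_int \<open>r > 0\<close> by (simp add: s_def r_def[symmetric])
    have \<eta>_smooth: "times_diff m \<eta>" for m
    proof -
      have "times_diff m \<psi>" "times_diff m \<rho>" for m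
        using \<psi> \<rho> unfolding test_fun_def smooth_iff_times_diff by auto
      then have "times_diff m (\<lambda>x. \<psi> x + (- s) * \<rho> x)"
        by (intro times_diff_add times_diff_mult times_diff_const)
      then show ?thesis by (simp add: \<eta>_def)
    qed
    obtain c' d' where cd': "a < c'" "c' < d'" "d' < b" and sub: "\<And>x. x \<notin> {c'..d'} \<Longrightarrow> \<eta> x = 0"
    proof -
      obtain K where K: "compact K" "K \<subseteq> {a<..<b}" "\<And>x. x \<notin> K \<Longrightarrow> \<psi> x = 0"
        using \<psi> unfolding test_fun_def by blast
      define c' d' where "c' = Min {c, Inf (insert c K)}" and "d' = Max {d, Sup (insert d K)}"
      have Kc: "compact (insert c K)" "compact (insert d K)" using K by auto
      have Kb: "bdd_below (insert c K)" "bdd_above (insert d K)"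
        using Kc by (simp_all only: bounded_imp_bdd_below bounded_imp_bdd_above compact_imp_bounded)
      have "Inf (insert c K) \<in> insert c K"
        using Kb(1) compact_imp_closed[OF Kc(1)] by (intro closed_contains_Inf) auto
      then have 1: "a < c'" using K cd by (auto simp: c'_def)
      have "Sup (insert d K) \<in> insert d K"
        using Kb(2) compact_imp_closed[OF Kc(2)] by (intro closed_contains_Sup) auto
      then have 2: "d' < b" using K cd by (auto simp: d'_def)
      have 3: "c' \<le> c" "d \<le> d'" by (auto simp: c'_def d'_def)
      have 4: "c' \<le> x \<and> x \<le> d'" if "x \<in> K" for x
      proof -
        have "Inf (insert c K) \<le> x" "x \<le> Sup (insert d K)"
          using that Kb by (auto intro!: cInf_lower cSup_upper)
        then show ?thesis by (auto simp: c'_def d'_def)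
      qed
      show thesis
      proof (rule that[of c' d'])
        fix x assume x: "x \<notin> {c'..d'}"
        then have "x \<notin> K" using 4 by auto
        moreover have "\<rho> x = 0" using x 3 by (auto simp: \<rho>_def bump_eq)
        ultimately show "\<eta> x = 0" using K(3) by (simp add: \<eta>_def)
      qed (use 1 2 3 cd in auto)
    qed
    \<comment> \<open>the lower limit lies to the left of the support, so \<open>\<Phi>\<close> is defined around the support\<close>
    define \<Phi> where "\<Phi> x = integral {a - 1..x} \<eta>" for x
    have \<eta>_cont: "continuous_on S \<eta>" for S
      using \<eta>_smooth[of 0] differentiable_imp_continuous_on continuous_on_subset by fastforce
    have \<eta>_int_ivl: "\<eta> integrable_on {u..v}" for u v by (intro integrable_continuous_interval \<eta>_cont)
    have left: "\<Phi> x = 0" if "x \<le> c'" for x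
    proof -
      have "integral {a - 1..x} \<eta> = integral {a - 1..x} (\<lambda>x. 0)"
      proof (rule integral_spike)
        show "negligible {c'}" by simp
      qed (use sub that in auto)
      then show ?thesis by (simp add: \<Phi>_def)
    qed
    have \<eta>D: "(\<Phi> has_real_derivative \<eta> x) (at x)" for x
    proof (cases "x < c'")
      case True
      have "((\<lambda>x. 0) has_real_derivative \<eta> x) (at x)" using sub True by auto
      then show ?thesis
        by (rule has_field_derivative_transform_within_open[of _ _ _ "{..<c'}"]) (use True left in auto)
    next
      case False
      have "(\<Phi> has_vector_derivative \<eta> x) (at x within {a - 1..x + 1})"
        unfolding \<Phi>_def by (rule integral_has_vector_derivative[OF \<eta>_cont]) (use False cd' in auto)
      then show ?thesis using False cd'
        by (simp add: has_real_derivative_iff_has_vector_derivative at_within_Icc_at)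
    qed
    have right: "\<Phi> x = 0" if "d' \<le> x" for x
    proof -
      have "\<Phi> x - \<Phi> d' = 0"
      proof -
        have "\<Phi> d' + integral {d'..x} \<eta> = \<Phi> x"
          unfolding \<Phi>_def
          by (rule Henstock_Kurzweil_Integration.integral_combine) (use that cd' \<eta>_int_ivl in auto)
        moreover have "integral {d'..x} \<eta> = integral {d'..x} (\<lambda>x. 0)"
        proof (rule integral_spike)
          show "negligible {d'}" by simp
        qed (use sub that in auto)
        ultimately show ?thesis by simp
      qed
      moreover have "\<Phi> b = 0"
      proof -
        have "\<Phi> b = \<Phi> a + prim a b \<eta> b" by (rule prim_of_DERIV[OF _ _ \<eta>D \<eta>_cont]) (use ab in auto)
        then show ?thesis using left[of a] cd' \<eta>0 by (simp add: prim_right)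
      qed
      moreover have "\<Phi> b - \<Phi> d' = 0"
      proof -
        have "\<Phi> d' + integral {d'..b} \<eta> = \<Phi> b"
          unfolding \<Phi>_def
          by (rule Henstock_Kurzweil_Integration.integral_combine) (use cd' \<eta>_int_ivl in auto)
        moreover have "integral {d'..b} \<eta> = integral {d'..b} (\<lambda>x. 0)"
        proof (rule integral_spike)
          show "negligible {d'}" by simp
        qed (use sub in auto)
        ultimately show ?thesis by simp
      qed
      ultimately show ?thesis by simp
    qed
    have d\<Phi>: "deriv \<Phi> = \<eta>" using \<eta>D by (auto intro: DERIV_imp_deriv)
    have "\<Phi> \<in> test_fun a b"
    proof -
      have "times_diff m \<Phi>" for m
        by (rule times_diff_mono, rule times_diff_SucI[OF \<eta>D \<eta>_smooth])
      moreover have "\<forall>x. x \<notin> {c'..d'} \<longrightarrow> \<Phi> x = 0" using left right by auto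
      ultimately show ?thesis
        unfolding test_fun_def smooth_iff_times_diff using cd'
        by (intro CollectI conjI exI[of _ "{c'..d'}"]) auto
    qed
    from z[OF this] have "(LINT x|leb a b. h x * \<psi> x - s * (h x * \<rho> x)) = 0"
      by (simp add: d\<Phi> \<eta>_def algebra_simps)
    then have "(LINT x|leb a b. h x * \<psi> x) = s * (LINT x|leb a b. h x * \<rho> x)"
      using L2_mult_integrable[OF h test_fun_L2[OF \<psi>]] L2_mult_integrable[OF h test_fun_L2[OF \<rho>]]
      by simp
    also have "\<dots> = C * (LINT x|leb a b. \<psi> x)" by (simp add: s_def C_def)
    finally show "(LINT x|leb a b. (h x - C) * \<psi> x) = 0"
      using L2_mult_integrable[OF h test_fun_L2[OF \<psi>]] \<psi>_int by (simp add: left_diff_distrib)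
  qed
  then show ?thesis by (intro exI[of _ C]) auto
qed

section \<open>Sobolev functions as chains of primitives\<close>

text \<open>
A Sobolev function together with its derivatives, as honest functions: \<open>F k\<close> stands for the
continuous representative of the \<open>k\<close>-th derivative if \<open>k < n\<close>, and \<open>F n\<close> is merely square
integrable. Nothing is said about \<open>F k\<close> outside \<open>[a, b]\<close>.
\<close>

definition sob_chain :: "real \<Rightarrow> real \<Rightarrow> nat \<Rightarrow> (nat \<Rightarrow> real \<Rightarrow> real) \<Rightarrow> bool" where
  "sob_chain a b n F \<longleftrightarrow> (\<forall>k\<le>n. F k \<in> L2_fun a b) \<and>
     (\<forall>k<n. \<forall>x\<in>{a..b}. F k x = F k a + prim a b (F (Suc k)) x)"

lemma sob_chain_L2: "sob_chain a b n F \<Longrightarrow> k \<le> n \<Longrightarrow> F k \<in> L2_fun a b"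
  by (simp add: sob_chain_def)

lemma sob_chain_prim:
  "sob_chain a b n F \<Longrightarrow> k < n \<Longrightarrow> x \<in> {a..b} \<Longrightarrow> F k x = F k a + prim a b (F (Suc k)) x"
  unfolding sob_chain_def by blast

lemma sob_chain_integrable: "sob_chain a b n F \<Longrightarrow> k \<le> n \<Longrightarrow> integrable (leb a b) (F k)"
  by (intro L2_integrable sob_chain_L2)

lemma sob_chain_continuous:
  assumes "sob_chain a b n F" "k < n"
  shows "continuous_on {a..b} (F k)"
proof -
  have "continuous_on {a..b} (\<lambda>x. F k a + prim a b (F (Suc k)) x)"
    using assms by (intro continuous_intros prim_continuous sob_chain_integrable) auto
  then show ?thesis
    by (rule continuous_on_eq) (rule sob_chain_prim[OF assms, symmetric])
qed

lemma sob_chain_add: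
  assumes F: "sob_chain a b n F" and G: "sob_chain a b n G"
  shows "sob_chain a b n (\<lambda>k x. F k x + G k x)"
  unfolding sob_chain_def
proof (intro conjI allI impI ballI)
  fix k x assume k: "k < n" and x: "x \<in> {a..b}"
  have "prim a b (\<lambda>x. F (Suc k) x + G (Suc k) x) x = prim a b (F (Suc k)) x + prim a b (G (Suc k)) x"
    using k by (intro prim_add sob_chain_integrable[OF F] sob_chain_integrable[OF G]) auto
  then show "F k x + G k x = F k a + G k a + prim a b (\<lambda>x. F (Suc k) x + G (Suc k) x) x"
    using sob_chain_prim[OF F k x] sob_chain_prim[OF G k x] by simp
qed (intro L2_add sob_chain_L2[OF F] sob_chain_L2[OF G])

lemma sob_chain_cmult:
  assumes F: "sob_chain a b n F"
  shows "sob_chain a b n (\<lambda>k x. c * F k x)"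
  unfolding sob_chain_def
proof (intro conjI allI impI ballI)
  fix k x assume k: "k < n" and x: "x \<in> {a..b}"
  show "c * F k x = c * F k a + prim a b (\<lambda>x. c * F (Suc k) x) x"
    using sob_chain_prim[OF F k x] by (simp add: prim_cmult algebra_simps)
qed (intro L2_cmult sob_chain_L2[OF F])

lemma sob_chain_zero: "sob_chain a b n (\<lambda>k x. 0)"
  by (simp add: sob_chain_def L2_const prim_def)

lemma sob_chain_sum:
  "finite I \<Longrightarrow> (\<And>i. i \<in> I \<Longrightarrow> sob_chain a b n (F i)) \<Longrightarrow> sob_chain a b n (\<lambda>k x. \<Sum>i\<in>I. F i k x)"
  by (induction I rule: finite_induct) (auto intro: sob_chain_add sob_chain_zero)

lemma sob_chain_diff:
  "sob_chain a b n F \<Longrightarrow> sob_chain a b n G \<Longrightarrow> sob_chain a b n (\<lambda>k x. F k x - G k x)"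
  using sob_chain_add[of a b n F "\<lambda>k x. (-1) * G k x"] sob_chain_cmult[of a b n G "-1"] by simp

text \<open>
Write each factor as its value at \<open>a\<close> plus a primitive; the product of the two primitives is
covered by \<open>prim_by_parts\<close>.
\<close>

lemma sob_chain_by_parts:
  assumes ab: "a < b" and F: "sob_chain a b n F" "i < n" and G: "sob_chain a b m G" "j < m"
  shows "F i b * G j b - F i a * G j a =
    (LINT x|leb a b. F (Suc i) x * G j x + F i x * G (Suc j) x)"
proof -
  let ?f = "F (Suc i)" and ?g = "G (Suc j)"
  let ?pf = "prim a b ?f" and ?pg = "prim a b ?g"
  have f: "?f \<in> L2_fun a b" and g: "?g \<in> L2_fun a b" using F G by (auto intro: sob_chain_L2)
  have fi: "integrable (leb a b) ?f" and gi: "integrable (leb a b) ?g" using f g L2_integrable by auto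
  have i: "integrable (leb a b) (\<lambda>x. ?f x * ?pg x)" "integrable (leb a b) (\<lambda>x. ?pf x * ?g x)"
    using f g fi gi by (auto intro: L2_mult_integrable prim_L2)
  have "(LINT x|leb a b. ?f x * G j x + F i x * ?g x) =
      (LINT x|leb a b. (G j a * ?f x + F i a * ?g x) + (?f x * ?pg x + ?pf x * ?g x))"
  proof (rule Bochner_Integration.integral_cong)
    fix x assume "x \<in> space (leb a b)"
    then have x: "x \<in> {a..b}" by auto
    show "?f x * G j x + F i x * ?g x = (G j a * ?f x + F i a * ?g x) + (?f x * ?pg x + ?pf x * ?g x)"
      unfolding sob_chain_prim[OF F x] sob_chain_prim[OF G x] by (simp add: algebra_simps)
  qed simp
  also have "\<dots> = G j a * ?pf b + F i a * ?pg b + (LINT x|leb a b. ?f x * ?pg x + ?pf x * ?g x)"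
    using fi gi i by (simp add: prim_right)
  also have "\<dots> = G j a * ?pf b + F i a * ?pg b + ?pf b * ?pg b"
    by (simp add: prim_by_parts[OF fi gi])
  also have "\<dots> = F i b * G j b - F i a * G j a"
    using sob_chain_prim[OF F, of b] sob_chain_prim[OF G, of b] ab by (simp add: algebra_simps)
  finally show ?thesis by simp
qed

lemma sob_chain_test_fun:
  assumes "a < b" "\<phi> \<in> test_fun a b"
  shows "sob_chain a b n (\<lambda>k. (deriv ^^ k) \<phi>)"
  unfolding sob_chain_def
proof (intro conjI allI impI ballI)
  fix k show "(deriv ^^ k) \<phi> \<in> L2_fun a b" by (intro test_fun_L2 test_fun_deriv_funpow assms)
  fix x assume x: "x \<in> {a..b}"
  have D: "((deriv ^^ k) \<phi> has_real_derivative (deriv ^^ Suc k) \<phi> x) (at x)" for x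
    using test_fun_DERIV[OF test_fun_deriv_funpow[OF assms(2)]] by simp
  show "(deriv ^^ k) \<phi> x = (deriv ^^ k) \<phi> a + prim a b ((deriv ^^ Suc k) \<phi>) x"
    by (rule prim_of_DERIV[OF _ _ D])
       (use x test_fun_continuous[OF test_fun_deriv_funpow[OF assms(2), of "Suc k"]] in auto)
qed

text \<open>
The derivatives of a test function form a chain that vanishes at both end points, so integrating
by parts moves one derivative at a time.
\<close>

lemma sob_chain_weak_deriv:
  assumes ab: "a < b" and F: "sob_chain a b n F" and f: "f \<in> L2_fun a b" "AE x in leb a b. f x = F 0 x"
  shows "k \<le> n \<Longrightarrow> is_weak_deriv a b k f (F k)"
proof (induction k)
  case 0
  have "(LINT x|leb a b. f x * \<phi> x) = (LINT x|leb a b. F 0 x * \<phi> x)" if "\<phi> \<in> test_fun a b" for \<phi>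
  proof (rule integral_cong_AE)
    show "AE x in leb a b. f x * \<phi> x = F 0 x * \<phi> x" using f(2) by eventually_elim simp
  qed (use f L2_measurable test_fun_L2[OF that] sob_chain_L2[OF F, of 0]
        in \<open>auto intro!: borel_measurable_times\<close>)
  then show ?case using f sob_chain_L2[OF F, of 0] by (simp add: is_weak_deriv_def)
next
  case (Suc k)
  then have IH: "is_weak_deriv a b k f (F k)" and k: "k < n" by auto
  have "(LINT x|leb a b. f x * (deriv ^^ Suc k) \<phi> x) = (-1) ^ Suc k * (LINT x|leb a b. F (Suc k) x * \<phi> x)"
    if \<phi>: "\<phi> \<in> test_fun a b" for \<phi>
  proof -
    have "(LINT x|leb a b. f x * (deriv ^^ k) (deriv \<phi>) x) = (-1) ^ k * (LINT x|leb a b. F k x * deriv \<phi> x)"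
      using IH test_fun_deriv[OF \<phi>] by (auto simp: is_weak_deriv_def)
    moreover have "(LINT x|leb a b. F k x * deriv \<phi> x) = - (LINT x|leb a b. F (Suc k) x * \<phi> x)"
    proof -
      have "integrable (leb a b) (\<lambda>x. F (Suc k) x * \<phi> x)" "integrable (leb a b) (\<lambda>x. F k x * deriv \<phi> x)"
        using k by (auto intro!: L2_mult_integrable sob_chain_L2[OF F] test_fun_L2[OF \<phi>]
            test_fun_L2[OF test_fun_deriv[OF \<phi>]])
      moreover have "F k b * \<phi> b - F k a * \<phi> a = (LINT x|leb a b. F (Suc k) x * \<phi> x + F k x * deriv \<phi> x)"
        using sob_chain_by_parts[OF ab F k sob_chain_test_fun[OF ab \<phi>, of 1], of 0] by simp
      moreover have "\<phi> a = 0" "\<phi> b = 0" using test_fun_outside[OF \<phi>] by auto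
      ultimately show ?thesis by simp
    qed
    ultimately show ?thesis by (simp add: funpow_Suc_right del: funpow.simps)
  qed
  then show ?case using f(1) sob_chain_L2[OF F Suc.prems] by (simp add: is_weak_deriv_def del: funpow.simps)
qed

lemma weak_deriv_unique:
  assumes "is_weak_deriv a b k f h" "is_weak_deriv a b k f h'"
  shows "AE x in leb a b. h x = h' x"
proof -
  have L: "h \<in> L2_fun a b" "h' \<in> L2_fun a b" using assms by (auto simp: is_weak_deriv_def)
  have "AE x in leb a b. h x - h' x = 0"
  proof (rule fundamental_lemma)
    show "integrable (leb a b) (\<lambda>x. h x - h' x)" by (intro L2_integrable L2_diff L)
    fix \<phi> assume \<phi>: "\<phi> \<in> test_fun a b"
    have "(LINT x|leb a b. f x * (deriv ^^ k) \<phi> x) = (-1) ^ k * (LINT x|leb a b. h x * \<phi> x)"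
      "(LINT x|leb a b. f x * (deriv ^^ k) \<phi> x) = (-1) ^ k * (LINT x|leb a b. h' x * \<phi> x)"
      using assms \<phi> unfolding is_weak_deriv_def by blast+
    then have "(-1) ^ k * (LINT x|leb a b. h x * \<phi> x) = (-1) ^ k * (LINT x|leb a b. h' x * \<phi> x)"
      by (rule trans[OF sym])
    then show "(LINT x|leb a b. (h x - h' x) * \<phi> x) = 0"
      using L2_mult_integrable[OF L(1) test_fun_L2[OF \<phi>]] L2_mult_integrable[OF L(2) test_fun_L2[OF \<phi>]]
      by (simp add: left_diff_distrib)
  qed
  then show ?thesis by eventually_elim simp
qed

text \<open>
Derivatives of test functions are test functions, so the defining identities of two consecutive
orders can be compared. This reduces all orders to the first one.
\<close>

lemma weak_deriv_step:
  assumes "is_weak_deriv a b k f h" "is_weak_deriv a b (Suc k) f h'"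
  shows "is_weak_deriv a b 1 h h'"
  unfolding is_weak_deriv_def
proof (intro conjI ballI)
  fix \<phi> assume \<phi>: "\<phi> \<in> test_fun a b"
  have "(LINT x|leb a b. f x * (deriv ^^ k) (deriv \<phi>) x) = (-1) ^ k * (LINT x|leb a b. h x * deriv \<phi> x)"
    using assms(1) test_fun_deriv[OF \<phi>] by (auto simp: is_weak_deriv_def)
  moreover have "(LINT x|leb a b. f x * (deriv ^^ Suc k) \<phi> x) = (-1) ^ Suc k * (LINT x|leb a b. h' x * \<phi> x)"
    using assms(2) \<phi> unfolding is_weak_deriv_def by blast
  ultimately have "(-1) ^ k * (LINT x|leb a b. h x * deriv \<phi> x) = (-1) ^ k * (- (LINT x|leb a b. h' x * \<phi> x))"
    by (simp add: funpow_Suc_right del: funpow.simps)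
  then have "(LINT x|leb a b. h x * deriv \<phi> x) = - (LINT x|leb a b. h' x * \<phi> x)"
    by (subst (asm) mult_left_cancel) simp_all
  then show "(LINT x|leb a b. h x * (deriv ^^ 1) \<phi> x) = (- 1) ^ 1 * (LINT x|leb a b. h' x * \<phi> x)"
    by simp
qed (use assms in \<open>auto simp: is_weak_deriv_def\<close>)

text \<open>
The function \<open>h\<close> and the primitive of \<open>h'\<close> have the same weak derivative, so their difference is
constant by the lemma of du Bois-Reymond.
\<close>

lemma weak_deriv_prim:
  assumes ab: "a < b" and w: "is_weak_deriv a b 1 h h'"
  shows "\<exists>c. AE x in leb a b. h x = c + prim a b h' x"
proof -
  have h: "h \<in> L2_fun a b" "h' \<in> L2_fun a b" using w by (auto simp: is_weak_deriv_def)
  have h'i: "integrable (leb a b) h'" by (intro L2_integrable h)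
  define G where "G k = (if k = (0::nat) then prim a b h' else h')" for k
  have G: "sob_chain a b 1 G"
    using h h'i by (auto simp: sob_chain_def G_def le_Suc_eq prim_left intro: prim_L2)
  have p: "is_weak_deriv a b 1 (prim a b h') h'"
    using sob_chain_weak_deriv[OF ab G prim_L2[OF h'i], of 1] by (simp add: G_def)
  have "\<exists>c. AE x in leb a b. h x - prim a b h' x = c"
  proof (rule du_Bois_Reymond[OF ab])
    show "(\<lambda>x. h x - prim a b h' x) \<in> L2_fun a b" by (intro L2_diff h prim_L2 h'i)
    fix \<phi> assume \<phi>: "\<phi> \<in> test_fun a b"
    have "(LINT x|leb a b. h x * deriv \<phi> x) = (LINT x|leb a b. prim a b h' x * deriv \<phi> x)"
      using w p \<phi> by (simp add: is_weak_deriv_def)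
    then show "(LINT x|leb a b. (h x - prim a b h' x) * deriv \<phi> x) = 0"
      using L2_mult_integrable[OF h(1) test_fun_L2[OF test_fun_deriv[OF \<phi>]]]
        L2_mult_integrable[OF prim_L2[OF h'i] test_fun_L2[OF test_fun_deriv[OF \<phi>]]]
      by (simp add: left_diff_distrib)
  qed
  then obtain c where "AE x in leb a b. h x - prim a b h' x = c" by blast
  then have "AE x in leb a b. h x = c + prim a b h' x" by eventually_elim simp
  then show ?thesis by blast
qed

text \<open>
Sobolev embedding: representatives \<open>h k\<close> of the weak derivatives are replaced by
\<open>c\<^sub>k + \<integral> h (k+1)\<close>, which changes them only on null sets and therefore does not affect the primitives
formed from them.
\<close>

lemma sobolev_chain:
  assumes ab: "a < b" and f: "f \<in> sobolev a b n"
  obtains F where "sob_chain a b n F" "AE x in leb a b. f x = F 0 x"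
proof -
  have "\<forall>k. \<exists>h. k \<le> n \<longrightarrow> is_weak_deriv a b k f h" using f by (auto simp: sobolev_def)
  then obtain h where h: "\<And>k. k \<le> n \<Longrightarrow> is_weak_deriv a b k f (h k)" by metis
  have hL: "h k \<in> L2_fun a b" if "k \<le> n" for k using h[OF that] by (simp add: is_weak_deriv_def)
  have "\<forall>k. \<exists>c. k < n \<longrightarrow> (AE x in leb a b. h k x = c + prim a b (h (Suc k)) x)"
    using weak_deriv_prim[OF ab weak_deriv_step[OF h h]] by simp
  then obtain c where c: "\<And>k. k < n \<Longrightarrow> AE x in leb a b. h k x = c k + prim a b (h (Suc k)) x"
    by metis
  define F where "F k = (if k < n then (\<lambda>x. c k + prim a b (h (Suc k)) x) else h k)" for k
  have F_L2: "F k \<in> L2_fun a b" if "k \<le> n" for k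
    using that hL by (auto simp: F_def intro!: L2_add L2_const prim_L2 L2_integrable)
  have Fh: "AE x in leb a b. h k x = F k x" if "k \<le> n" for k
    using that c by (auto simp: F_def)
  have "sob_chain a b n F"
    unfolding sob_chain_def
  proof (intro conjI allI impI ballI F_L2)
    fix k x assume k: "k < n" and x: "x \<in> {a..b}"
    have "prim a b (h (Suc k)) = prim a b (F (Suc k))"
      using k by (intro prim_cong_AE L2_integrable hL F_L2 Fh) auto
    then show "F k x = F k a + prim a b (F (Suc k)) x"
      using k by (simp add: F_def[of k] prim_left)
  qed
  moreover have "AE x in leb a b. f x = F 0 x"
  proof -
    have "is_weak_deriv a b 0 f f" using f by (simp add: is_weak_deriv_def sobolev_def)
    from weak_deriv_unique[OF this h[of 0]] Fh[of 0] show ?thesis by auto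
  qed
  ultimately show thesis using that by blast
qed

text \<open>
The set where two continuous functions agree is closed in \<open>[a, b]\<close>. It has full measure, so it
contains \<open>(a, b)\<close> and then also the end points.
\<close>

lemma continuous_AE_eq_imp_eq:
  fixes f g :: "real \<Rightarrow> real"
  assumes ab: "a < b" and f: "continuous_on {a..b} f" and g: "continuous_on {a..b} g"
    and eq: "AE x in leb a b. f x = g x" and t: "t \<in> {a..b}"
  shows "f t = g t"
proof -
  let ?C = "{x \<in> {a..b}. f x - g x = 0}"
  have "continuous_on {a..b} (\<lambda>x. f x - g x)" by (intro continuous_intros f g)
  then have C: "closed ?C"
    using continuous_closed_preimage_constant[of "{a..b}" "\<lambda>x. f x - g x" 0] by simp
  have "AE x \<in> {a<..<b} in lebesgue. f x = g x" using eq by (subst (asm) AE_restrict_space_iff) auto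
  then have ae: "AE x \<in> {a<..<b} in lebesgue. x \<in> ?C" by eventually_elim auto
  have "{a<..<b} \<subseteq> ?C"
  proof
    fix x assume "x \<in> {a<..<b}"
    then show "x \<in> ?C" using mem_closed_if_AE_lebesgue_open[OF open_greaterThanLessThan C ae] by blast
  qed
  then have "closure {a<..<b} \<subseteq> ?C" using C by (rule closure_minimal)
  then show ?thesis using ab t by auto
qed

lemma cont_rep_eq:
  assumes ab: "a < b" and F: "continuous_on {a..b} F" "AE x in leb a b. F x = f x" and t: "t \<in> {a..b}"
  shows "cont_rep a b f t = F t"
proof -
  have "continuous_on {a..b} (cont_rep a b f) \<and> (AE x in leb a b. cont_rep a b f x = f x)"
    unfolding cont_rep_def by (rule someI[of _ F]) (use F in auto)
  moreover have "AE x in leb a b. cont_rep a b f x = F x"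
    using conjunct2[OF calculation] F(2) by eventually_elim simp
  ultimately show ?thesis using continuous_AE_eq_imp_eq[OF ab _ F(1) _ t] by blast
qed

text \<open>
The choices of representatives that underlie weak derivatives and traces are harmless: for a
function that starts a chain, they yield the members of the chain.
\<close>

lemma
  assumes ab: "a < b" and F: "sob_chain a b n F" and f: "f \<in> L2_fun a b" "AE x in leb a b. f x = F 0 x"
  shows sob_chain_sobolev: "f \<in> sobolev a b n"
    and sob_chain_wderiv: "\<And>k. k \<le> n \<Longrightarrow> AE x in leb a b. wderiv a b k f x = F k x"
    and sob_chain_wderiv_L2: "\<And>k. k \<le> n \<Longrightarrow> wderiv a b k f \<in> L2_fun a b"
    and sob_chain_trace: "\<And>k t. k < n \<Longrightarrow> t \<in> {a..b} \<Longrightarrow> cont_rep a b (wderiv a b k f) t = F k t"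
proof -
  note w = sob_chain_weak_deriv[OF ab F f]
  show "f \<in> sobolev a b n" using w f(1) by (auto simp: sobolev_def)
  have wd: "is_weak_deriv a b k f (wderiv a b k f)" if "k \<le> n" for k
    unfolding wderiv_def by (rule someI[where x="F k"], rule w[OF that])
  then show "wderiv a b k f \<in> L2_fun a b" if "k \<le> n" for k using that by (simp add: is_weak_deriv_def)
  show ae: "AE x in leb a b. wderiv a b k f x = F k x" if "k \<le> n" for k
    using weak_deriv_unique[OF wd w] that by blast
  show "cont_rep a b (wderiv a b k f) t = F k t" if "k < n" "t \<in> {a..b}" for k t
  proof (rule cont_rep_eq[OF ab sob_chain_continuous[OF F that(1)] _ that(2)])
    show "AE x in leb a b. F k x = wderiv a b k f x" using ae[of k] that by auto
  qed
qed

section \<open>Spectral theory of symmetric matrices\<close>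

lemma symmetric_inner:
  fixes M :: "real^'m^'m"
  assumes "transpose M = M"
  shows "inner (M *v v) w = inner v (M *v w)"
  by (metis assms dot_lmul_matrix transpose_matrix_vector)

text \<open>
A maximizer \<open>v\<close> of the quadratic form on the unit sphere of \<open>E\<close> is an eigenvector. With the maximum
\<open>\<mu>\<close>, the form \<open>q w = \<mu> \<bar>w\<bar>\<^sup>2 - \<langle>w, M w\<rangle>\<close> is nonnegative on \<open>E\<close> and vanishes at \<open>v\<close>. Moving from \<open>v\<close> in
the direction \<open>z = M v - \<mu> v\<close> would make it negative unless \<open>z = 0\<close>.
\<close>

lemma symmetric_has_eigenvector:
  fixes M :: "real^'m^'m"
  assumes M: "transpose M = M" and E: "subspace E" and inv: "\<And>v. v \<in> E \<Longrightarrow> M *v v \<in> E"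
    and ne: "E \<noteq> {0}"
  shows "\<exists>v\<in>E. norm v = 1 \<and> (\<exists>\<mu>. M *v v = \<mu> *\<^sub>R v)"
proof -
  let ?S = "E \<inter> sphere 0 1"
  have "compact ?S" by (intro closed_Int_compact closed_subspace E compact_sphere)
  moreover have "?S \<noteq> {}"
  proof -
    obtain u where u: "u \<in> E" "u \<noteq> 0" using ne subspace_0[OF E] by blast
    then have "u /\<^sub>R norm u \<in> ?S" by (auto intro: subspace_scale[OF E])
    then show ?thesis by blast
  qed
  moreover have "continuous_on ?S (\<lambda>v. inner v (M *v v))"
    by (intro continuous_on_inner continuous_on_id matrix_vector_mult_linear_continuous_on)
  ultimately have "\<exists>v\<in>?S. \<forall>w\<in>?S. inner w (M *v w) \<le> inner v (M *v v)"
    by (rule continuous_attains_sup)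
  then obtain v where v: "v \<in> ?S" and max: "\<And>w. w \<in> ?S \<Longrightarrow> inner w (M *v w) \<le> inner v (M *v v)"
    by blast
  define \<mu> where "\<mu> = inner v (M *v v)"
  define q where "q w = \<mu> * inner w w - inner w (M *v w)" for w
  have vn: "norm v = 1" "v \<in> E" using v by auto
  have q_nonneg: "q w \<ge> 0" if "w \<in> E" for w
  proof (cases "w = 0")
    case False
    have "w /\<^sub>R norm w \<in> ?S" using that False by (auto intro: subspace_scale[OF E])
    from max[OF this] have "inner w (M *v w) / (norm w)\<^sup>2 \<le> \<mu>"
      by (simp add: \<mu>_def matrix_vector_mult_scaleR power2_eq_square field_simps)
    then show ?thesis using False by (simp add: q_def divide_le_eq dot_square_norm)
  qed (simp add: q_def)
  have q_line: "q (v + t *\<^sub>R w) = 2 * t * inner w (\<mu> *\<^sub>R v - M *v v) + t\<^sup>2 * q w" for t w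
    using symmetric_inner[OF M, of v w] vn(1)
    by (simp add: q_def \<mu>_def[symmetric] matrix_vector_right_distrib matrix_vector_mult_scaleR
        inner_left_distrib inner_right_distrib inner_diff_right inner_commute algebra_simps
        power2_eq_square norm_eq_1)
  define z where "z = M *v v - \<mu> *\<^sub>R v"
  have zE: "z \<in> E" unfolding z_def by (intro subspace_diff[OF E] inv subspace_scale[OF E] vn)
  have ineq: "2 * t * (norm z)\<^sup>2 \<le> t\<^sup>2 * q z" for t
  proof -
    have "0 \<le> q (v + t *\<^sub>R z)" by (intro q_nonneg subspace_add[OF E] subspace_scale[OF E] vn zE)
    moreover have "\<mu> *\<^sub>R v - M *v v = - z" by (simp add: z_def)
    ultimately show ?thesis unfolding q_line by (simp add: dot_square_norm)
  qed
  have "norm z = 0"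
  proof (cases "q z = 0")
    case True
    then show ?thesis using ineq[of 1] by simp
  next
    case False
    then have "q z > 0" using q_nonneg[OF zE] by simp
    then have "2 * ((norm z)\<^sup>2)\<^sup>2 \<le> ((norm z)\<^sup>2)\<^sup>2"
      using ineq[of "(norm z)\<^sup>2 / q z"] by (simp add: field_simps power2_eq_square)
    then show ?thesis by simp
  qed
  then show ?thesis using vn by (auto simp: z_def)
qed

text \<open>
Induction on the dimension: the vectors of \<open>E\<close> that are orthogonal to an eigenvector again form an
invariant subspace. The lemma is stated for invariant subspaces because it is applied both to \<open>E_plus M\<close>
and to the orthogonal complement of the two eigenspaces.
\<close>

lemma symmetric_eigenbasis:
  fixes M :: "real^'m^'m"
  assumes M: "transpose M = M"
  shows "subspace E \<Longrightarrow> (\<And>v. v \<in> E \<Longrightarrow> M *v v \<in> E) \<Longrightarrow>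
    \<exists>B. finite B \<and> B \<subseteq> E \<and> span B = E \<and> pairwise orthogonal B \<and>
      (\<forall>b\<in>B. norm b = 1 \<and> (\<exists>\<mu>. M *v b = \<mu> *\<^sub>R b))"
proof (induction "dim E" arbitrary: E rule: less_induct)
  case less
  show ?case
  proof (cases "E = {0}")
    case True
    then show ?thesis by (intro exI[of _ "{}"]) auto
  next
    case False
    then obtain v \<mu> where v: "v \<in> E" "norm v = 1" "M *v v = \<mu> *\<^sub>R v"
      using symmetric_has_eigenvector[OF M less.prems] by blast
    define E' where "E' = E \<inter> {w. inner v w = 0}"
    have E': "subspace E'"
      unfolding E'_def by (intro subspace_inter less.prems(1) subspace_hyperplane)
    have inv': "M *v w \<in> E'" if "w \<in> E'" for w
      using that less.prems(2) symmetric_inner[OF M, of v w] v(3) by (auto simp: E'_def)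
    have "v \<notin> E'" using v(2) by (auto simp: E'_def)
    then have "E' \<subset> E" using v(1) unfolding E'_def by blast
    then have "span E' \<subset> span E" using E' less.prems(1) by (simp add: span_eq_iff[THEN iffD2])
    then have "dim E' < dim E" by (rule dim_psubset)
    from less.hyps[OF this E' inv'] obtain B where B: "finite B" "B \<subseteq> E'" "span B = E'"
      "pairwise orthogonal B" "\<And>b. b \<in> B \<Longrightarrow> norm b = 1 \<and> (\<exists>\<mu>. M *v b = \<mu> *\<^sub>R b)" by blast
    have "E \<subseteq> span (insert v B)"
    proof
      fix w assume w: "w \<in> E"
      have "w - inner v w *\<^sub>R v \<in> E'"
        using w v less.prems(1)
        by (auto simp: E'_def inner_diff_right norm_eq_1 intro: subspace_diff subspace_scale)
      then have "w - inner v w *\<^sub>R v \<in> span (insert v B)" using B(3) span_mono[of B "insert v B"] by auto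
      from span_add[OF this span_scale[OF span_base[of v "insert v B"], of "inner v w"]]
      have "(w - inner v w *\<^sub>R v) + inner v w *\<^sub>R v \<in> span (insert v B)" by blast
      then show "w \<in> span (insert v B)" by simp
    qed
    moreover have sub: "insert v B \<subseteq> E" using v B(2) by (auto simp: E'_def)
    ultimately have "span (insert v B) = E" using span_minimal[OF sub less.prems(1)] by blast
    moreover have "pairwise orthogonal (insert v B)"
      using B(2,4) by (auto simp: pairwise_insert orthogonal_def E'_def inner_commute)
    ultimately show ?thesis using B v sub by (intro exI[of _ "insert v B"]) auto
  qed
qed

text \<open>
The adjoint of the embedding of a subspace is the orthogonal projection onto it.
\<close>

lemma emb_adj:
  fixes E :: "(real^'m) set"
  assumes E: "subspace E"
  shows emb_adj_in: "emb_adj E v \<in> E"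
    and emb_adj_inner: "u \<in> E \<Longrightarrow> inner u (emb_adj E v) = inner u v"
    and emb_adj_eqI: "w \<in> E \<Longrightarrow> (\<And>u. u \<in> E \<Longrightarrow> inner u w = inner u v) \<Longrightarrow> emb_adj E v = w"
proof -
  have uniq: "w = w'" if "w \<in> E" "w' \<in> E" "\<And>u. u \<in> E \<Longrightarrow> inner u w = inner u v"
    "\<And>u. u \<in> E \<Longrightarrow> inner u w' = inner u v" for w w'
  proof -
    have "inner (w - w') (w - w') = 0"
      using that(3,4)[OF subspace_diff[OF E that(1,2)]] by (simp add: inner_diff_right)
    then show ?thesis by simp
  qed
  obtain y z where yz: "y \<in> span E" "\<And>w. w \<in> span E \<Longrightarrow> orthogonal z w" "v = y + z"
    using orthogonal_subspace_decomp_exists by blast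
  have sp: "span E = E" using E by (simp add: span_eq_iff)
  have "\<exists>!w. w \<in> E \<and> (\<forall>u\<in>E. inner u w = inner u v)"
  proof (rule ex1I[of _ y])
    show "y \<in> E \<and> (\<forall>u\<in>E. inner u y = inner u v)"
      using yz sp by (auto simp: inner_right_distrib orthogonal_def inner_commute)
  qed (use uniq yz sp in \<open>auto simp: inner_right_distrib orthogonal_def inner_commute\<close>)
  from theI'[OF this] show a: "emb_adj E v \<in> E" and b: "u \<in> E \<Longrightarrow> inner u (emb_adj E v) = inner u v" for u
    unfolding emb_adj_def by auto
  show "emb_adj E v = w" if "w \<in> E" "\<And>u. u \<in> E \<Longrightarrow> inner u w = inner u v"
    by (rule uniq) (use a b that in auto)
qed

lemma emb_adj_linear:
  fixes E :: "(real^'m) set"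
  assumes E: "subspace E"
  shows "linear (emb_adj E)"
proof (rule linearI)
  show "emb_adj E (x + y) = emb_adj E x + emb_adj E y" for x y
    by (rule emb_adj_eqI[OF E]) (auto simp: inner_right_distrib emb_adj_inner[OF E] intro: subspace_add[OF E] emb_adj_in[OF E])
  show "emb_adj E (c *\<^sub>R x) = c *\<^sub>R emb_adj E x" for c x
    by (rule emb_adj_eqI[OF E]) (auto simp: emb_adj_inner[OF E] intro: subspace_scale[OF E] emb_adj_in[OF E])
qed

lemma subspace_E_plus: "subspace (E_plus M)"
  by (simp add: E_plus_def)

lemma E_plus_invariant:
  assumes "v \<in> E_plus M"
  shows "M *v v \<in> E_plus M"
  using assms unfolding E_plus_def
proof (induction rule: span_induct_alt)
  case base
  show ?case by (simp add: span_zero)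
next
  case (step c x y)
  then obtain \<mu> where "M *v x = \<mu> *\<^sub>R x" by blast
  then have "M *v (c *\<^sub>R x + y) = (c * \<mu>) *\<^sub>R x + M *v y"
    by (simp add: matrix_vector_right_distrib matrix_vector_mult_scaleR)
  then show ?case using span_add[OF span_scale[OF span_base[OF step(1)]] step(2)] by simp
qed

lemma eigenvectors_orthogonal:
  fixes M :: "real^'m^'m"
  assumes "transpose M = M" "M *v v = \<mu> *\<^sub>R v" "M *v w = \<nu> *\<^sub>R w" "\<mu> \<noteq> \<nu>"
  shows "inner v w = 0"
  using symmetric_inner[OF assms(1), of v w] assms by simp

lemma inner_span_0:
  assumes "\<And>x. x \<in> S \<Longrightarrow> inner u x = 0" "x \<in> span S"
  shows "inner u x = 0"
  using assms(2) by (induction rule: span_induct_alt) (auto simp: assms(1) inner_right_distrib)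

text \<open>
An eigenvector for an eigenvalue \<open>\<mu> \<le> 0\<close> is orthogonal to all generators of \<open>E_plus M\<close>, so it cannot
lie in that space.
\<close>

lemma E_plus_eigenvalue_pos:
  fixes M :: "real^'m^'m"
  assumes M: "transpose M = M" and b: "b \<in> E_plus M" "b \<noteq> 0" "M *v b = \<mu> *\<^sub>R b"
  shows "\<mu> > 0"
proof (rule ccontr)
  assume "\<not> \<mu> > 0"
  have "inner b x = 0" if "x \<in> {v. v \<noteq> 0 \<and> (\<exists>\<mu>>0. M *v v = \<mu> *\<^sub>R v)}" for x
  proof -
    obtain \<nu> where \<nu>: "\<nu> > 0" "M *v x = \<nu> *\<^sub>R x" using \<open>x \<in> _\<close> by blast
    show ?thesis by (rule eigenvectors_orthogonal[OF M b(3) \<nu>(2)]) (use \<nu> \<open>\<not> \<mu> > 0\<close> in auto)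
  qed
  from inner_span_0[OF this b(1)[unfolded E_plus_def]] have "inner b b = 0" .
  then show False using b by simp
qed

lemma uminus_matrix_vector_mult: "(- M) *v v = - (M *v v)"
  for M :: "real^'m^'n"
  by (simp add: matrix_vector_mult_def vec_eq_iff sum_negf)

text \<open>
This symmetry halves the work: everything about \<open>Q_minus M\<close> follows from facts about \<open>Q_plus (- M)\<close>.
\<close>

lemma E_minus_eq: "E_minus M = E_plus (- M)"
proof -
  have e: "(- M) *v v = \<mu> *\<^sub>R v \<longleftrightarrow> M *v v = (- \<mu>) *\<^sub>R v" for \<mu> v
    by (auto simp: uminus_matrix_vector_mult minus_equation_iff[of "M *v v"])
  have "(\<exists>\<mu><0. M *v v = \<mu> *\<^sub>R v) \<longleftrightarrow> (\<exists>\<mu>>0. M *v v = (- \<mu>) *\<^sub>R v)" for v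
    by (metis add.inverse_inverse neg_0_less_iff_less)
  then show ?thesis unfolding E_minus_def E_plus_def e by simp
qed

lemma Q_minus_eq: "Q_minus M = Q_plus (- M)"
  unfolding Q_minus_def Q_plus_def E_minus_eq ..

text \<open>
The function \<open>psd_sqrt_on\<close> picks some operator with the defining properties of a square root. An
eigenbasis of \<open>E_plus M\<close> provides one, and the properties alone determine the norm.
\<close>

lemma
  fixes M :: "real^'m^'m"
  assumes M: "transpose M = M"
  shows Q_plus_linear: "linear (Q_plus M)"
    and Q_plus_in: "Q_plus M v \<in> E_plus M"
    and Q_plus_norm: "(norm (Q_plus M v))\<^sup>2 = inner (emb_adj (E_plus M) v) (M *v emb_adj (E_plus M) v)"
proof -
  let ?E = "E_plus M"
  note E = subspace_E_plus[of M]
  obtain B where B: "finite B" "B \<subseteq> ?E" "span B = ?E" "pairwise orthogonal B"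
    "\<And>b. b \<in> B \<Longrightarrow> norm b = 1 \<and> (\<exists>\<mu>. M *v b = \<mu> *\<^sub>R b)"
    using symmetric_eigenbasis[OF M E E_plus_invariant] by blast
  define m where "m b = inner b (M *v b)" for b
  have m: "M *v b = m b *\<^sub>R b" "m b \<ge> 0" if b: "b \<in> B" for b
  proof -
    obtain \<mu> where \<mu>: "M *v b = \<mu> *\<^sub>R b" "norm b = 1" using B(5)[OF b] by blast
    then have "m b = \<mu>" by (simp add: m_def norm_eq_1)
    moreover have "\<mu> > 0" using \<mu> b B(2) by (intro E_plus_eigenvalue_pos[OF M _ _ \<mu>(1)]) auto
    ultimately show "M *v b = m b *\<^sub>R b" "m b \<ge> 0" using \<mu> by auto
  qed
  \<comment> \<open>the square root, diagonal in the eigenbasis\<close>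
  define S where "S v = (\<Sum>b\<in>B. (sqrt (m b) * inner v b) *\<^sub>R b)" for v
  have S_lin: "linear S"
    by (rule linearI) (simp_all add: S_def inner_left_distrib distrib_left scaleR_left_distrib
        sum.distrib scaleR_sum_right algebra_simps)
  have S_B: "S c = sqrt (m c) *\<^sub>R c" if c: "c \<in> B" for c
  proof -
    have "S c = (\<Sum>b\<in>B. if b = c then sqrt (m c) *\<^sub>R c else 0)"
      unfolding S_def
    proof (rule sum.cong)
      fix b assume b: "b \<in> B"
      show "(sqrt (m b) * inner c b) *\<^sub>R b = (if b = c then sqrt (m c) *\<^sub>R c else 0)"
        using B(4,5) b c by (auto simp: pairwise_def orthogonal_def norm_eq_1)
    qed simp
    then show ?thesis using B(1) c by simp
  qed
  have S_in: "S v \<in> ?E" for v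
    unfolding S_def B(3)[symmetric] by (intro span_sum span_scale span_base)
  have S_S: "S (S v) = M *v v" if "v \<in> ?E" for v
  proof (rule linear_eq_on_span[where B=B and f="\<lambda>v. S (S v)" and g="(*v) M"])
    show "linear (\<lambda>v. S (S v))" using linear_compose[OF S_lin S_lin] by (simp add: o_def)
    show "S (S b) = M *v b" if "b \<in> B" for b
      using m[OF that] by (simp add: S_B[OF that] linear_scale[OF S_lin])
  qed (use that B(3) in \<open>auto simp: matrix_vector_mul_linear\<close>)
  have S_pos: "inner (S v) v \<ge> 0" for v
    unfolding S_def inner_sum_left
    by (intro sum_nonneg) (use m in \<open>auto simp: inner_commute mult.assoc\<close>)
  have S_sym: "inner (S v) w = inner v (S w)" for v w
    unfolding S_def inner_sum_left inner_sum_right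
    by (intro sum.cong) (auto simp: inner_commute)
  let ?T = "\<lambda>w. emb_adj ?E (M *v w)"
  have T: "?T v = M *v v" if "v \<in> ?E" for v
    by (rule emb_adj_eqI[OF E]) (auto intro: E_plus_invariant that)
  define R where "R = psd_sqrt_on ?E ?T"
  have "linear R \<and> (\<forall>v\<in>?E. R v \<in> ?E \<and> R (R v) = ?T v \<and> inner (R v) v \<ge> 0) \<and>
     (\<forall>v\<in>?E. \<forall>w\<in>?E. inner (R v) w = inner v (R w))"
    unfolding R_def psd_sqrt_on_def
    by (rule someI[of _ S]) (use S_lin S_in S_S S_pos S_sym T in auto)
  then have R: "linear R" "\<And>v. v \<in> ?E \<Longrightarrow> R v \<in> ?E" "\<And>v. v \<in> ?E \<Longrightarrow> R (R v) = M *v v"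
    "\<And>v w. v \<in> ?E \<Longrightarrow> w \<in> ?E \<Longrightarrow> inner (R v) w = inner v (R w)"
    using T by auto
  have Q: "Q_plus M = R \<circ> emb_adj ?E"
    by (auto simp: Q_plus_def compressed_sqrt_def R_def fun_eq_iff)
  show "linear (Q_plus M)" unfolding Q by (intro linear_compose emb_adj_linear E R)
  show "Q_plus M v \<in> ?E" unfolding Q using R(2) emb_adj_in[OF E] by simp
  show "(norm (Q_plus M v))\<^sup>2 = inner (emb_adj ?E v) (M *v emb_adj ?E v)"
    unfolding Q using R(2-4) emb_adj_in[OF E, of v] by (simp add: dot_square_norm[symmetric])
qed

lemma E_plus_orthogonal:
  fixes M :: "real^'m^'m"
  assumes M: "transpose M = M" and v: "v \<in> E_plus M" and w: "w \<in> E_plus (- M)"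
  shows "inner v w = 0"
proof -
  have "inner x y = 0" if "\<mu> > 0" "M *v x = \<mu> *\<^sub>R x" "\<nu> > 0" "(- M) *v y = \<nu> *\<^sub>R y" for x y \<mu> \<nu>
  proof -
    have "M *v y = (- \<nu>) *\<^sub>R y"
      using that(4) by (auto simp: uminus_matrix_vector_mult minus_equation_iff[of "M *v y"])
    then show ?thesis by (rule eigenvectors_orthogonal[OF M that(2)]) (use that in auto)
  qed
  then have "inner x w = 0" if "\<exists>\<mu>>0. M *v x = \<mu> *\<^sub>R x" for x
    using that w unfolding E_plus_def by (intro inner_span_0[OF _ w[unfolded E_plus_def]]) blast
  then have "inner w v = 0"
    by (intro inner_span_0[OF _ v[unfolded E_plus_def]]) (auto simp: inner_commute)
  then show ?thesis by (simp add: inner_commute)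
qed

text \<open>
The rest \<open>r\<close> of \<open>v\<close> after both projections lies in an invariant subspace orthogonal to all
eigenvectors with nonzero eigenvalue. An eigenbasis of this subspace shows that \<open>M\<close> vanishes on it, so
only the two projections contribute to the form.
\<close>

lemma quadratic_form_Q_plus_Q_minus:
  fixes M :: "real^'m^'m"
  assumes M: "transpose M = M"
  shows "inner v (M *v v) = (norm (Q_plus M v))\<^sup>2 - (norm (Q_minus M v))\<^sup>2"
proof -
  have M': "transpose (- M) = - M" using M by (simp add: transpose_def vec_eq_iff)
  let ?p = "emb_adj (E_plus M) v" and ?n = "emb_adj (E_plus (- M)) v"
  note Ep = subspace_E_plus[of M] and En = subspace_E_plus[of "- M"]
  note p = emb_adj_in[OF Ep, of v] and n = emb_adj_in[OF En, of v]
  define r where "r = v - ?p - ?n"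
  have r_orth: "inner u r = 0" if "u \<in> E_plus M \<or> u \<in> E_plus (- M)" for u
    using that emb_adj_inner[OF Ep, of u v] emb_adj_inner[OF En, of u v]
      E_plus_orthogonal[OF M _ n] E_plus_orthogonal[OF M p]
    by (auto simp: r_def inner_diff_right inner_commute)
  define Z where "Z = {w. \<forall>u \<in> E_plus M \<union> E_plus (- M). inner u w = 0}"
  have Zsub: "subspace Z" unfolding Z_def subspace_def by (auto simp: inner_right_distrib)
  have Minv: "M *v u \<in> E_plus (- M)" if "u \<in> E_plus (- M)" for u
  proof -
    have "- ((- M) *v u) \<in> E_plus (- M)" by (intro subspace_neg[OF En] E_plus_invariant that)
    then show ?thesis by (simp add: uminus_matrix_vector_mult)
  qed
  have Zinv: "M *v w \<in> Z" if "w \<in> Z" for w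
    using that E_plus_invariant[of _ M] Minv
    by (auto simp: Z_def symmetric_inner[OF M, symmetric])
  obtain B where B: "B \<subseteq> Z" "span B = Z" "\<And>b. b \<in> B \<Longrightarrow> norm b = 1 \<and> (\<exists>\<mu>. M *v b = \<mu> *\<^sub>R b)"
    using symmetric_eigenbasis[OF M Zsub Zinv] by blast
  have B0: "M *v b = 0" if b: "b \<in> B" for b
  proof -
    obtain \<mu> where \<mu>: "M *v b = \<mu> *\<^sub>R b" "norm b = 1" using B(3)[OF b] by blast
    have nb: "b \<noteq> 0" using \<mu> by auto
    have m: "(- M) *v b = (- \<mu>) *\<^sub>R b" using \<mu> by (simp add: uminus_matrix_vector_mult)
    have "\<not> \<mu> > 0"
    proof
      assume "\<mu> > 0"
      then have "b \<in> E_plus M" unfolding E_plus_def using \<mu> nb by (intro span_base) auto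
      then have "inner b b = 0" using B(1) b unfolding Z_def by blast
      then show False using nb by simp
    qed
    moreover have "\<not> \<mu> < 0"
    proof
      assume "\<mu> < 0"
      then have "b \<in> E_plus (- M)" unfolding E_plus_def using m nb
        by (intro span_base) (auto intro!: exI[of _ "- \<mu>"])
      then have "inner b b = 0" using B(1) b unfolding Z_def by blast
      then show False using nb by simp
    qed
    ultimately show ?thesis using \<mu> by auto
  qed
  have "r \<in> span B" using r_orth B(2) by (auto simp: Z_def)
  then have Mr: "M *v r = 0"
    by (induction rule: span_induct_alt) (auto simp: B0 matrix_vector_right_distrib matrix_vector_mult_scaleR)
  have v: "v = ?p + ?n + r" by (simp add: r_def)
  have "M *v v = M *v ?p + M *v ?n"
    by (subst v) (simp only: matrix_vector_right_distrib Mr add_0_right)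
  moreover have "inner v (M *v ?p) = inner ?p (M *v ?p)"
    using emb_adj_inner[OF Ep E_plus_invariant[OF p], of v] by (simp add: inner_commute)
  moreover have "inner v (M *v ?n) = inner ?n (M *v ?n)"
    using emb_adj_inner[OF En Minv[OF n], of v] by (simp add: inner_commute)
  moreover have "(norm (Q_minus M v))\<^sup>2 = - inner ?n (M *v ?n)"
    unfolding Q_minus_eq Q_plus_norm[OF M'] by (simp add: uminus_matrix_vector_mult)
  ultimately show ?thesis using Q_plus_norm[OF M, of v] by (simp add: inner_right_distrib)
qed

lemma Q_minus_linear:
  fixes M :: "real^'m^'m"
  assumes M: "transpose M = M"
  shows "linear (Q_minus M)"
  unfolding Q_minus_eq by (rule Q_plus_linear) (use M in \<open>simp add: transpose_def vec_eq_iff\<close>)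

text \<open>
The ranges of \<open>Q_plus M\<close> and \<open>Q_minus M\<close> are orthogonal, so Pythagoras' theorem allows to
regroup the four terms and thereby to exchange the roles of the end points.
\<close>

lemma boundary_form_difference:
  fixes M :: "real^'m^'m"
  assumes M: "transpose M = M"
  shows "inner x (M *v x) - inner y (M *v y) =
    (norm (Q_plus M x + Q_minus M y))\<^sup>2 - (norm (Q_minus M x + Q_plus M y))\<^sup>2"
proof -
  have M': "transpose (- M) = - M" using M by (simp add: transpose_def vec_eq_iff)
  have "inner (Q_plus M u) (Q_minus M w) = 0" for u w
    unfolding Q_minus_eq by (intro E_plus_orthogonal[OF M] Q_plus_in M M')
  then have o: "(norm (Q_plus M u + Q_minus M w))\<^sup>2 = (norm (Q_plus M u))\<^sup>2 + (norm (Q_minus M w))\<^sup>2" for u w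
    by (simp add: norm_add_Pythagorean orthogonal_def)
  show ?thesis
    using o[of x y] o[of y x] quadratic_form_Q_plus_Q_minus[OF M, of x] quadratic_form_Q_plus_Q_minus[OF M, of y]
    by (simp add: add.commute)
qed

section \<open>The boundary matrix and the energy identity\<close>

lemma pos_strict_mono: "strict_mono (pos :: 'n::{finite,linorder} \<Rightarrow> nat)"
proof (rule strict_monoI)
  fix i j :: 'n assume "i < j"
  then have "{..i} \<subset> {..j}" by auto
  then show "pos i < pos j" unfolding pos_def by (intro psubset_card_mono) auto
qed

lemma pos_bij: "bij_betw (pos :: 'n::{finite,linorder} \<Rightarrow> nat) UNIV {1..CARD('n)}"
proof -
  have inj: "inj (pos :: 'n \<Rightarrow> nat)" by (rule strict_mono_imp_inj_on[OF pos_strict_mono])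
  have "range (pos :: 'n \<Rightarrow> nat) \<subseteq> {1..CARD('n)}"
  proof safe
    fix j :: 'n
    have "card {j} \<le> card {..j}" by (rule card_mono) auto
    moreover have "card {..j} \<le> CARD('n)" by (rule card_mono) auto
    ultimately show "pos j \<in> {1..CARD('n)}" by (simp add: pos_def)
  qed
  moreover have "card (range (pos :: 'n \<Rightarrow> nat)) = CARD('n)" using inj by (simp add: card_image)
  ultimately have "range (pos :: 'n \<Rightarrow> nat) = {1..CARD('n)}" by (intro card_subset_eq) auto
  with inj show ?thesis by (simp add: bij_betw_def)
qed

lemma pos_range: "1 \<le> pos j" "pos j \<le> CARD('n)" for j :: "'n::{finite,linorder}"
proof -
  have "pos j \<in> {1..CARD('n)}" using bij_betwE[OF pos_bij] by blast
  then show "1 \<le> pos j" "pos j \<le> CARD('n)" by auto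
qed

lemma sum_pos: "(\<Sum>j\<in>UNIV. f (pos (j :: 'n::{finite,linorder}) - 1)) = (\<Sum>k<CARD('n). f k)"
proof -
  have "(\<Sum>j\<in>UNIV. f (pos (j :: 'n) - 1)) = (\<Sum>k\<in>{1..CARD('n)}. f (k - 1))"
    by (rule sum.reindex_bij_betw[OF pos_bij])
  also have "\<dots> = (\<Sum>k<CARD('n). f k)"
    by (rule sum.reindex_bij_witness[of _ Suc "\<lambda>k. k - 1"]) auto
  finally show ?thesis .
qed

text \<open>
The trace vector as a function of the values of the derivatives at one point.
\<close>

definition stack :: "(nat \<Rightarrow> real^'d) \<Rightarrow> real^('n::{finite,linorder} \<times> 'd::finite)" where
  "stack w = (\<chi> s. case s of (j, p) \<Rightarrow> w (pos j - 1) $ p)"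

lemma sgn_transpose_entry:
  assumes "transpose A = (-1) ^ (k + 1) *\<^sub>R (A :: real^'d^'d)"
  shows "A $ q $ p = (-1) ^ (k + 1) * A $ p $ q"
proof -
  have "A $ q $ p = transpose A $ p $ q" by (simp add: transpose_def)
  then show ?thesis by (simp add: assms)
qed

text \<open>
The signs of the blocks \<open>(j, i)\<close> and \<open>(i, j)\<close> differ by \<open>(-1)\<^bsup>i-j\<^esup>\<close>, and this is the sign by which
\<open>P\<^bsub>i+j-1\<^esub>\<close> differs from its transpose.
\<close>

lemma Qmat_symmetric:
  fixes P :: "nat \<Rightarrow> real^'d^'d"
  assumes P: "\<And>j. j \<le> CARD('n) \<Longrightarrow> transpose (P j) = (-1) ^ (j + 1) *\<^sub>R P j"
  shows "transpose (Qmat P) = (Qmat P :: real^('n::{finite,linorder} \<times> 'd::finite)^('n \<times> 'd))"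
proof -
  have "Qmat P $ s $ t = Qmat P $ t $ s" for s t :: "'n \<times> 'd"
  proof (cases s; cases t)
    fix j i :: 'n and p q :: 'd assume s: "s = (j, p)" and t: "t = (i, q)"
    define k where "k = pos i + pos j - 1"
    have k: "k + 1 = pos i + pos j" using pos_range(1)[of i] by (simp add: k_def)
    have k': "pos i + pos j - Suc 0 = k" "pos j + pos i - Suc 0 = k" by (simp_all add: k_def)
    show ?thesis
    proof (cases "k \<le> CARD('n)")
      case True
      have "(-1) ^ (pos i + 1) * P k $ q $ p = (-1) ^ (pos i + 1 + (k + 1)) * P k $ p $ q"
        by (subst sgn_transpose_entry[OF P[OF True]]) (simp add: power_add)
      also have "(-1::real) ^ (pos i + 1 + (k + 1)) = (-1) ^ (pos j + 1)"
        unfolding k by (simp add: power_add)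
      finally show ?thesis using True by (simp add: Qmat_def s t k')
    next
      case False
      then show ?thesis by (simp add: Qmat_def s t k')
    qed
  qed
  then show ?thesis by (simp add: transpose_def vec_eq_iff)
qed

lemma sum_UNIV_prod: "(\<Sum>s\<in>UNIV. f s) = (\<Sum>j\<in>UNIV. \<Sum>p\<in>UNIV. f (j, p))"
  for f :: "'a::finite \<times> 'b::finite \<Rightarrow> 'c::comm_monoid_add"
  by (simp add: sum.cartesian_product)

text \<open>
The blocks of the matrix are constant, up to sign, on the antidiagonals \<open>i + j = k + 1\<close>; summing along
them collects the terms that belong to the same coefficient.
\<close>

lemma inner_Qmat_stack:
  fixes P :: "nat \<Rightarrow> real^'d^'d" and w :: "nat \<Rightarrow> real^'d"
  defines "\<tau> \<equiv> stack w :: real^('n::{finite,linorder} \<times> 'd::finite)"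
  shows "inner \<tau> (Qmat P *v \<tau>) =
    (\<Sum>k<CARD('n). \<Sum>j\<le>k. (-1) ^ j * inner (w j) (P (Suc k) *v w (k - j)))"
proof -
  let ?n = "CARD('n)"
  have "inner \<tau> (Qmat P *v \<tau>) = (\<Sum>s\<in>UNIV. \<Sum>t\<in>UNIV. \<tau> $ s * (Qmat P $ s $ t * \<tau> $ t))"
    by (simp add: inner_vec_def matrix_vector_mult_def sum_distrib_left)
  also have "\<dots> = (\<Sum>j\<in>UNIV. \<Sum>p\<in>UNIV. \<Sum>i\<in>UNIV. \<Sum>q\<in>UNIV.
      \<tau> $ (j, p) * (Qmat P $ (j, p) $ (i, q) * \<tau> $ (i, q)))"
    unfolding sum_UNIV_prod ..
  also have "\<dots> = (\<Sum>j\<in>UNIV. \<Sum>i\<in>UNIV. \<Sum>p\<in>UNIV. \<Sum>q\<in>UNIV.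
      \<tau> $ (j, p) * (Qmat P $ (j, p) $ (i, q) * \<tau> $ (i, q)))"
    by (intro sum.cong refl sum.swap)
  also have "\<dots> = (\<Sum>j\<in>UNIV. \<Sum>i\<in>UNIV. (\<lambda>J I. if J + I < ?n then
      (-1) ^ J * inner (w J) (P (Suc (J + I)) *v w I) else 0) (pos (j::'n) - 1) (pos (i::'n) - 1))"
  proof (intro sum.cong refl)
    fix i j :: 'n
    obtain I J where IJ: "pos i = Suc I" "pos j = Suc J"
      using pos_range(1)[of i] pos_range(1)[of j] by (metis One_nat_def Suc_le_D)
    show "(\<Sum>p\<in>UNIV. \<Sum>q\<in>UNIV. \<tau> $ (j, p) * (Qmat P $ (j, p) $ (i, q) * \<tau> $ (i, q))) =
      (\<lambda>J I. if J + I < ?n then (-1) ^ J * inner (w J) (P (Suc (J + I)) *v w I) else 0) (pos j - 1) (pos i - 1)"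
      by (simp add: \<tau>_def stack_def Qmat_def IJ inner_vec_def matrix_vector_mult_def sum_distrib_left
          Suc_le_eq add.commute mult_ac)
  qed
  also have "\<dots> = (\<Sum>J<?n. \<Sum>I<?n. if J + I < ?n then (-1) ^ J * inner (w J) (P (Suc (J + I)) *v w I) else 0)"
    unfolding sum_pos[where 'n='n and f="\<lambda>I. (\<lambda>J I. if J + I < ?n then
      (-1) ^ J * inner (w J) (P (Suc (J + I)) *v w I) else 0) _ I"]
    by (subst sum_pos[where 'n='n, symmetric]) simp
  also have "\<dots> = (\<Sum>(J, I)\<in>{..<?n} \<times> {..<?n}. if J + I < ?n then (-1) ^ J * inner (w J) (P (Suc (J + I)) *v w I) else 0)"
    by (rule sum.cartesian_product)
  also have "\<dots> = (\<Sum>(J, I)\<in>{(J, I). J + I < ?n}. (-1) ^ J * inner (w J) (P (Suc (J + I)) *v w I))"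
    by (rule sum.mono_neutral_cong_right) (auto split: if_splits)
  also have "\<dots> = (\<Sum>k<?n. \<Sum>j\<le>k. (-1) ^ j * inner (w j) (P (Suc k) *v w (k - j)))"
    by (subst sum.triangle_reindex) simp
  finally show ?thesis .
qed

definition vec_chain :: "real \<Rightarrow> real \<Rightarrow> nat \<Rightarrow> (nat \<Rightarrow> real \<Rightarrow> real^'d) \<Rightarrow> bool" where
  "vec_chain a b n W \<longleftrightarrow> (\<forall>p. sob_chain a b n (\<lambda>k x. W k x $ p))"

lemma vec_chainD: "vec_chain a b n W \<Longrightarrow> sob_chain a b n (\<lambda>k x. W k x $ p)"
  by (simp add: vec_chain_def)

lemma inner_matrix_expand:
  "inner v (A *v w) = (\<Sum>p\<in>UNIV. \<Sum>q\<in>UNIV. A $ p $ q * (v $ p * w $ q))"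
  for A :: "real^'d^'d"
  by (simp add: inner_vec_def matrix_vector_mult_def sum_distrib_left mult.left_commute)

lemma vec_chain_integrable:
  assumes W: "vec_chain a b n W" and "j \<le> n" "i \<le> n"
  shows "integrable (leb a b) (\<lambda>x. inner (W j x) (A *v W i x))"
proof -
  have "integrable (leb a b) (\<lambda>x. W j x $ p * W i x $ q)" for p q
    by (rule L2_mult_integrable) (use assms sob_chain_L2[OF vec_chainD[OF W]] in auto)
  then show ?thesis unfolding inner_matrix_expand by (intro Bochner_Integration.integrable_sum integrable_mult_right)
qed

lemma vec_chain_by_parts:
  assumes ab: "a < b" and W: "vec_chain a b n W" and ji: "j < n" "i < n"
  shows "inner (W j b) (A *v W i b) - inner (W j a) (A *v W i a) =
    (LINT x|leb a b. inner (W (Suc j) x) (A *v W i x)) + (LINT x|leb a b. inner (W j x) (A *v W (Suc i) x))"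
proof -
  note L = sob_chain_L2[OF vec_chainD[OF W]]
  have int: "integrable (leb a b) (\<lambda>x. W k x $ p * W l x $ q)" if "k \<le> n" "l \<le> n" for k l p q
    using that by (intro L2_mult_integrable L)
  have "W j b $ p * W i b $ q - W j a $ p * W i a $ q =
      (LINT x|leb a b. W (Suc j) x $ p * W i x $ q) + (LINT x|leb a b. W j x $ p * W (Suc i) x $ q)" for p q
    using sob_chain_by_parts[OF ab vec_chainD[OF W, of p] ji(1) vec_chainD[OF W, of q] ji(2)]
      int[of "Suc j" i p q] int[of j "Suc i" p q] ji by simp
  moreover have "(LINT x|leb a b. inner (W k x) (A *v W l x)) =
      (\<Sum>p\<in>UNIV. \<Sum>q\<in>UNIV. A $ p $ q * (LINT x|leb a b. W k x $ p * W l x $ q))" if "k \<le> n" "l \<le> n" for k l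
    unfolding inner_matrix_expand using int[OF that]
    by (subst Bochner_Integration.integral_sum | intro Bochner_Integration.integrable_sum sum.cong refl integrable_mult_right | simp)+
  ultimately show ?thesis
    unfolding inner_matrix_expand sum_subtractf[symmetric] right_diff_distrib[symmetric]
    using ji by (simp add: sum.distrib[symmetric] distrib_left[symmetric])
qed

lemma alternating_telescope:
  fixes Y :: "nat \<Rightarrow> real"
  shows "(\<Sum>j\<le>k. (-1) ^ j * (Y (Suc j) + Y j)) = Y 0 + (-1) ^ k * Y (Suc k)"
  by (induction k) (auto simp: algebra_simps)

lemma signed_symmetric_inner:
  fixes A :: "real^'d^'d"
  assumes "transpose A = (-1) ^ (k + 1) *\<^sub>R A"
  shows "inner v (A *v w) = (-1) ^ (k + 1) * inner w (A *v v)"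
proof -
  have "inner v (A *v w) = inner (transpose A *v v) w"
    by (metis dot_lmul_matrix transpose_matrix_vector)
  then show ?thesis
    unfolding assms scaleR_matrix_vector_assoc[symmetric] inner_scaleR_left by (simp add: inner_commute)
qed

text \<open>
For each \<open>k\<close>, integrating the terms \<open>(-1)\<^sup>j \<langle>w\<^sub>j, P\<^sub>k w\<^bsub>k-1-j\<^esub>\<rangle>\<close> of the boundary form by parts
produces a telescoping sum. Its two ends are equal because of the symmetry of \<open>P\<^sub>k\<close>, and they are the
contribution of \<open>P\<^sub>k w\<^sub>k\<close> to the left-hand side. The skew matrix \<open>P 0\<close> contributes nothing.
\<close>

lemma energy_identity:
  fixes P :: "nat \<Rightarrow> real^'d^'d" and W :: "nat \<Rightarrow> real \<Rightarrow> real^'d"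
  defines "\<tau> \<equiv> \<lambda>t. stack (\<lambda>k. W k t) :: real^('n::{finite,linorder} \<times> 'd::finite)"
  assumes ab: "a < b"
    and P: "\<And>j. j \<le> CARD('n) \<Longrightarrow> transpose (P j) = (-1) ^ (j + 1) *\<^sub>R P j"
    and W: "vec_chain a b CARD('n) W"
  shows "2 * (LINT x|leb a b. inner (W 0 x) (\<Sum>k=0..CARD('n). P k *v W k x)) =
    inner (\<tau> b) (Qmat P *v \<tau> b) - inner (\<tau> a) (Qmat P *v \<tau> a)"
proof -
  let ?n = "CARD('n)"
  define X where "X k j i = (LINT x|leb a b. inner (W j x) (P k *v W i x))" for k j i
  have "inner (\<tau> b) (Qmat P *v \<tau> b) - inner (\<tau> a) (Qmat P *v \<tau> a) =
      (\<Sum>k<?n. \<Sum>j\<le>k. (-1) ^ j * (inner (W j b) (P (Suc k) *v W (k - j) b) - inner (W j a) (P (Suc k) *v W (k - j) a)))"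
    unfolding \<tau>_def inner_Qmat_stack by (simp add: sum_subtractf right_diff_distrib)
  also have "\<dots> = (\<Sum>k<?n. \<Sum>j\<le>k. (-1) ^ j * (X (Suc k) (Suc j) (Suc k - Suc j) + X (Suc k) j (Suc k - j)))"
  proof (intro sum.cong refl arg_cong2[where f="(*)"])
    fix k j assume "k \<in> {..<?n}" "j \<in> {..k}"
    then have "j < ?n" "k - j < ?n" "Suc (k - j) = Suc k - j" by auto
    then show "inner (W j b) (P (Suc k) *v W (k - j) b) - inner (W j a) (P (Suc k) *v W (k - j) a) =
       X (Suc k) (Suc j) (Suc k - Suc j) + X (Suc k) j (Suc k - j)"
      unfolding X_def by (subst vec_chain_by_parts[OF ab W]) simp_all
  qed
  also have "\<dots> = (\<Sum>k<?n. 2 * X (Suc k) 0 (Suc k))"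
  proof (intro sum.cong refl)
    fix k assume "k \<in> {..<?n}"
    then have k: "Suc k \<le> ?n" by simp
    have "X (Suc k) (Suc k) 0 = (LINT x|leb a b. (-1) ^ (Suc k + 1) * inner (W 0 x) (P (Suc k) *v W (Suc k) x))"
      unfolding X_def by (subst signed_symmetric_inner[OF P[OF k]]) simp
    then have "X (Suc k) (Suc k) 0 = (-1) ^ k * X (Suc k) 0 (Suc k)" by (simp add: X_def)
    then show "(\<Sum>j\<le>k. (-1) ^ j * (X (Suc k) (Suc j) (Suc k - Suc j) + X (Suc k) j (Suc k - j))) = 2 * X (Suc k) 0 (Suc k)"
      using alternating_telescope[of "\<lambda>j. X (Suc k) j (Suc k - j)" k]
      by (simp add: mult.assoc[symmetric] power_mult_distrib[symmetric])
  qed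
  also have "\<dots> = 2 * (\<Sum>k\<le>?n. X k 0 k)"
  proof -
    have "inner v (P 0 *v v) = 0" for v using signed_symmetric_inner[OF P[of 0], of v v] by simp
    then have "X 0 0 0 = 0" by (simp add: X_def)
    then show ?thesis
      by (simp add: sum_distrib_left[symmetric] lessThan_Suc_atMost[symmetric] sum.lessThan_Suc_shift del: sum.lessThan_Suc)
  qed
  also have "(\<Sum>k\<le>?n. X k 0 k) = (LINT x|leb a b. (\<Sum>k\<le>?n. inner (W 0 x) (P k *v W k x)))"
    unfolding X_def by (rule Bochner_Integration.integral_sum[symmetric]) (auto intro: vec_chain_integrable[OF W])
  finally show ?thesis by (simp add: inner_sum_right atLeast0AtMost)
qed

section \<open>Linear differential equations with measurable coefficients\<close>

lemma prim_abs_le: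
  assumes f: "integrable (leb a b) f" and g: "integrable (leb a b) g"
    and le: "AE y in leb a b. \<bar>f y\<bar> \<le> g y"
  shows "\<bar>prim a b f x\<bar> \<le> prim a b g x"
proof -
  have "\<bar>prim a b f x\<bar> \<le> (LINT y|leb a b. \<bar>indicator {..x} y * f y\<bar>)"
    unfolding prim_def by (rule integral_abs_bound)
  also have "\<dots> \<le> prim a b g x"
    unfolding prim_def
  proof (rule integral_mono_AE)
    show "AE y in leb a b. \<bar>indicator {..x} y * f y\<bar> \<le> indicator {..x} y * g y"
      using le by eventually_elim (simp add: indicator_def)
  qed (intro integrable_abs prim_integrable f g)+
  finally show ?thesis .
qed

lemma prim_exp:
  assumes "\<kappa> > 0" "x \<in> {a..b}"
  shows "prim a b (\<lambda>y. exp (\<kappa> * (y - a))) x = (exp (\<kappa> * (x - a)) - 1) / \<kappa>"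
proof -
  have "exp (\<kappa> * (x - a)) / \<kappa> = exp (\<kappa> * (a - a)) / \<kappa> + prim a b (\<lambda>y. exp (\<kappa> * (y - a))) x"
    by (rule prim_of_DERIV)
       (use assms in \<open>auto intro!: derivative_eq_intros continuous_intros\<close>)
  then show ?thesis by (simp add: diff_divide_distrib)
qed

text \<open>
Picard iteration, globally on \<open>[a, b]\<close>: for the unknown \<open>V x = exp (-\<kappa> (x - a)) X x\<close> the integral
operator is a contraction in the supremum norm as soon as \<open>\<kappa>\<close> exceeds the Lipschitz constant times
the dimension; the choice below yields the factor \<open>1/2\<close>. Functions on \<open>[a, b]\<close> are extended to the line by clamping the argument, because
the complete space at hand consists of bounded continuous functions on the whole line.
\<close>

lemma caratheodory_existence:
  fixes L :: "real \<Rightarrow> real^'s \<Rightarrow> real^'s" and \<xi> :: "real^'s"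
  assumes ab: "a < b" and K: "K \<ge> 0"
    and lip: "AE y in leb a b. \<forall>v v' s. \<bar>L y v $ s - L y v' $ s\<bar> \<le> K * norm (v - v')"
    and L2: "\<And>V s. continuous_on {a..b} V \<Longrightarrow> (\<lambda>y. L y (V y) $ s) \<in> L2_fun a b"
  shows "\<exists>X. continuous_on {a..b} X \<and>
    (\<forall>x\<in>{a..b}. \<forall>s. X x $ s = \<xi> $ s + prim a b (\<lambda>y. L y (X y) $ s) x)"
proof -
  \<comment> \<open>the factor \<open>CARD('s)\<close> comes from bounding the norm by the sum of the components\<close>
  define \<kappa> where "\<kappa> = 2 * (real CARD('s) * K) + 1"
  have \<kappa>: "\<kappa> > 0" using K by (simp add: \<kappa>_def add_nonneg_pos)
  define e where "e y = exp (\<kappa> * (y - a))" for y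
  have e_cont: "continuous_on S e" for S unfolding e_def by (intro continuous_intros)
  have e_pos: "e y > 0" for y by (simp add: e_def)
  define R where "R V s y = L y (e y *\<^sub>R V y) $ s" for V s y
  have R_L2: "R V s \<in> L2_fun a b" if "continuous_on {a..b} V" for V s
    unfolding R_def by (rule L2) (intro continuous_intros that e_cont)
  \<comment> \<open>the Picard operator after the substitution \<open>X = e V\<close>\<close>
  define G where "G V x = (\<chi> s. (\<xi> $ s + prim a b (R V s) x) / e x)" for V x
  have G_cont: "continuous_on {a..b} (G V)" if "continuous_on {a..b} V" for V
    unfolding G_def
    by (intro continuous_on_vec_lambda continuous_intros prim_continuous L2_integrable R_L2 that e_cont)
       (use e_pos in \<open>auto simp: less_imp_neq[symmetric]\<close>)
  have "\<exists>\<Phi>V :: real \<Rightarrow>\<^sub>C (real^'s). \<forall>x. \<Phi>V x = G V (clamp a b x)" if "continuous_on {a..b} V" for V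
    using G_cont[OF that] continuous_on_cbox_bcontfunE[of a b "G V"] by (metis box_real(2))
  then have "\<forall>V :: real \<Rightarrow>\<^sub>C (real^'s). \<exists>\<Phi>V :: real \<Rightarrow>\<^sub>C (real^'s). \<forall>x. \<Phi>V x = G V (clamp a b x)"
    by simp
  then obtain \<Phi> :: "(real \<Rightarrow>\<^sub>C (real^'s)) \<Rightarrow> (real \<Rightarrow>\<^sub>C (real^'s))" where \<Phi>: "\<And>V x. \<Phi> V x = G V (clamp a b x)"
    by metis
  have G_lip: "dist (G V x) (G V' x) \<le> 1 / 2 * dist V V'" if x: "x \<in> {a..b}" for V V' :: "real \<Rightarrow>\<^sub>C (real^'s)" and x
  proof -
    define D where "D = dist V V'"
    have D: "norm (V y - V' y) \<le> D" for y unfolding D_def dist_norm[symmetric] by (rule dist_bounded)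
    have D0: "D \<ge> 0" by (simp add: D_def)
    have Ri: "integrable (leb a b) (R V s)" "integrable (leb a b) (R V' s)" for s
      by (intro L2_integrable R_L2 continuous_on_apply_bcontfun)+
    have ei: "integrable (leb a b) e" by (intro L2_integrable L2_continuous e_cont)
    have comp: "\<bar>(G V x - G V' x) $ s\<bar> \<le> K * D / \<kappa>" for s
    proof -
      have "\<bar>prim a b (\<lambda>y. R V s y + (-1) * R V' s y) x\<bar> \<le> prim a b (\<lambda>y. (K * D) * e y) x"
      proof (rule prim_abs_le)
        show "AE y in leb a b. \<bar>R V s y + (-1) * R V' s y\<bar> \<le> K * D * e y"
          using lip
        proof eventually_elim
          case (elim y)
          have "\<bar>R V s y - R V' s y\<bar> \<le> K * norm (e y *\<^sub>R V y - e y *\<^sub>R V' y)"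
            using elim by (simp add: R_def)
          also have "\<dots> = K * (e y * norm (V y - V' y))"
            using e_pos[of y] by (simp add: scaleR_diff_right[symmetric])
          also have "\<dots> \<le> K * (e y * D)"
            using D[of y] e_pos[of y] K by (intro mult_left_mono) auto
          finally show ?case by (simp add: mult_ac)
        qed
      qed (use Ri ei in auto)
      also have "\<dots> = K * D * ((e x - 1) / \<kappa>)"
        using prim_exp[OF \<kappa> x] by (simp add: prim_cmult e_def)
      also have "\<dots> \<le> K * D * (e x / \<kappa>)"
        using \<kappa> K D0 by (intro mult_left_mono divide_right_mono) auto
      finally have "\<bar>prim a b (R V s) x - prim a b (R V' s) x\<bar> \<le> K * D * (e x / \<kappa>)"
        using Ri prim_cmult[of a b "-1" "R V' s" x] by (subst (asm) prim_add) auto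
      then have "\<bar>prim a b (R V s) x - prim a b (R V' s) x\<bar> / e x \<le> K * D / \<kappa>"
        using e_pos[of x] by (simp add: divide_le_eq mult_ac)
      moreover have "(G V x - G V' x) $ s = (prim a b (R V s) x - prim a b (R V' s) x) / e x"
        by (simp add: G_def diff_divide_distrib add_divide_distrib)
      ultimately show ?thesis using e_pos[of x] by (simp add: abs_divide)
    qed
    have "norm (G V x - G V' x) \<le> (\<Sum>s\<in>UNIV. \<bar>(G V x - G V' x) $ s\<bar>)" by (rule norm_le_l1_cart)
    also have "\<dots> \<le> (\<Sum>s\<in>(UNIV::'s set). K * D / \<kappa>)" by (intro sum_mono comp)
    also have "\<dots> = (real CARD('s) * K / \<kappa>) * D" by simp
    also have "\<dots> \<le> 1 / 2 * D"
      using \<kappa> D0 by (intro mult_right_mono) (auto simp: divide_le_eq \<kappa>_def)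
    finally show ?thesis by (simp add: dist_norm D_def)
  qed
  have "\<exists>!V. \<Phi> V = V"
  proof (rule banach_fix_type[of "1/2"])
    show "\<forall>V V'. dist (\<Phi> V) (\<Phi> V') \<le> 1 / 2 * dist V V'"
    proof (intro allI dist_bound)
      fix V V' x
      have "clamp a b x \<in> {a..b}" using clamp_in_interval[of a b x] ab by simp
      then show "dist (\<Phi> V x) (\<Phi> V' x) \<le> 1 / 2 * dist V V'" unfolding \<Phi> by (rule G_lip)
    qed
  qed auto
  then obtain V where V: "\<Phi> V = V" by blast
  have VG: "V x = G V x" if "x \<in> {a..b}" for x
    using \<Phi>[of V x] V that by simp
  define X where "X x = e x *\<^sub>R V x" for x
  have "X x $ s = \<xi> $ s + prim a b (\<lambda>y. L y (X y) $ s) x" if "x \<in> {a..b}" for x s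
  proof -
    have "X x $ s = e x * (G V x $ s)" using VG[OF that] by (simp add: X_def)
    moreover have "R V s = (\<lambda>y. L y (X y) $ s)" by (simp add: R_def X_def fun_eq_iff)
    ultimately show ?thesis using e_pos[of x] by (simp add: G_def)
  qed
  moreover have "continuous_on {a..b} X" unfolding X_def by (intro continuous_intros e_cont) auto
  ultimately show ?thesis by blast
qed

text \<open>
The inverse of \<open>stack\<close>: the block of index \<open>k + 1\<close>, which holds the \<open>k\<close>-th derivative.
\<close>

definition unstack :: "real^('n::{finite,linorder} \<times> 'd::finite) \<Rightarrow> nat \<Rightarrow> real^'d" where
  "unstack v k = (\<chi> p. v $ (inv pos (Suc k), p))"

lemma pos_inv: "1 \<le> k \<Longrightarrow> k \<le> CARD('n) \<Longrightarrow> pos (inv pos k :: 'n::{finite,linorder}) = k"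
  using bij_betw_imp_surj_on[OF pos_bij[where 'n='n]] by (metis atLeastAtMost_iff f_inv_into_f)

lemma inv_pos: "inv pos (pos j) = (j :: 'n::{finite,linorder})"
  using bij_betw_imp_inj_on[OF pos_bij] by (rule inv_f_f)

lemma stack_unstack: "stack (unstack v) = v"
proof -
  have "stack (unstack v) $ s = v $ s" for s
    using pos_range(1)[of "fst s"] by (cases s) (simp add: stack_def unstack_def inv_pos)
  then show ?thesis by (simp add: vec_eq_iff)
qed

lemma unstack_diff: "unstack (v - w) k = unstack v k - unstack w k"
  by (simp add: unstack_def vec_eq_iff)

lemma norm_unstack_le: "norm (unstack v k) \<le> norm v"
proof -
  have "(norm (unstack v k))\<^sup>2 = (\<Sum>p\<in>UNIV. (v $ (inv pos (Suc k), p))\<^sup>2)"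
    unfolding power2_norm_eq_inner by (simp add: inner_vec_def unstack_def power2_eq_square)
  also have "\<dots> \<le> (\<Sum>j\<in>UNIV. \<Sum>p\<in>UNIV. (v $ (j, p))\<^sup>2)"
    by (rule member_le_sum) (auto intro: sum_nonneg)
  also have "\<dots> = (norm v)\<^sup>2"
    unfolding power2_norm_eq_inner by (simp add: inner_vec_def power2_eq_square sum_UNIV_prod)
  finally show ?thesis by (rule power2_le_imp_le) simp
qed

lemma matrix_vector_L2:
  fixes M :: "real \<Rightarrow> real^'d^'e"
  assumes M: "\<And>p q. (\<lambda>x. M x $ p $ q) \<in> borel_measurable (leb a b)"
    and bd: "AE x in leb a b. \<forall>v. norm (M x *v v) \<le> K * norm v"
    and u: "\<And>q. (\<lambda>x. u x $ q) \<in> L2_fun a b"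
  shows "(\<lambda>x. (M x *v u x) $ p) \<in> L2_fun a b"
proof -
  have "(\<lambda>x. \<Sum>q\<in>UNIV. M x $ p $ q * u x $ q) \<in> L2_fun a b"
  proof (intro L2_sum L2_bounded_mult u M)
    fix q
    show "AE x in leb a b. \<bar>M x $ p $ q\<bar> \<le> K"
      using bd
    proof eventually_elim
      case (elim x)
      have "M x $ p $ q = (M x *v axis q 1) $ p"
        by (simp add: matrix_vector_mult_basis column_def)
      then have "\<bar>M x $ p $ q\<bar> \<le> norm (M x *v axis q 1)" by (simp only: component_le_norm_cart)
      also have "\<dots> \<le> K * norm (axis q 1 :: real^'d)" using elim by blast
      finally show ?case by simp
    qed
  qed
  then show ?thesis by (simp add: matrix_vector_mult_def)
qed

lemma const_matrix_vector_L2: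
  fixes A :: "real^'d^'e"
  assumes u: "\<And>q. (\<lambda>x. u x $ q) \<in> L2_fun a b"
  shows "(\<lambda>x. (A *v u x) $ p) \<in> L2_fun a b"
  unfolding matrix_vector_mult_def by (simp, intro L2_sum L2_cmult u)

text \<open>
The usual reduction to a first-order system: the block \<open>j < n\<close> is differentiated to the next block,
and the last one is determined by solving the equation for the derivative of highest order, which is possible
because \<open>P n\<close> is invertible.
\<close>

lemma ode_solution:
  fixes P :: "nat \<Rightarrow> real^'d^'d" and M :: "real \<Rightarrow> real^'d^'d" and f :: "real \<Rightarrow> real^'d"
    and \<xi> :: "real^('n::{finite,linorder} \<times> 'd::finite)"
  assumes ab: "a < b" and P: "det (P CARD('n)) \<noteq> 0"
    and M: "\<And>p q. (\<lambda>x. M x $ p $ q) \<in> borel_measurable (leb a b)"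
    and bd: "AE x in leb a b. \<forall>v. norm (M x *v v) \<le> K * norm v"
    and f: "\<And>p. (\<lambda>x. f x $ p) \<in> L2_fun a b"
  shows "\<exists>W. vec_chain a b CARD('n) W \<and> stack (\<lambda>k. W k a) = \<xi> \<and>
    (\<forall>x. (\<Sum>k=0..CARD('n). P k *v W k x) + M x *v W 0 x = f x)"
proof -
  let ?n = "CARD('n)"
  obtain I where I: "P ?n ** I = mat 1"
    using P by (meson invertible_def invertible_det_nz)
  define top where "top x v = I *v (f x - M x *v unstack v 0 - (\<Sum>k<?n. P k *v unstack v k))"
    for x and v :: "real^('n \<times> 'd)"
  define L where "L x v = ((\<chi> s. case s of (j, p) \<Rightarrow> if pos j < ?n then unstack v (pos j) $ p else top x v $ p) :: real^('n \<times> 'd))"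
    for x and v :: "real^('n \<times> 'd)"
  define c where "c A = onorm ((*v) A)" for A :: "real^'d^'d"
  have c: "norm (A *v v) \<le> c A * norm v" for A v
    unfolding c_def by (rule onorm[OF matrix_vector_mul_bounded_linear])
  have c0: "c A \<ge> 0" for A unfolding c_def by (rule onorm_pos_le[OF matrix_vector_mul_bounded_linear])
  define C where "C = c I * (\<bar>K\<bar> + (\<Sum>k<?n. c (P k)))"
  have C0: "C \<ge> 0" unfolding C_def by (intro mult_nonneg_nonneg add_nonneg_nonneg sum_nonneg c0) auto
  have lip: "AE y in leb a b. \<forall>v v' s. \<bar>L y v $ s - L y v' $ s\<bar> \<le> (1 + C) * norm (v - v')"
    using bd
  proof eventually_elim
    case (elim y)
    show ?case
    proof (intro allI)
      fix v v' :: "real^('n \<times> 'd)" and s :: "'n \<times> 'd"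
      obtain j p where s: "s = (j, p)" by (cases s)
      let ?u = "unstack (v - v')"
      show "\<bar>L y v $ s - L y v' $ s\<bar> \<le> (1 + C) * norm (v - v')"
      proof (cases "pos j < ?n")
        case True
        have "\<bar>L y v $ s - L y v' $ s\<bar> = \<bar>?u (pos j) $ p\<bar>"
          using True by (simp add: L_def s unstack_diff)
        also have "\<dots> \<le> norm (v - v')"
          by (rule order_trans[OF component_le_norm_cart norm_unstack_le])
        finally show ?thesis using C0 by (simp add: distrib_right add_increasing2)
      next
        case False
        have "norm (M y *v ?u 0) \<le> \<bar>K\<bar> * norm (v - v')"
        proof -
          have "norm (M y *v ?u 0) \<le> K * norm (?u 0)" using elim by blast
          also have "\<dots> \<le> \<bar>K\<bar> * norm (v - v')" by (intro mult_mono norm_unstack_le) auto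
          finally show ?thesis .
        qed
        moreover have "norm (\<Sum>k<?n. P k *v ?u k) \<le> (\<Sum>k<?n. c (P k)) * norm (v - v')"
          unfolding sum_distrib_right
          by (intro sum_norm_le order_trans[OF c mult_left_mono[OF norm_unstack_le c0]])
        ultimately have *: "norm (M y *v ?u 0 + (\<Sum>k<?n. P k *v ?u k)) \<le>
            (\<bar>K\<bar> + (\<Sum>k<?n. c (P k))) * norm (v - v')"
          using norm_triangle_ineq[of "M y *v ?u 0" "\<Sum>k<?n. P k *v ?u k"] by (simp add: distrib_right)
        have "top y v - top y v' = - (I *v (M y *v ?u 0 + (\<Sum>k<?n. P k *v ?u k)))"
          by (simp add: top_def unstack_diff matrix_vector_mult_diff_distrib matrix_vector_right_distrib
              sum_subtractf)
        then have "norm (top y v - top y v') \<le> c I * norm (M y *v ?u 0 + (\<Sum>k<?n. P k *v ?u k))"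
          using c by simp
        also have "\<dots> \<le> C * norm (v - v')"
          using mult_left_mono[OF * c0[of I]] by (simp add: C_def mult_ac)
        finally have "\<bar>(top y v - top y v') $ p\<bar> \<le> C * norm (v - v')"
          using component_le_norm_cart order_trans by blast
        then show ?thesis using False by (simp add: L_def s distrib_right add_increasing)
      qed
    qed
  qed
  have comp_cont: "continuous_on {a..b} (\<lambda>x. unstack (V x) k $ q)" if "continuous_on {a..b} V"
    for V :: "real \<Rightarrow> real^('n \<times> 'd)" and k q
    unfolding unstack_def using that by (simp add: continuous_intros)
  have L2: "(\<lambda>y. L y (V y) $ s) \<in> L2_fun a b" if V: "continuous_on {a..b} V"
    for V :: "real \<Rightarrow> real^('n \<times> 'd)" and s
  proof -
    obtain j p where s: "s = (j, p)" by (cases s)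
    have uL2: "(\<lambda>y. unstack (V y) k $ q) \<in> L2_fun a b" for k q
      by (intro L2_continuous comp_cont V)
    have "(\<lambda>y. (f y - M y *v unstack (V y) 0 - (\<Sum>k<?n. P k *v unstack (V y) k)) $ q) \<in> L2_fun a b" for q
      using f uL2 by (simp, intro L2_diff L2_sum matrix_vector_L2[OF M bd] const_matrix_vector_L2) auto
    then have "(\<lambda>y. top y (V y) $ p) \<in> L2_fun a b"
      unfolding top_def by (rule const_matrix_vector_L2)
    then show ?thesis using uL2 by (cases "pos j < ?n") (simp_all add: L_def s)
  qed
  obtain X where X: "continuous_on {a..b} X"
    "\<And>x s. x \<in> {a..b} \<Longrightarrow> X x $ s = \<xi> $ s + prim a b (\<lambda>y. L y (X y) $ s) x"
    using caratheodory_existence[OF ab _ lip L2, of \<xi>] C0 by auto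
  define W where "W k x = (if k < ?n then unstack (X x) k else top x (X x))" for k x
  have "vec_chain a b ?n W"
    unfolding vec_chain_def sob_chain_def
  proof (intro allI conjI impI ballI)
    fix p k assume k: "k \<le> ?n"
    have "(\<lambda>x. W k x $ p) = (\<lambda>x. unstack (X x) k $ p)" if "k < ?n" using that by (simp add: W_def)
    moreover have "(\<lambda>x. W k x $ p) = (\<lambda>x. L x (X x) $ (inv pos ?n, p))" if "k = ?n"
      using that by (simp add: W_def L_def pos_inv)
    ultimately show "(\<lambda>x. W k x $ p) \<in> L2_fun a b"
      using k L2[OF X(1)] L2_continuous[OF comp_cont[OF X(1)]] by (cases "k < ?n") simp_all
  next
    fix p k x assume k: "k < ?n" and x: "x \<in> {a..b}"
    have "(\<lambda>y. L y (X y) $ (inv pos (Suc k), p)) = (\<lambda>y. W (Suc k) y $ p)"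
      using k by (auto simp: L_def W_def pos_inv)
    then have e: "W k x $ p = \<xi> $ (inv pos (Suc k), p) + prim a b (\<lambda>y. W (Suc k) y $ p) x" if "x \<in> {a..b}" for x
      using X(2)[OF that, of "(inv pos (Suc k), p)"] k by (simp add: W_def unstack_def)
    show "W k x $ p = W k a $ p + prim a b (\<lambda>y. W (Suc k) y $ p) x"
      using e[OF x] e[of a] ab by (simp add: prim_left)
  qed
  moreover have "stack (\<lambda>k. W k a) = \<xi>"
  proof -
    have "(stack (\<lambda>k. W k a) :: real^('n \<times> 'd)) = stack (unstack (X a))"
    proof -
      have "pos j - 1 < ?n" for j :: 'n using pos_range[of j] by linarith
      then show ?thesis by (auto simp: stack_def W_def vec_eq_iff)
    qed
    also have "\<dots> = X a" by (rule stack_unstack)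
    also have "\<dots> = \<xi>" using X(2)[of a] ab by (simp add: vec_eq_iff prim_left)
    finally show ?thesis .
  qed
  moreover have "(\<Sum>k=0..?n. P k *v W k x) + M x *v W 0 x = f x" for x
  proof -
    have n0: "?n > 0" by simp
    have "(\<Sum>k=0..?n. P k *v W k x) = (\<Sum>k<?n. P k *v W k x) + P ?n *v W ?n x"
      by (simp add: atLeast0AtMost lessThan_Suc_atMost[symmetric])
    also have "(\<Sum>k<?n. P k *v W k x) = (\<Sum>k<?n. P k *v unstack (X x) k)"
      by (intro sum.cong) (auto simp: W_def)
    also have "P ?n *v W ?n x = f x - M x *v unstack (X x) 0 - (\<Sum>k<?n. P k *v unstack (X x) k)"
      by (simp add: W_def top_def matrix_vector_mul_assoc I)
    finally show ?thesis using n0 by (simp add: W_def)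
  qed
  ultimately show ?thesis by blast
qed

section \<open>Parametrization by contractions\<close>

text \<open>
The inequality makes \<open>g\<close> injective, hence bijective, and \<open>K = f g\<^sup>-\<^sup>1\<close> satisfies \<open>\<bar>K y\<bar> < \<bar>y\<bar>\<close> for
\<open>y \<noteq> 0\<close>. By compactness of the unit sphere this strict inequality improves to a factor \<open>k < 1\<close>.
\<close>

lemma dominated_linear_quotient:
  fixes f g :: "'v::euclidean_space \<Rightarrow> 'v"
  assumes f: "linear f" and g: "linear g" and less: "\<And>\<xi>. \<xi> \<noteq> 0 \<Longrightarrow> norm (f \<xi>) < norm (g \<xi>)"
  shows "surj g \<and> (\<exists>K k. linear K \<and> 0 \<le> k \<and> k < 1 \<and> (\<forall>y. norm (K y) \<le> k * norm y) \<and>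
    (\<forall>\<xi>. f \<xi> = K (g \<xi>)))"
proof -
  have inj: "inj g" unfolding linear_injective_0[OF g] using less by force
  then have surj: "surj g" by (rule linear_inj_imp_surj[OF g])
  obtain h where h: "linear h" "h \<circ> g = id" using linear_injective_left_inverse[OF g inj] by blast
  define K where "K = f \<circ> h"
  have K: "linear K" unfolding K_def by (rule linear_compose[OF h(1) f])
  have Kg: "f \<xi> = K (g \<xi>)" for \<xi> using h(2) by (simp add: K_def fun_eq_iff)
  have "continuous_on (sphere 0 1) (\<lambda>y. norm (K y))"
    by (intro continuous_on_norm linear_continuous_on linear_conv_bounded_linear[THEN iffD1] K)
  moreover have "sphere (0::'v) 1 \<noteq> {}"
  proof -
    have "(SOME i. i \<in> Basis) \<in> sphere (0::'v) 1" using SOME_Basis by simp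
    then show ?thesis by blast
  qed
  ultimately have "\<exists>y0\<in>sphere 0 1. \<forall>y\<in>sphere 0 1. norm (K y) \<le> norm (K y0)"
    by (intro continuous_attains_sup) auto
  then obtain y0 where y0: "norm y0 = 1" "\<And>y. norm y = 1 \<Longrightarrow> norm (K y) \<le> norm (K y0)" by auto
  obtain \<xi> where \<xi>: "y0 = g \<xi>" using surj by blast
  have "\<xi> \<noteq> 0" using \<xi> y0(1) linear_0[OF g] by auto
  then have lt: "norm (K y0) < 1" using less[of \<xi>] Kg[of \<xi>] \<xi> y0(1) by simp
  have "norm (K y) \<le> norm (K y0) * norm y" for y
  proof (cases "y = 0")
    case False
    have "norm (K (y /\<^sub>R norm y)) \<le> norm (K y0)" using False by (intro y0(2)) simp
    then show ?thesis using False by (simp add: linear_scale[OF K] field_simps)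
  qed (simp add: linear_0[OF K])
  then show ?thesis using surj K lt Kg by (intro conjI exI[of _ K] exI[of _ "norm (K y0)"]) auto
qed

text \<open>
Let \<open>g\<close> be the contraction \<open>F U \<mapsto> G U\<close>, defined on \<open>F ` D\<close>. If \<open>1 - t K g\<close> is onto, then its inverse is
Lipschitz with constant \<open>1 / (1 - k)\<close>, and the equation for a parameter \<open>s\<close> becomes a fixed point equation
with contraction factor \<open>\<bar>s - t\<bar> k / (1 - k)\<close>. The admissible step size does not depend on \<open>t\<close>, so
finitely many steps lead from \<open>t = 1\<close> to \<open>t = 0\<close>.
\<close>

lemma perturbed_boundary_map_surjective:
  fixes F G :: "'u \<Rightarrow> 'v::euclidean_space"
  assumes K: "linear K" "0 \<le> k" "k < 1" "\<And>y. norm (K y) \<le> k * norm y"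
    and contr: "\<And>U V. U \<in> D \<Longrightarrow> V \<in> D \<Longrightarrow> norm (G U - G V) \<le> norm (F U - F V)"
    and start: "\<And>x. \<exists>U\<in>D. F U - K (G U) = x"
  shows "\<exists>U\<in>D. F U = x"
proof -
  have step: "\<exists>U\<in>D. F U - s *\<^sub>R K (G U) = x"
    if P: "\<And>z. \<exists>U\<in>D. F U - t *\<^sub>R K (G U) = z" and t: "0 \<le> t" "t \<le> 1" and st: "\<bar>s - t\<bar> * k < 1 - k" for s t x
  proof -
    obtain u where u: "\<And>z. u z \<in> D" "\<And>z. F (u z) - t *\<^sub>R K (G (u z)) = z" using P by metis
    have tk: "t * k \<le> k" using t K(2) by (simp add: mult_left_le_one_le)
    define r where "r = \<bar>s - t\<bar> * k / (1 - k)"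
    have Kdiff: "norm (K y - K y') \<le> k * norm (y - y')" for y y'
      using K(4)[of "y - y'"] by (simp add: linear_diff[OF K(1)])
    have lip: "(1 - k) * norm (G (u z) - G (u z')) \<le> norm (z - z')" for z z'
    proof -
      let ?d = "norm (F (u z) - F (u z'))"
      have "F (u z) - F (u z') = (z - z') + t *\<^sub>R (K (G (u z)) - K (G (u z')))"
        using u(2)[of z] u(2)[of z'] by (simp add: algebra_simps)
      then have "?d \<le> norm (z - z') + t * norm (K (G (u z)) - K (G (u z')))"
        using norm_triangle_ineq[of "z - z'" "t *\<^sub>R (K (G (u z)) - K (G (u z')))"] t by simp
      also have "t * norm (K (G (u z)) - K (G (u z'))) \<le> t * (k * norm (G (u z) - G (u z')))"
        using Kdiff t by (intro mult_left_mono) auto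
      also have "\<dots> \<le> k * norm (G (u z) - G (u z'))"
        using mult_right_mono[OF tk, of "norm (G (u z) - G (u z'))"] by (simp add: mult.assoc)
      finally have "?d \<le> norm (z - z') + k * norm (G (u z) - G (u z'))" by simp
      moreover have "norm (G (u z) - G (u z')) \<le> ?d" by (intro contr u)
      ultimately show ?thesis by (simp add: algebra_simps)
    qed
    have "\<exists>!z. x + (s - t) *\<^sub>R K (G (u z)) = z"
    proof (rule banach_fix_type[of r])
      show "0 \<le> r" "r < 1" using K(2,3) st by (auto simp: r_def)
      show "\<forall>z z'. dist (x + (s - t) *\<^sub>R K (G (u z))) (x + (s - t) *\<^sub>R K (G (u z'))) \<le> r * dist z z'"
      proof (intro allI)
        fix z z'
        have "dist (x + (s - t) *\<^sub>R K (G (u z))) (x + (s - t) *\<^sub>R K (G (u z'))) =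
            \<bar>s - t\<bar> * norm (K (G (u z)) - K (G (u z')))"
          by (simp add: dist_norm scaleR_diff_right[symmetric])
        also have "\<dots> \<le> \<bar>s - t\<bar> * (k * norm (G (u z) - G (u z')))"
          by (intro mult_left_mono Kdiff) auto
        also have "\<dots> = r * ((1 - k) * norm (G (u z) - G (u z')))"
          using K(3) by (simp add: r_def)
        also have "\<dots> \<le> r * norm (z - z')"
          using K(2,3) by (intro mult_left_mono lip) (auto simp: r_def)
        finally show "dist (x + (s - t) *\<^sub>R K (G (u z))) (x + (s - t) *\<^sub>R K (G (u z'))) \<le> r * dist z z'"
          by (simp add: dist_norm)
      qed
    qed
    then obtain z where "x + (s - t) *\<^sub>R K (G (u z)) = z" by blast
    then have "F (u z) - s *\<^sub>R K (G (u z)) = x" using u(2)[of z] by (simp add: algebra_simps)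
    then show ?thesis using u(1) by blast
  qed
  \<comment> \<open>the number of steps, so that the step size \<open>1 / N\<close> is admissible\<close>
  obtain N :: nat where N: "k / (1 - k) < real N" using reals_Archimedean2 by blast
  have N0: "real N > 0" using N K(2,3) by (smt (verit) divide_nonneg_pos)
  have "\<forall>x. \<exists>U\<in>D. F U - (1 - real j / real N) *\<^sub>R K (G U) = x" if "j \<le> N" for j
    using that
  proof (induction j)
    case 0
    then show ?case using start by simp
  next
    case (Suc j)
    have IH: "\<forall>x. \<exists>U\<in>D. F U - (1 - real j / real N) *\<^sub>R K (G U) = x"
      by (rule Suc.IH) (use Suc.prems in simp)
    show ?case
    proof (rule allI, rule step[where t="1 - real j / real N"])
      show "\<exists>U\<in>D. F U - (1 - real j / real N) *\<^sub>R K (G U) = z" for z using IH by blast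
      show "0 \<le> 1 - real j / real N" "1 - real j / real N \<le> 1" using Suc.prems N0 by auto
      have "\<bar>1 - real (Suc j) / real N - (1 - real j / real N)\<bar> = 1 / real N"
        by (simp add: add_divide_distrib)
      then show "\<bar>1 - real (Suc j) / real N - (1 - real j / real N)\<bar> * k < 1 - k"
        using N N0 K(3) by (simp add: field_simps)
    qed
  qed
  from this[of N] show ?thesis using N0 by simp
qed

text \<open>
The abstract form of the theorem. The map \<open>T\<close> plays the role of \<open>1 + A\<close>, \<open>q U V\<close> that of
\<open>\<langle>A U - A V, U - V\<rangle>\<close> and \<open>m U V\<close> that of \<open>\<parallel>U - V\<parallel>\<^sup>2\<close>. No linear structure is assumed on the elements of \<open>X\<close>,
since classes of functions modulo null sets carry none as a type.
\<close>

lemma contraction_parametrization: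
  fixes F G :: "'u \<Rightarrow> 'v::euclidean_space" and T :: "'u \<Rightarrow> 'f" and X D :: "'u set" and Y :: "'f set"
    and q m :: "'u \<Rightarrow> 'u \<Rightarrow> real"
  assumes green: "\<And>U V. U \<in> X \<Longrightarrow> V \<in> X \<Longrightarrow>
      2 * q U V = (norm (F U - F V))\<^sup>2 - (norm (G U - G V))\<^sup>2"
    and res: "\<And>U V. U \<in> X \<Longrightarrow> V \<in> X \<Longrightarrow> T U = T V \<Longrightarrow> q U V = - m U V"
    and m_nonneg: "\<And>U V. U \<in> X \<Longrightarrow> V \<in> X \<Longrightarrow> 0 \<le> m U V"
    and m_zero: "\<And>U V. U \<in> X \<Longrightarrow> V \<in> X \<Longrightarrow> m U V = 0 \<Longrightarrow> U = V"
    and T: "T ` X \<subseteq> Y"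
    and K: "linear K" "0 \<le> k" "k < 1" "\<And>y. norm (K y) \<le> k * norm y"
    and fibre: "\<And>f. f \<in> Y \<Longrightarrow> \<exists>x. \<forall>y. \<exists>U\<in>X. T U = f \<and> G U = y \<and> F U = x + K y"
    and fibre_surj: "\<And>x. \<exists>f\<in>Y. \<forall>y. \<exists>U\<in>X. T U = f \<and> G U = y \<and> F U = x + K y"
    and D: "D \<subseteq> X"
  shows "(\<forall>U\<in>D. \<forall>V\<in>D. 0 \<le> q U V) \<and> T ` D = Y \<longleftrightarrow>
    (\<exists>g. (\<forall>x y. norm (g x - g y) \<le> norm (x - y)) \<and> D = {U \<in> X. g (F U) = G U})"
proof
  have q_iff: "0 \<le> q U V \<longleftrightarrow> norm (G U - G V) \<le> norm (F U - F V)" if "U \<in> X" "V \<in> X" for U V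
  proof -
    have "0 \<le> q U V \<longleftrightarrow> (norm (G U - G V))\<^sup>2 \<le> (norm (F U - F V))\<^sup>2" using green[OF that] by linarith
    also have "\<dots> \<longleftrightarrow> norm (G U - G V) \<le> norm (F U - F V)" by (simp add: power_mono_iff)
    finally show ?thesis .
  qed
  have uniq: "U = V" if "U \<in> X" "V \<in> X" "T U = T V" "norm (G U - G V) \<le> norm (F U - F V)" for U V
    using that q_iff[OF that(1,2)] res[OF that(1-3)] m_nonneg[OF that(1,2)] m_zero[OF that(1,2)] by auto
  show "\<exists>g. (\<forall>x y. norm (g x - g y) \<le> norm (x - y)) \<and> D = {U \<in> X. g (F U) = G U}"
    if macc: "(\<forall>U\<in>D. \<forall>V\<in>D. 0 \<le> q U V) \<and> T ` D = Y"
  proof -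
    have contr: "norm (G U - G V) \<le> norm (F U - F V)" if "U \<in> D" "V \<in> D" for U V
      using macc that D q_iff by blast
    have start: "\<exists>U\<in>D. F U - K (G U) = x" for x
    proof -
      obtain f where f: "f \<in> Y" "\<forall>y. \<exists>U\<in>X. T U = f \<and> G U = y \<and> F U = x + K y" using fibre_surj by blast
      then obtain U where U: "U \<in> D" "T U = f" using macc by blast
      obtain V where V: "V \<in> X" "T V = f" "G V = G U" "F V = x + K (G U)" using f(2) by blast
      have "U = V" by (rule uniq) (use U V D in auto)
      then have "F U - K (G U) = x" using V by simp
      then show ?thesis using U by blast
    qed
    have "\<exists>U\<in>D. F U = x" for x
      by (rule perturbed_boundary_map_surjective[where D=D, OF K contr start])
    then obtain u where u: "\<And>x. u x \<in> D" "\<And>x. F (u x) = x" by metis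
    define g where "g x = G (u x)" for x
    have g: "norm (g x - g y) \<le> norm (x - y)" for x y
      using contr[OF u(1)[of x] u(1)[of y]] by (simp add: g_def u)
    have gD: "g (F U) = G U" if "U \<in> D" for U
      using contr[OF u(1)[of "F U"] that] by (simp add: g_def u)
    have "D = {U \<in> X. g (F U) = G U}"
    proof (intro equalityI subsetI)
      fix U assume "U \<in> {U \<in> X. g (F U) = G U}"
      then have U: "U \<in> X" "g (F U) = G U" by auto
      have "T U \<in> T ` D" using T macc U(1) by auto
      then obtain V where V: "V \<in> D" "T V = T U" by (metis imageE)
      have "U = V"
        by (rule uniq) (use U V D g[of "F U" "F V"] gD in auto)
      then show "U \<in> D" using V by simp
    qed (use gD D in auto)
    then show ?thesis using g by blast
  qed
  show "(\<forall>U\<in>D. \<forall>V\<in>D. 0 \<le> q U V) \<and> T ` D = Y"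
    if gex: "\<exists>g. (\<forall>x y. norm (g x - g y) \<le> norm (x - y)) \<and> D = {U \<in> X. g (F U) = G U}"
  proof -
    obtain g where g: "\<And>x y. norm (g x - g y) \<le> norm (x - y)" and Dg: "D = {U \<in> X. g (F U) = G U}"
      using gex by blast
    have "0 \<le> q U V" if "U \<in> D" "V \<in> D" for U V
      using that g[of "F U" "F V"] by (subst q_iff) (auto simp: Dg)
    moreover have "f \<in> T ` D" if f: "f \<in> Y" for f
    proof -
      obtain x where x: "\<And>y. \<exists>U\<in>X. T U = f \<and> G U = y \<and> F U = x + K y" using fibre[OF f] by blast
      have "\<exists>!y. g (x + K y) = y"
      proof (rule banach_fix_type[OF K(2,3)], intro allI)
        fix y z
        have "norm (g (x + K y) - g (x + K z)) \<le> norm (K (y - z))"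
          using g[of "x + K y" "x + K z"] by (simp add: linear_diff[OF K(1)])
        also have "\<dots> \<le> k * norm (y - z)" by (rule K(4))
        finally show "dist (g (x + K y)) (g (x + K z)) \<le> k * dist y z" by (simp add: dist_norm)
      qed
      then obtain y where y: "g (x + K y) = y" by blast
      obtain U where "U \<in> X" "T U = f" "G U = y" "F U = x + K y" using x by blast
      then show ?thesis using y by (auto simp: Dg)
    qed
    ultimately show ?thesis using T D by blast
  qed
qed

section \<open>Classes of vector-valued functions and coercive weights\<close>

lemma L2_class_relation_equiv: "equiv (fun_pow (L2_fun a b)) (ae_rel a b)"
proof (rule equivI)
  show "trans (ae_rel a b)"
    unfolding trans_def ae_rel_def by (auto elim: eventually_elim2)
qed (auto simp: refl_on_def sym_def ae_rel_def elim!: eventually_mono)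

lemma ae_class_in: "u \<in> fun_pow (L2_fun a b) \<Longrightarrow> ae_class a b u \<in> L2_space a b"
  unfolding ae_class_def L2_space_def by (rule quotientI)

lemma
  assumes "u \<in> fun_pow (L2_fun a b)"
  shows rep_ae_class_L2: "rep (ae_class a b u) \<in> fun_pow (L2_fun a b)"
    and rep_ae_class_AE: "AE x in leb a b. rep (ae_class a b u) x = u x"
proof -
  have "u \<in> ae_class a b u" using assms by (simp add: ae_class_def ae_rel_def)
  then have "rep (ae_class a b u) \<in> ae_class a b u" unfolding rep_def by (rule someI[where x=u])
  then have "(u, rep (ae_class a b u)) \<in> ae_rel a b" by (simp add: ae_class_def)
  then show "rep (ae_class a b u) \<in> fun_pow (L2_fun a b)" "AE x in leb a b. rep (ae_class a b u) x = u x"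
    unfolding ae_rel_def by (auto elim: eventually_mono)
qed

lemma ae_class_eqI:
  assumes "u \<in> fun_pow (L2_fun a b)" "v \<in> fun_pow (L2_fun a b)" "AE x in leb a b. u x = v x"
  shows "ae_class a b u = ae_class a b v"
  unfolding ae_class_def
  by (rule equiv_class_eq[OF L2_class_relation_equiv]) (use assms in \<open>simp add: ae_rel_def\<close>)

lemma L2_space_cases:
  assumes "U \<in> L2_space a b"
  obtains u where "u \<in> fun_pow (L2_fun a b)" "U = ae_class a b u"
  using assms unfolding L2_space_def ae_class_def by (auto elim!: quotientE)

lemma rep_L2: "U \<in> L2_space a b \<Longrightarrow> rep U \<in> fun_pow (L2_fun a b)"
  by (auto elim!: L2_space_cases intro: rep_ae_class_L2)

lemma ae_class_rep: "U \<in> L2_space a b \<Longrightarrow> ae_class a b (rep U) = U"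
  by (erule L2_space_cases) (simp add: ae_class_eqI[OF rep_ae_class_L2 _ rep_ae_class_AE])

lemma L2_space_eqI:
  assumes "U \<in> L2_space a b" "V \<in> L2_space a b" "AE x in leb a b. rep U x = rep V x"
  shows "U = V"
  using ae_class_eqI[OF rep_L2[OF assms(1)] rep_L2[OF assms(2)] assms(3)] assms(1,2)
  by (simp add: ae_class_rep)

lemma fun_pow_component: "u \<in> fun_pow X \<Longrightarrow> (\<lambda>x. u x $ p) \<in> X"
  by (simp add: fun_pow_def)

lemma fun_pow_add:
  "u \<in> fun_pow (L2_fun a b) \<Longrightarrow> v \<in> fun_pow (L2_fun a b) \<Longrightarrow> (\<lambda>x. u x + v x) \<in> fun_pow (L2_fun a b)"
  by (simp add: fun_pow_def L2_add)

lemma fun_pow_diff: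
  "u \<in> fun_pow (L2_fun a b) \<Longrightarrow> v \<in> fun_pow (L2_fun a b) \<Longrightarrow> (\<lambda>x. u x - v x) \<in> fun_pow (L2_fun a b)"
  by (simp add: fun_pow_def L2_diff)

lemma
  assumes "U \<in> L2_space a b" "V \<in> L2_space a b"
  shows L2_add_in: "L2_add a b U V \<in> L2_space a b"
    and rep_L2_add: "AE x in leb a b. rep (L2_add a b U V) x = rep U x + rep V x"
  using ae_class_in[OF fun_pow_add[OF rep_L2[OF assms(1)] rep_L2[OF assms(2)]]]
    rep_ae_class_AE[OF fun_pow_add[OF rep_L2[OF assms(1)] rep_L2[OF assms(2)]]]
  by (simp_all add: L2_add_def)

lemma L2_diff_props:
  assumes "U \<in> L2_space a b" "V \<in> L2_space a b"
  shows "L2_diff a b U V \<in> L2_space a b"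
    and "AE x in leb a b. rep (L2_diff a b U V) x = rep U x - rep V x"
  using ae_class_in[OF fun_pow_diff[OF rep_L2[OF assms(1)] rep_L2[OF assms(2)]]]
    rep_ae_class_AE[OF fun_pow_diff[OF rep_L2[OF assms(1)] rep_L2[OF assms(2)]]]
  by (simp_all add: L2_diff_def)

lemma fun_pow_inner_integrable:
  fixes u v :: "real \<Rightarrow> real^'d"
  assumes "u \<in> fun_pow (L2_fun a b)" "v \<in> fun_pow (L2_fun a b)"
  shows "integrable (leb a b) (\<lambda>x. inner (u x) (v x))"
  unfolding inner_vec_def inner_real_def
  by (intro Bochner_Integration.integrable_sum L2_mult_integrable fun_pow_component assms)

lemma norm_matrix_vector_mult_le:
  fixes A :: "real^'m^'n"
  shows "norm (A *v v) \<le> norm A * norm v"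
proof -
  have "norm (A *v v) \<le> L2_set (\<lambda>p. norm (A $ p) * norm v) UNIV"
    unfolding norm_vec_def[of "A *v v"]
    by (rule L2_set_mono) (auto simp: matrix_vector_mul_component intro: Cauchy_Schwarz_ineq2)
  also have "\<dots> = norm A * norm v"
    by (simp add: L2_set_left_distrib norm_vec_def[of A])
  finally show ?thesis .
qed

lemma matrix_entry_measurable:
  fixes H :: "real \<Rightarrow> real^'m^'n"
  assumes "H \<in> borel_measurable M"
  shows "(\<lambda>x. H x $ p $ q) \<in> borel_measurable M"
proof -
  have "(\<lambda>A::real^'m^'n. A $ p $ q) \<in> borel_measurable borel"
    by (intro borel_measurable_continuous_onI continuous_intros)
  from measurable_compose[OF assms this] show ?thesis .
qed

lemma det_measurable:
  fixes A :: "real \<Rightarrow> real^'d^'d"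
  assumes "\<And>p q. (\<lambda>x. A x $ p $ q) \<in> borel_measurable M"
  shows "(\<lambda>x. det (A x)) \<in> borel_measurable M"
  unfolding det_def
  by (intro borel_measurable_sum borel_measurable_times borel_measurable_const borel_measurable_prod assms)

text \<open>
By Cramer's rule the entries of the inverse are quotients of polynomials in the entries of \<open>H x\<close>,
which gives measurability. The bound and the lower estimate are coercivity applied to \<open>M x v\<close>.
\<close>

lemma coercive_inverse:
  fixes H :: "real \<Rightarrow> real^'d^'d"
  assumes meas: "H \<in> borel_measurable (leb a b)" and c: "c > 0"
    and coercive: "AE x in leb a b. \<forall>v. inner (H x *v v) v \<ge> c * (norm v)\<^sup>2"
  obtains M where "\<And>p q. (\<lambda>x. M x $ p $ q) \<in> borel_measurable (leb a b)"
    "AE x in leb a b. \<forall>v. H x *v (M x *v v) = v"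
    "AE x in leb a b. \<forall>v. norm (M x *v v) \<le> (1 / c) * norm v"
    "AE x in leb a b. \<forall>v. inner v (M x *v v) \<ge> c * (norm (M x *v v))\<^sup>2"
proof -
  define M where "M x = (\<chi> k l. det (\<chi> i j. if j = k then axis l 1 $ i else H x $ i $ j) / det (H x))" for x
  note ent = matrix_entry_measurable[OF meas]
  have inv: "AE x in leb a b. \<forall>v. H x *v (M x *v v) = v"
    using coercive
  proof eventually_elim
    case (elim x)
    have "v = 0" if "H x *v v = 0" for v
    proof -
      have "c * (norm v)\<^sup>2 \<le> inner (H x *v v) v" using elim by blast
      then have "(norm v)\<^sup>2 \<le> 0" using that c by (simp add: mult_le_0_iff)
      then show ?thesis by simp
    qed
    then have "\<exists>B. B ** H x = mat 1" unfolding matrix_left_invertible_ker by blast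
    then have d: "det (H x) \<noteq> 0" by (simp add: invertible_left_inverse[symmetric] invertible_det_nz)
    have col: "H x *v column l (M x) = axis l 1" for l
      unfolding cramer[OF d] by (simp add: M_def column_def vec_eq_iff)
    have "(H x ** M x) $ i $ l = mat 1 $ i $ l" for i l
    proof -
      have "(H x ** M x) $ i $ l = (H x *v column l (M x)) $ i"
        by (simp add: matrix_matrix_mult_def matrix_vector_mult_def column_def)
      then show ?thesis unfolding col by (simp add: axis_def mat_def)
    qed
    then have "H x ** M x = mat 1" by (simp add: vec_eq_iff)
    then show ?case by (simp add: matrix_vector_mul_assoc)
  qed
  have pos: "AE x in leb a b. \<forall>v. inner v (M x *v v) \<ge> c * (norm (M x *v v))\<^sup>2"
    using inv coercive by eventually_elim metis
  show thesis
  proof (rule that[OF _ inv _ pos])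
    show "(\<lambda>x. M x $ p $ q) \<in> borel_measurable (leb a b)" for p q
      unfolding M_def vec_lambda_beta
    proof (intro borel_measurable_divide det_measurable)
      show "(\<lambda>x. (\<chi> i j. if j = p then axis q 1 $ i else H x $ i $ j) $ i $ j) \<in> borel_measurable (leb a b)"
        for i j using ent by (cases "j = p") simp_all
    qed (rule ent)
    show "AE x in leb a b. \<forall>v. norm (M x *v v) \<le> (1 / c) * norm v"
      using pos
    proof eventually_elim
      case (elim x)
      show ?case
      proof
        fix v
        let ?u = "M x *v v"
        have "c * (norm ?u)\<^sup>2 \<le> inner v ?u" using elim by blast
        also have "\<dots> \<le> norm v * norm ?u" by (rule norm_cauchy_schwarz)
        finally have "norm ?u * (c * norm ?u) \<le> norm ?u * norm v"
          by (simp add: power2_eq_square mult_ac)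
        then have "c * norm ?u \<le> norm v" by (cases "norm ?u = 0") auto
        then show "norm ?u \<le> (1 / c) * norm v" using c by (simp add: field_simps)
      qed
    qed
  qed
qed

lemma stack_add: "stack (\<lambda>k. u k + v k) = stack u + stack v"
  by (auto simp: stack_def vec_eq_iff)

lemma stack_diff: "stack (\<lambda>k. u k - v k) = stack u - stack v"
  by (auto simp: stack_def vec_eq_iff)

lemma stack_sum_scaleR: "stack (\<lambda>k. \<Sum>s\<in>I. c s *\<^sub>R u s k) = (\<Sum>s\<in>I. c s *\<^sub>R stack (u s))"
  by (induction I rule: infinite_finite_induct) (auto simp: stack_def vec_eq_iff)

lemma vec_chain_add:
  "vec_chain a b n W \<Longrightarrow> vec_chain a b n W' \<Longrightarrow> vec_chain a b n (\<lambda>k x. W k x + W' k x)"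
  by (simp add: vec_chain_def sob_chain_add)

lemma vec_chain_diff:
  "vec_chain a b n W \<Longrightarrow> vec_chain a b n W' \<Longrightarrow> vec_chain a b n (\<lambda>k x. W k x - W' k x)"
  by (simp add: vec_chain_def sob_chain_diff)

lemma vec_chain_sum:
  assumes "finite I" "\<And>s. s \<in> I \<Longrightarrow> vec_chain a b n (W s)"
  shows "vec_chain a b n (\<lambda>k x. \<Sum>s\<in>I. c s *\<^sub>R W s k x)"
  unfolding vec_chain_def
  using assms by (auto simp: intro!: sob_chain_sum sob_chain_cmult vec_chainD)

text \<open>
A chain starting with the zero function has the same weak derivatives as the zero chain.
\<close>

lemma vec_chain_zero_trace:
  assumes ab: "a < b" and W: "vec_chain a b n W" and z: "AE x in leb a b. W 0 x = 0" and k: "k < n"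
  shows "W k a = 0"
proof -
  have "W k a $ p = 0" for p
  proof -
    have "AE x in leb a b. 0 = W 0 x $ p" using z by eventually_elim simp
    then have "cont_rep a b (wderiv a b k (\<lambda>x. 0)) a = W k a $ p"
      using ab by (intro sob_chain_trace[OF ab vec_chainD[OF W] L2_const _ k]) auto
    moreover have "cont_rep a b (wderiv a b k (\<lambda>x. 0)) a = 0"
      using ab by (intro sob_chain_trace[OF ab sob_chain_zero L2_const _ k]) auto
    ultimately show ?thesis by simp
  qed
  then show ?thesis by (simp add: vec_eq_iff)
qed

section \<open>Port-Hamiltonian operators\<close>

text \<open>
The weight \<open>H\<close> comes with a pointwise inverse \<open>M\<close>, because the differential equation is solved for
\<open>w = H u\<close> and \<open>u = M w\<close> is recovered afterwards.
\<close>

locale port_hamiltonian =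
  fixes a b c K K' :: real
    and P :: "nat \<Rightarrow> real^'d^'d"
    and H M :: "real \<Rightarrow> real^'d^'d"
    and Q :: "real^('n::{finite,linorder} \<times> 'd::finite)^('n \<times> 'd)"
  assumes ab: "a < b"
    and P_sym: "\<And>j. j \<le> CARD('n) \<Longrightarrow> transpose (P j) = (-1) ^ (j + 1) *\<^sub>R P j"
    and P_det: "det (P CARD('n)) \<noteq> 0"
    and Q: "Q = Qmat P"
    and H_meas: "\<And>p q. (\<lambda>x. H x $ p $ q) \<in> borel_measurable (leb a b)"
    and H_bdd: "AE x in leb a b. \<forall>v. norm (H x *v v) \<le> K * norm v"
    and H_sym: "AE x in leb a b. transpose (H x) = H x"
    and c: "c > 0"
    and H_coercive: "AE x in leb a b. \<forall>v. inner (H x *v v) v \<ge> c * (norm v)\<^sup>2"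
    and M_meas: "\<And>p q. (\<lambda>x. M x $ p $ q) \<in> borel_measurable (leb a b)"
    and H_M: "AE x in leb a b. \<forall>v. H x *v (M x *v v) = v"
    and M_bdd: "AE x in leb a b. \<forall>v. norm (M x *v v) \<le> K' * norm v"
    and M_coercive: "AE x in leb a b. \<forall>v. inner v (M x *v v) \<ge> c * (norm (M x *v v))\<^sup>2"
begin

definition traces :: "real \<Rightarrow> (nat \<Rightarrow> real \<Rightarrow> real^'d) \<Rightarrow> real^('n \<times> 'd)" where
  "traces t W = stack (\<lambda>k. W k t)"

definition bnd_in :: "(nat \<Rightarrow> real \<Rightarrow> real^'d) \<Rightarrow> real^('n \<times> 'd)" where
  "bnd_in W = Q_plus Q (traces b W) + Q_minus Q (traces a W)"

definition bnd_out :: "(nat \<Rightarrow> real \<Rightarrow> real^'d) \<Rightarrow> real^('n \<times> 'd)" where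
  "bnd_out W = Q_minus Q (traces b W) + Q_plus Q (traces a W)"

definition diff_expr :: "(nat \<Rightarrow> real \<Rightarrow> real^'d) \<Rightarrow> real \<Rightarrow> real^'d" where
  "diff_expr W x = (\<Sum>k=0..CARD('n). P k *v W k x)"

lemma Q_sym: "transpose Q = Q"
  unfolding Q by (rule Qmat_symmetric[OF P_sym])

lemmas Q_linear = Q_plus_linear[OF Q_sym] Q_minus_linear[OF Q_sym]

lemma bnd_add:
  "bnd_in (\<lambda>k x. W k x + W' k x) = bnd_in W + bnd_in W'"
  "bnd_out (\<lambda>k x. W k x + W' k x) = bnd_out W + bnd_out W'"
  by (simp_all add: bnd_in_def bnd_out_def traces_def stack_add linear_add[OF Q_linear(1)] linear_add[OF Q_linear(2)])

lemma bnd_diff: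
  "bnd_in (\<lambda>k x. W k x - W' k x) = bnd_in W - bnd_in W'"
  "bnd_out (\<lambda>k x. W k x - W' k x) = bnd_out W - bnd_out W'"
  by (simp_all add: bnd_in_def bnd_out_def traces_def stack_diff linear_diff[OF Q_linear(1)] linear_diff[OF Q_linear(2)])

lemma diff_expr_add: "diff_expr (\<lambda>k x. W k x + W' k x) x = diff_expr W x + diff_expr W' x"
  by (simp add: diff_expr_def matrix_vector_right_distrib sum.distrib)

lemma diff_expr_diff: "diff_expr (\<lambda>k x. W k x - W' k x) x = diff_expr W x - diff_expr W' x"
  by (simp add: diff_expr_def matrix_vector_mult_diff_distrib sum_subtractf)

lemma chain_L2:
  assumes "vec_chain a b CARD('n) W" "k \<le> CARD('n)"
  shows "W k \<in> fun_pow (L2_fun a b)"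
  using sob_chain_L2[OF vec_chainD[OF assms(1)] assms(2)] by (simp add: fun_pow_def)

lemma diff_expr_L2:
  assumes "vec_chain a b CARD('n) W"
  shows "diff_expr W \<in> fun_pow (L2_fun a b)"
proof -
  have "(\<lambda>x. diff_expr W x $ p) \<in> L2_fun a b" for p
    unfolding diff_expr_def sum_component
    by (intro L2_sum const_matrix_vector_L2 fun_pow_component[OF chain_L2[OF assms]]) simp
  then show ?thesis by (simp add: fun_pow_def)
qed

lemma H_L2: "u \<in> fun_pow (L2_fun a b) \<Longrightarrow> (\<lambda>x. H x *v u x) \<in> fun_pow (L2_fun a b)"
  using matrix_vector_L2[OF H_meas H_bdd] by (simp add: fun_pow_def)

lemma M_L2: "u \<in> fun_pow (L2_fun a b) \<Longrightarrow> (\<lambda>x. M x *v u x) \<in> fun_pow (L2_fun a b)"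
  using matrix_vector_L2[OF M_meas M_bdd] by (simp add: fun_pow_def)

lemma chain_energy:
  assumes "vec_chain a b CARD('n) W"
  shows "2 * (LINT x|leb a b. inner (W 0 x) (diff_expr W x)) = (norm (bnd_in W))\<^sup>2 - (norm (bnd_out W))\<^sup>2"
  using energy_identity[where 'n='n, OF ab P_sym assms, folded Q] boundary_form_difference[OF Q_sym, of "traces b W" "traces a W"]
  by (simp add: diff_expr_def bnd_in_def bnd_out_def traces_def)


text \<open>
The chain \<open>W\<close> consists of the derivatives of \<open>H u\<close>, where \<open>u\<close> represents the class \<open>U\<close>.
\<close>

definition represents :: "'d L2_class \<Rightarrow> (nat \<Rightarrow> real \<Rightarrow> real^'d) \<Rightarrow> bool" where
  "represents U W \<longleftrightarrow> U \<in> L2_space a b \<and> vec_chain a b CARD('n) W \<and>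
     (AE x in leb a b. H x *v rep U x = W 0 x)"

lemma representsD:
  assumes "represents U W"
  shows "U \<in> L2_space a b" "vec_chain a b CARD('n) W" "AE x in leb a b. H x *v rep U x = W 0 x"
  using assms by (auto simp: represents_def)

lemma weigh_L2: "U \<in> L2_space a b \<Longrightarrow> weigh H U \<in> fun_pow (L2_fun a b)"
  unfolding weigh_def by (intro H_L2 rep_L2)

lemma dom_A_represents:
  assumes "U \<in> dom_A a b CARD('n) H"
  shows "\<exists>W. represents U W"
proof -
  have U: "U \<in> L2_space a b" and s: "\<And>p. (\<lambda>x. weigh H U x $ p) \<in> sobolev a b CARD('n)"
    using assms by (auto simp: dom_A_def fun_pow_def)
  have "\<forall>p. \<exists>F. sob_chain a b CARD('n) F \<and> (AE x in leb a b. weigh H U x $ p = F 0 x)"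
    using sobolev_chain[OF ab s] by blast
  then obtain F where F: "\<And>p. sob_chain a b CARD('n) (F p)" "\<And>p. AE x in leb a b. weigh H U x $ p = F p 0 x"
    by metis
  have "vec_chain a b CARD('n) (\<lambda>k x. \<chi> p. F p k x)" using F(1) by (simp add: vec_chain_def)
  moreover have "AE x in leb a b. \<forall>p. weigh H U x $ p = F p 0 x" using F(2) by (simp add: AE_all_countable)
  then have "AE x in leb a b. H x *v rep U x = (\<chi> p. F p 0 x)"
    by eventually_elim (simp add: vec_eq_iff weigh_def)
  ultimately show ?thesis using U unfolding represents_def by blast
qed

lemma represents_weigh:
  assumes "represents U W"
  shows "(\<lambda>x. weigh H U x $ p) \<in> L2_fun a b" "AE x in leb a b. weigh H U x $ p = W 0 x $ p"
  using weigh_L2[OF representsD(1)[OF assms]] representsD(3)[OF assms]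
  by (auto simp: fun_pow_def weigh_def elim: eventually_mono)

lemma represents_dom_A:
  assumes "represents U W"
  shows "U \<in> dom_A a b CARD('n) H"
  using sob_chain_sobolev[OF ab vec_chainD[OF representsD(2)[OF assms]] represents_weigh[OF assms]]
    representsD(1)[OF assms]
  by (simp add: dom_A_def fun_pow_def)

lemma represents_trace:
  assumes "represents U W" "t \<in> {a..b}"
  shows "tr a b t (weigh H U) = traces t W"
proof -
  have "pos j - 1 < CARD('n)" for j :: 'n using pos_range[of j] by linarith
  then have "cont_rep a b (wderiv a b (pos j - 1) (\<lambda>x. weigh H U x $ p)) t = W (pos j - 1) t $ p"
    for j :: 'n and p
    by (intro sob_chain_trace[OF ab vec_chainD[OF representsD(2)[OF assms(1)]] represents_weigh[OF assms(1)] _ assms(2)])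
  then show ?thesis by (simp add: tr_def traces_def stack_def)
qed

lemma
  assumes U: "represents U W"
  shows op_A_in: "op_A a b CARD('n) P H U \<in> L2_space a b"
    and rep_op_A: "AE x in leb a b. rep (op_A a b CARD('n) P H U) x = diff_expr W x"
proof -
  note S = ab vec_chainD[OF representsD(2)[OF U]] represents_weigh[OF U]
  let ?f = "\<lambda>x. \<Sum>k=0..CARD('n). P k *v vderiv a b k (weigh H U) x"
  have "(\<lambda>x. ?f x $ p) \<in> L2_fun a b" for p
    unfolding sum_component
    by (intro L2_sum const_matrix_vector_L2) (simp add: vderiv_def sob_chain_wderiv_L2[OF S])
  then have f: "?f \<in> fun_pow (L2_fun a b)" by (simp add: fun_pow_def)
  have "AE x in leb a b. \<forall>k\<in>{0..CARD('n)}. \<forall>p. wderiv a b k (\<lambda>x. weigh H U x $ p) x = W k x $ p"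
  proof (rule AE_finite_allI)
    show "AE x in leb a b. \<forall>p. wderiv a b k (\<lambda>x. weigh H U x $ p) x = W k x $ p" if "k \<in> {0..CARD('n)}" for k
      unfolding AE_all_countable using sob_chain_wderiv[OF S] that by simp
  qed simp
  then have "AE x in leb a b. ?f x = diff_expr W x"
  proof eventually_elim
    case (elim x)
    then have "vderiv a b k (weigh H U) x = W k x" if "k \<in> {0..CARD('n)}" for k
      using that by (simp add: vderiv_def vec_eq_iff)
    then show ?case unfolding diff_expr_def by (intro sum.cong refl) simp
  qed
  then show "op_A a b CARD('n) P H U \<in> L2_space a b"
    "AE x in leb a b. rep (op_A a b CARD('n) P H U) x = diff_expr W x"
    using ae_class_in[OF f] rep_ae_class_AE[OF f] unfolding op_A_def by (auto elim: eventually_elim2)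
qed

text \<open>
The weight is symmetric, so it can be moved to the second argument of the inner product, where it turns
\<open>u - v\<close> into the start of a chain. What is left is the energy identity for the difference of the two
chains.
\<close>

lemma represents_green:
  assumes U: "represents U W" and V: "represents V W'"
  shows "2 * weighted_inner a b H (L2_diff a b (op_A a b CARD('n) P H U) (op_A a b CARD('n) P H V)) (L2_diff a b U V) =
    (norm (bnd_in W - bnd_in W'))\<^sup>2 - (norm (bnd_out W - bnd_out W'))\<^sup>2"
proof -
  let ?D = "L2_diff a b (op_A a b CARD('n) P H U) (op_A a b CARD('n) P H V)" and ?E = "L2_diff a b U V"
  let ?W = "\<lambda>k x. W k x - W' k x"
  note D = L2_diff_props[OF op_A_in[OF U] op_A_in[OF V]]
  note E = L2_diff_props[OF representsD(1)[OF U] representsD(1)[OF V]]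
  have W: "vec_chain a b CARD('n) ?W" by (intro vec_chain_diff representsD(2)[OF U] representsD(2)[OF V])
  have "AE x in leb a b. rep ?D x = diff_expr ?W x"
    using D(2) rep_op_A[OF U] rep_op_A[OF V] by eventually_elim (simp add: diff_expr_diff)
  moreover have "AE x in leb a b. H x *v rep ?E x = ?W 0 x"
    using E(2) representsD(3)[OF U] representsD(3)[OF V]
    by eventually_elim (simp add: matrix_vector_mult_diff_distrib)
  ultimately have ae: "AE x in leb a b. inner (H x *v rep ?D x) (rep ?E x) = inner (?W 0 x) (diff_expr ?W x)"
    using H_sym
  proof eventually_elim
    case (elim x)
    have "inner (H x *v rep ?D x) (rep ?E x) = inner (rep ?D x) (H x *v rep ?E x)"
      by (rule symmetric_inner[OF elim(3)])
    then show ?case unfolding elim(1,2) by (simp add: inner_commute)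
  qed
  have "weighted_inner a b H ?D ?E = (LINT x|leb a b. inner (?W 0 x) (diff_expr ?W x))"
    unfolding weighted_inner_def
    by (rule integral_cong_AE[OF _ _ ae])
       (intro borel_measurable_integrable fun_pow_inner_integrable H_L2 rep_L2 D(1) E(1)
          diff_expr_L2 W chain_L2[OF W]; simp)+
  then show ?thesis using chain_energy[OF W] by (simp add: bnd_diff)
qed

definition dist_sq :: "'d L2_class \<Rightarrow> 'd L2_class \<Rightarrow> real" where
  "dist_sq U V = weighted_inner a b H (L2_diff a b U V) (L2_diff a b U V)"

lemma
  assumes U: "U \<in> L2_space a b" and V: "V \<in> L2_space a b"
  shows dist_sq_nonneg: "0 \<le> dist_sq U V"
    and dist_sq_zero: "dist_sq U V = 0 \<Longrightarrow> U = V"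
proof -
  let ?E = "L2_diff a b U V"
  note E = L2_diff_props[OF U V]
  have nonneg: "AE x in leb a b. 0 \<le> inner (H x *v rep ?E x) (rep ?E x)"
    using H_coercive
  proof eventually_elim
    case (elim x)
    then have "c * (norm (rep ?E x))\<^sup>2 \<le> inner (H x *v rep ?E x) (rep ?E x)" by blast
    moreover have "0 \<le> c * (norm (rep ?E x))\<^sup>2" using c by simp
    ultimately show ?case by linarith
  qed
  have int: "integrable (leb a b) (\<lambda>x. inner (H x *v rep ?E x) (rep ?E x))"
    by (intro fun_pow_inner_integrable H_L2 rep_L2 E(1))
  show "0 \<le> dist_sq U V"
    unfolding dist_sq_def weighted_inner_def by (rule integral_nonneg_AE[OF nonneg])
  assume "dist_sq U V = 0"
  then have "AE x in leb a b. inner (H x *v rep ?E x) (rep ?E x) = 0"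
    using integral_nonneg_eq_0_iff_AE[OF int nonneg] by (simp add: dist_sq_def weighted_inner_def)
  then have "AE x in leb a b. rep U x = rep V x"
    using H_coercive E(2)
  proof eventually_elim
    case (elim x)
    have "c * (norm (rep ?E x))\<^sup>2 \<le> inner (H x *v rep ?E x) (rep ?E x)" using elim(2) by blast
    then have "(norm (rep ?E x))\<^sup>2 \<le> 0" unfolding elim(1) using c by (simp add: mult_le_0_iff)
    then show ?case using elim(3) by simp
  qed
  then show "U = V" by (rule L2_space_eqI[OF U V])
qed

text \<open>
If \<open>u + A u = v + A v\<close>, then \<open>A u - A v = -(u - v)\<close>.
\<close>

lemma resolvent_identity:
  assumes U: "U \<in> L2_space a b" "AU \<in> L2_space a b" and V: "V \<in> L2_space a b" "AV \<in> L2_space a b"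
    and eq: "L2_add a b U AU = L2_add a b V AV"
  shows "weighted_inner a b H (L2_diff a b AU AV) (L2_diff a b U V) = - dist_sq U V"
proof -
  let ?D = "L2_diff a b AU AV" and ?E = "L2_diff a b U V"
  note D = L2_diff_props[OF U(2) V(2)] and E = L2_diff_props[OF U(1) V(1)]
  have "AE x in leb a b. rep ?D x = - rep ?E x"
    using D(2) E(2) rep_L2_add[OF U] rep_L2_add[OF V]
  proof eventually_elim
    case (elim x)
    have "rep U x + rep AU x = rep V x + rep AV x" using elim(3,4) eq by simp
    then show ?case unfolding elim(1,2) by (simp add: algebra_simps)
  qed
  then have ae: "AE x in leb a b. inner (H x *v rep ?D x) (rep ?E x) = - inner (H x *v rep ?E x) (rep ?E x)"
    by eventually_elim (simp add: linear_neg[OF matrix_vector_mul_linear])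
  have "weighted_inner a b H ?D ?E = (LINT x|leb a b. - inner (H x *v rep ?E x) (rep ?E x))"
    unfolding weighted_inner_def
    by (rule integral_cong_AE[OF _ _ ae])
       (intro borel_measurable_integrable integrable_minus fun_pow_inner_integrable H_L2 rep_L2 D(1) E(1))+
  then show ?thesis by (simp add: dist_sq_def weighted_inner_def)
qed

text \<open>
The class of \<open>u = M w\<close> solves \<open>u + A u = f\<close> if \<open>w\<close> solves the differential equation.
\<close>

lemma solution_class:
  assumes f: "f \<in> L2_space a b" and W: "vec_chain a b CARD('n) W"
    and eq: "AE x in leb a b. diff_expr W x + M x *v W 0 x = rep f x"
  shows "\<exists>U. represents U W \<and> L2_add a b U (op_A a b CARD('n) P H U) = f"
proof -
  define U where "U = ae_class a b (\<lambda>x. M x *v W 0 x)"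
  have u: "(\<lambda>x. M x *v W 0 x) \<in> fun_pow (L2_fun a b)" by (intro M_L2 chain_L2[OF W]) simp
  have U: "U \<in> L2_space a b" unfolding U_def by (rule ae_class_in[OF u])
  have repU: "AE x in leb a b. rep U x = M x *v W 0 x" unfolding U_def by (rule rep_ae_class_AE[OF u])
  have "AE x in leb a b. H x *v rep U x = W 0 x" using repU H_M by eventually_elim simp
  then have R: "represents U W" using U W by (simp add: represents_def)
  have "AE x in leb a b. rep (L2_add a b U (op_A a b CARD('n) P H U)) x = rep f x"
    using rep_L2_add[OF U op_A_in[OF R]] rep_op_A[OF R] repU eq
    by eventually_elim (simp add: add.commute)
  then have "L2_add a b U (op_A a b CARD('n) P H U) = f"
    by (rule L2_space_eqI[OF L2_add_in[OF U op_A_in[OF R]] f])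
  then show ?thesis using R by blast
qed

text \<open>
Solutions of \<open>\<sigma> u + A u = 0\<close>, depending linearly on their trace \<open>\<xi>\<close> at \<open>a\<close>: solve for the unit vectors and
superpose. By the energy identity the difference of the two squared norms is
\<open>2 \<sigma> \<integral> \<langle>w, M w\<rangle>\<close>. The integral is positive because a solution that vanishes almost everywhere has
trace zero.
\<close>

lemma kernel_family:
  assumes \<sigma>: "\<sigma> = 1 \<or> \<sigma> = (-1::real)"
  shows "\<exists>S :: real^('n \<times> 'd) \<Rightarrow> nat \<Rightarrow> real \<Rightarrow> real^'d.
    linear (\<lambda>\<xi>. bnd_in (S \<xi>)) \<and> linear (\<lambda>\<xi>. bnd_out (S \<xi>)) \<and>
    (\<forall>\<xi>. vec_chain a b CARD('n) (S \<xi>) \<and> (\<forall>x. diff_expr (S \<xi>) x = - \<sigma> *\<^sub>R (M x *v S \<xi> 0 x)) \<and>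
      (\<xi> \<noteq> 0 \<longrightarrow> 0 < \<sigma> * ((norm (bnd_out (S \<xi>)))\<^sup>2 - (norm (bnd_in (S \<xi>)))\<^sup>2)))"
proof -
  have M': "(\<lambda>x. (\<sigma> *\<^sub>R M x) $ p $ q) \<in> borel_measurable (leb a b)" for p q
    using M_meas by simp
  have bd': "AE x in leb a b. \<forall>v. norm (\<sigma> *\<^sub>R M x *v v) \<le> K' * norm v"
    using M_bdd by eventually_elim (use \<sigma> in \<open>auto simp: scaleR_matrix_vector_assoc[symmetric]\<close>)
  have "\<forall>s. \<exists>W. vec_chain a b CARD('n) W \<and> stack (\<lambda>k. W k a) = (axis s 1 :: real^('n \<times> 'd)) \<and>
      (\<forall>x. (\<Sum>k=0..CARD('n). P k *v W k x) + (\<sigma> *\<^sub>R M x) *v W 0 x = 0)"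
    by (intro allI ode_solution[where 'n='n and P=P and M="\<lambda>x. \<sigma> *\<^sub>R M x" and f="\<lambda>x. 0", OF ab P_det M' bd']) (simp add: L2_const)
  from choice[OF this] obtain W where W: "\<And>s. vec_chain a b CARD('n) (W s)"
    "\<And>s. stack (\<lambda>k. W s k a) = (axis s 1 :: real^('n \<times> 'd))"
    "\<And>s x. diff_expr (W s) x + (\<sigma> *\<^sub>R M x) *v W s 0 x = 0"
    unfolding diff_expr_def by blast
  define S where "S \<xi> k x = (\<Sum>s\<in>UNIV. \<xi> $ s *\<^sub>R W s k x)" for \<xi> k x
  have chain: "vec_chain a b CARD('n) (S \<xi>)" for \<xi>
    using vec_chain_sum[of UNIV a b "CARD('n)" W "\<lambda>s. \<xi> $ s"] W(1) by (simp add: S_def[abs_def])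
  have traces: "traces t (S \<xi>) = (\<Sum>s\<in>UNIV. \<xi> $ s *\<^sub>R traces t (W s))" for t \<xi>
    unfolding traces_def S_def by (rule stack_sum_scaleR)
  have traces_lin: "linear (\<lambda>\<xi>. traces t (S \<xi>))" for t
    unfolding traces by (rule linearI) (simp_all add: scaleR_left_distrib sum.distrib scaleR_sum_right)
  have lin: "linear (\<lambda>\<xi>. bnd_in (S \<xi>))" "linear (\<lambda>\<xi>. bnd_out (S \<xi>))"
    unfolding bnd_in_def bnd_out_def
    using linear_compose[OF traces_lin Q_linear(1)] linear_compose[OF traces_lin Q_linear(2)]
    by (auto simp: o_def intro!: linear_compose_add)
  have eq: "diff_expr (S \<xi>) x = - \<sigma> *\<^sub>R (M x *v S \<xi> 0 x)" for \<xi> x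
  proof -
    have "diff_expr (S \<xi>) x = (\<Sum>s\<in>UNIV. \<xi> $ s *\<^sub>R diff_expr (W s) x)"
      unfolding diff_expr_def S_def
      by (simp add: linear_sum[OF matrix_vector_mul_linear] matrix_vector_mult_scaleR scaleR_sum_right)
         (rule sum.swap)
    also have "\<dots> = (\<Sum>s\<in>UNIV. \<xi> $ s *\<^sub>R (- ((\<sigma> *\<^sub>R M x) *v W s 0 x)))"
      using W(3) by (simp add: eq_neg_iff_add_eq_0[symmetric])
    also have "\<dots> = - \<sigma> *\<^sub>R (M x *v S \<xi> 0 x)"
      by (simp add: S_def linear_sum[OF matrix_vector_mul_linear] matrix_vector_mult_scaleR
          scaleR_matrix_vector_assoc[symmetric] scaleR_sum_right sum_negf mult.commute)
    finally show ?thesis .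
  qed
  have pos: "0 < \<sigma> * ((norm (bnd_out (S \<xi>)))\<^sup>2 - (norm (bnd_in (S \<xi>)))\<^sup>2)" if \<xi>: "\<xi> \<noteq> 0" for \<xi>
  proof -
    let ?w = "S \<xi> 0"
    have w: "?w \<in> fun_pow (L2_fun a b)" by (intro chain_L2[OF chain]) simp
    have int: "integrable (leb a b) (\<lambda>x. inner (?w x) (M x *v ?w x))"
      by (intro fun_pow_inner_integrable w M_L2)
    have nonneg: "AE x in leb a b. 0 \<le> inner (?w x) (M x *v ?w x)"
      using M_coercive
    proof eventually_elim
      case (elim x)
      then have "c * (norm (M x *v ?w x))\<^sup>2 \<le> inner (?w x) (M x *v ?w x)" by blast
      moreover have "0 \<le> c * (norm (M x *v ?w x))\<^sup>2" using c by simp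
      ultimately show ?case by linarith
    qed
    have "(LINT x|leb a b. inner (?w x) (M x *v ?w x)) \<noteq> 0"
    proof
      assume "(LINT x|leb a b. inner (?w x) (M x *v ?w x)) = 0"
      then have "AE x in leb a b. inner (?w x) (M x *v ?w x) = 0"
        using integral_nonneg_eq_0_iff_AE[OF int nonneg] by simp
      then have "AE x in leb a b. ?w x = 0"
        using M_coercive H_M
      proof eventually_elim
        case (elim x)
        have "c * (norm (M x *v ?w x))\<^sup>2 \<le> inner (?w x) (M x *v ?w x)" using elim(2) by blast
        then have "(norm (M x *v ?w x))\<^sup>2 \<le> 0" unfolding elim(1) using c by (simp add: mult_le_0_iff)
        then have "M x *v ?w x = 0" by simp
        moreover have "H x *v (M x *v ?w x) = ?w x" using elim(3) by blast
        ultimately show ?case by simp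
      qed
      then have z: "S \<xi> k a = 0" if "k < CARD('n)" for k by (rule vec_chain_zero_trace[OF ab chain _ that])
      have "traces a (S \<xi>) = 0"
      proof -
        have "pos j - 1 < CARD('n)" for j :: 'n using pos_range[of j] by linarith
        then show ?thesis by (auto simp: traces_def stack_def z vec_eq_iff)
      qed
      moreover have "traces a (S \<xi>) = \<xi>"
        unfolding traces by (simp add: traces_def W(2) vec_eq_iff axis_def if_distrib cong: if_cong)
      ultimately show False using \<xi> by simp
    qed
    moreover have "0 \<le> (LINT x|leb a b. inner (?w x) (M x *v ?w x))" by (rule integral_nonneg_AE[OF nonneg])
    ultimately have "0 < (LINT x|leb a b. inner (?w x) (M x *v ?w x))" by simp
    moreover have "2 * (- \<sigma> * (LINT x|leb a b. inner (?w x) (M x *v ?w x))) =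
        (norm (bnd_in (S \<xi>)))\<^sup>2 - (norm (bnd_out (S \<xi>)))\<^sup>2"
      using chain_energy[OF chain[of \<xi>]] unfolding eq by simp
    ultimately show ?thesis using \<sigma> by auto
  qed
  show ?thesis using lin chain eq pos by blast
qed

abbreviation trace_in :: "'d L2_class \<Rightarrow> real^('n \<times> 'd)" where
  "trace_in U \<equiv> Q_plus Q (tr a b b (weigh H U)) + Q_minus Q (tr a b a (weigh H U))"

abbreviation trace_out :: "'d L2_class \<Rightarrow> real^('n \<times> 'd)" where
  "trace_out U \<equiv> Q_minus Q (tr a b b (weigh H U)) + Q_plus Q (tr a b a (weigh H U))"

lemma represents_bnd:
  assumes "represents U W"
  shows "trace_in U = bnd_in W" "trace_out U = bnd_out W"
  using represents_trace[OF assms, of a] represents_trace[OF assms, of b] ab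
  by (simp_all add: bnd_in_def bnd_out_def)

text \<open>
The boundary values of all solutions of \<open>u + A u = f\<close>. A particular solution \<open>W\<close> gives the offset
\<open>x = F W - K (G W)\<close>, and adding kernel elements produces every \<open>y\<close>. To reach a given \<open>x\<close>, it suffices to take \<open>W\<close> from
the kernel of \<open>1 - A\<close>: there \<open>\<bar>G W\<bar> < \<bar>F W\<bar>\<close> for \<open>W \<noteq> 0\<close>, so \<open>W \<mapsto> F W - K (G W)\<close> is injective, hence onto.
\<close>

lemma range_fibres:
  shows "\<exists>K k. linear K \<and> 0 \<le> k \<and> k < 1 \<and> (\<forall>y. norm (K y) \<le> k * norm y) \<and>
    (\<forall>f\<in>L2_space a b. \<exists>x. \<forall>y. \<exists>U\<in>dom_A a b CARD('n) H.
        L2_add a b U (op_A a b CARD('n) P H U) = f \<and> trace_out U = y \<and> trace_in U = x + K y) \<and>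
    (\<forall>x. \<exists>f\<in>L2_space a b. \<forall>y. \<exists>U\<in>dom_A a b CARD('n) H.
        L2_add a b U (op_A a b CARD('n) P H U) = f \<and> trace_out U = y \<and> trace_in U = x + K y)"
proof -
  obtain S :: "real^('n \<times> 'd) \<Rightarrow> nat \<Rightarrow> real \<Rightarrow> real^'d" where
    S_lin: "linear (\<lambda>\<xi>. bnd_in (S \<xi>))" "linear (\<lambda>\<xi>. bnd_out (S \<xi>))" and
    S: "\<And>\<xi>. vec_chain a b CARD('n) (S \<xi>)" "\<And>\<xi> x. diff_expr (S \<xi>) x = - (M x *v S \<xi> 0 x)"
    "\<And>\<xi>. \<xi> \<noteq> 0 \<Longrightarrow> (norm (bnd_in (S \<xi>)))\<^sup>2 < (norm (bnd_out (S \<xi>)))\<^sup>2"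
    using kernel_family[of 1] by auto
  obtain S' :: "real^('n \<times> 'd) \<Rightarrow> nat \<Rightarrow> real \<Rightarrow> real^'d" where
    S'_lin: "linear (\<lambda>\<xi>. bnd_in (S' \<xi>))" "linear (\<lambda>\<xi>. bnd_out (S' \<xi>))" and
    S': "\<And>\<xi>. vec_chain a b CARD('n) (S' \<xi>)" "\<And>\<xi> x. diff_expr (S' \<xi>) x = M x *v S' \<xi> 0 x"
    "\<And>\<xi>. \<xi> \<noteq> 0 \<Longrightarrow> (norm (bnd_out (S' \<xi>)))\<^sup>2 < (norm (bnd_in (S' \<xi>)))\<^sup>2"
    using kernel_family[of "-1"] by auto
  have "norm (bnd_in (S \<xi>)) < norm (bnd_out (S \<xi>))" if "\<xi> \<noteq> 0" for \<xi>
    using S(3)[OF that] by (rule power2_less_imp_less) simp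
  from dominated_linear_quotient[OF S_lin this] obtain K k where
    surj: "surj (\<lambda>\<xi>. bnd_out (S \<xi>))" and K: "linear K" "0 \<le> k" "k < 1" "\<And>y. norm (K y) \<le> k * norm y"
    and KS: "\<And>\<xi>. bnd_in (S \<xi>) = K (bnd_out (S \<xi>))" by blast
  have fibre: "\<exists>U\<in>dom_A a b CARD('n) H. L2_add a b U (op_A a b CARD('n) P H U) = f \<and> trace_out U = y \<and>
        trace_in U = (bnd_in W - K (bnd_out W)) + K y"
    if f: "f \<in> L2_space a b" and W: "vec_chain a b CARD('n) W" "AE x in leb a b. diff_expr W x + M x *v W 0 x = rep f x" for f W y
  proof -
    obtain \<xi> where \<xi>: "bnd_out (S \<xi>) = y - bnd_out W" using surj by (metis surjD)
    let ?W = "\<lambda>k x. W k x + S \<xi> k x"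
    have "vec_chain a b CARD('n) ?W" by (intro vec_chain_add W(1) S(1))
    moreover have "AE x in leb a b. diff_expr ?W x + M x *v ?W 0 x = rep f x"
      using W(2) by eventually_elim (simp add: diff_expr_add S(2) matrix_vector_right_distrib)
    ultimately obtain U where U: "represents U ?W" "L2_add a b U (op_A a b CARD('n) P H U) = f"
      using solution_class[OF f] by blast
    have "trace_out U = y" using represents_bnd(2)[OF U(1)] \<xi> by (simp add: bnd_add)
    moreover have "trace_in U = (bnd_in W - K (bnd_out W)) + K y"
      using represents_bnd(1)[OF U(1)] by (simp add: bnd_add KS \<xi> linear_diff[OF K(1)])
    ultimately show ?thesis using U represents_dom_A by blast
  qed
  have fibre_all: "\<exists>x. \<forall>y. \<exists>U\<in>dom_A a b CARD('n) H.
        L2_add a b U (op_A a b CARD('n) P H U) = f \<and> trace_out U = y \<and> trace_in U = x + K y"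
    if f: "f \<in> L2_space a b" for f
  proof -
    obtain W where W: "vec_chain a b CARD('n) W" "\<And>x. diff_expr W x + M x *v W 0 x = rep f x"
      using ode_solution[where 'n='n and P=P and M=M and f="rep f", OF ab P_det M_meas M_bdd fun_pow_component[OF rep_L2[OF f]], of 0]
      unfolding diff_expr_def by blast
    show ?thesis using fibre[OF f W(1) AE_I2[OF W(2)]] by blast
  qed
  have fibre_surj: "\<exists>f\<in>L2_space a b. \<forall>y. \<exists>U\<in>dom_A a b CARD('n) H.
        L2_add a b U (op_A a b CARD('n) P H U) = f \<and> trace_out U = y \<and> trace_in U = x + K y" for x
  proof -
    define h where "h \<xi> = bnd_in (S' \<xi>) - K (bnd_out (S' \<xi>))" for \<xi>
    have h: "linear h"
      unfolding h_def using linear_compose[OF S'_lin(2) K(1)] S'_lin(1)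
      by (intro linear_compose_sub) (simp_all add: o_def)
    have "inj h"
      unfolding linear_injective_0[OF h]
    proof (intro allI impI)
      fix \<xi> assume "h \<xi> = 0"
      then have "norm (bnd_in (S' \<xi>)) \<le> k * norm (bnd_out (S' \<xi>))" using K(4) by (simp add: h_def)
      also have "\<dots> \<le> norm (bnd_out (S' \<xi>))" using K(2,3) by (intro mult_left_le_one_le) auto
      finally have "(norm (bnd_in (S' \<xi>)))\<^sup>2 \<le> (norm (bnd_out (S' \<xi>)))\<^sup>2" by (intro power_mono) auto
      then show "\<xi> = 0" using S'(3)[of \<xi>] by (meson not_le)
    qed
    then have "surj h" by (rule linear_inj_imp_surj[OF h])
    then obtain \<xi> where \<xi>: "x = h \<xi>" by blast
    let ?f = "\<lambda>x. diff_expr (S' \<xi>) x + M x *v S' \<xi> 0 x"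
    have fL2: "?f \<in> fun_pow (L2_fun a b)"
      by (intro fun_pow_add diff_expr_L2 S' M_L2 chain_L2[OF S'(1)]) simp
    have "AE x in leb a b. ?f x = rep (ae_class a b ?f) x"
      using rep_ae_class_AE[OF fL2] by eventually_elim simp
    from fibre[OF ae_class_in[OF fL2] S'(1) this] show ?thesis
      using ae_class_in[OF fL2] unfolding \<xi> h_def by blast
  qed
  show ?thesis using K fibre_all fibre_surj by blast
qed

end

theorem theorem4p9:
  fixes a b :: real
    and P :: "nat \<Rightarrow> real^'d^'d"
    and \<H> :: "real \<Rightarrow> real^'d^'d"
    and Q :: "real^('n::{finite,linorder} \<times> 'd::finite)^('n \<times> 'd)"
    and domB :: "'d L2_class set"
    and B :: "'d L2_class \<Rightarrow> 'd L2_class"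
    and n :: nat
  assumes ab: "a < b"
    and n: "n = CARD('n)"
    and P_sym: "\<And>j. j \<le> n \<Longrightarrow> transpose (P j) = (-1) ^ (j + 1) *\<^sub>R P j"
    and P_det: "det (P n) \<noteq> 0"
    and H_meas: "\<H> \<in> borel_measurable (lebesgue_on {a<..<b})"
    and H_bdd: "\<exists>K. AE x in lebesgue_on {a<..<b}. norm (\<H> x) \<le> K"
    and H_sym: "AE x in lebesgue_on {a<..<b}. transpose (\<H> x) = \<H> x"
    and H_coercive: "\<exists>c>0. AE x in lebesgue_on {a<..<b}. \<forall>v. inner (\<H> x *v v) v \<ge> c * (norm v)\<^sup>2"
    and Q: "Q = Qmat P"
    and B_dom: "domB \<subseteq> dom_A a b n \<H>"
    and B_restr: "\<And>U. U \<in> domB \<Longrightarrow> B U = op_A a b n P \<H> U"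
  shows "m_accretive a b \<H> domB B \<longleftrightarrow>
    (\<exists>g :: real^('n \<times> 'd) \<Rightarrow> real^('n \<times> 'd). contraction g \<and>
       domB = {U \<in> dom_A a b n \<H>.
         g (Q_plus Q (tr a b b (weigh \<H> U)) + Q_minus Q (tr a b a (weigh \<H> U)))
         = Q_minus Q (tr a b b (weigh \<H> U)) + Q_plus Q (tr a b a (weigh \<H> U))})"
proof -
  note P_sym' = P_sym[unfolded n]
  obtain c where c: "c > 0" and coercive: "AE x in leb a b. \<forall>v. inner (\<H> x *v v) v \<ge> c * (norm v)\<^sup>2"
    using H_coercive by blast
  obtain K where K: "AE x in leb a b. norm (\<H> x) \<le> K" using H_bdd by blast
  have bdd: "AE x in leb a b. \<forall>v. norm (\<H> x *v v) \<le> K * norm v"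
    using K
  proof eventually_elim
    case (elim x)
    show ?case
      by (intro allI order_trans[OF norm_matrix_vector_mult_le] mult_right_mono elim) simp
  qed
  obtain M where M: "\<And>p q. (\<lambda>x. M x $ p $ q) \<in> borel_measurable (leb a b)"
    "AE x in leb a b. \<forall>v. \<H> x *v (M x *v v) = v"
    "AE x in leb a b. \<forall>v. norm (M x *v v) \<le> (1 / c) * norm v"
    "AE x in leb a b. \<forall>v. inner v (M x *v v) \<ge> c * (norm (M x *v v))\<^sup>2"
    by (rule coercive_inverse[OF H_meas c coercive]) (rule that)
  interpret port_hamiltonian a b c K "1 / c" P \<H> M Q
    by (rule port_hamiltonian.intro)
       (fact ab P_sym' P_det[unfolded n] Q matrix_entry_measurable[OF H_meas] bdd H_sym c coercive M)+
  let ?A = "op_A a b n P \<H>" and ?X = "dom_A a b n \<H>"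
  let ?q = "\<lambda>U V. weighted_inner a b \<H> (L2_diff a b (?A U) (?A V)) (L2_diff a b U V)"
  have rep: "\<exists>W. represents U W" if "U \<in> ?X" for U
    using dom_A_represents that by (simp add: n)
  have X: "U \<in> L2_space a b" "?A U \<in> L2_space a b" if "U \<in> ?X" for U
    using rep[OF that] representsD(1) op_A_in by (auto simp: n)
  obtain K' k where K': "linear K'" "0 \<le> k" "k < 1" "\<forall>y. norm (K' y) \<le> k * norm y"
    and fibre: "\<forall>f\<in>L2_space a b. \<exists>x. \<forall>y. \<exists>U\<in>?X.
        L2_add a b U (?A U) = f \<and> trace_out U = y \<and> trace_in U = x + K' y"
    and fibre_surj: "\<forall>x. \<exists>f\<in>L2_space a b. \<forall>y. \<exists>U\<in>?X.
        L2_add a b U (?A U) = f \<and> trace_out U = y \<and> trace_in U = x + K' y"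
    using range_fibres[folded n] by (elim exE conjE) (rule that)
  have "m_accretive a b \<H> domB B \<longleftrightarrow> 
      (\<forall>U\<in>domB. \<forall>V\<in>domB. 0 \<le> ?q U V) \<and> (\<lambda>U. L2_add a b U (?A U)) ` domB = L2_space a b"
    unfolding m_accretive_def accretive_def using B_restr by (simp cong: image_cong)
  also have "\<dots> \<longleftrightarrow> (\<exists>g. (\<forall>x y. norm (g x - g y) \<le> norm (x - y)) \<and>
      domB = {U \<in> ?X. g (trace_in U) = trace_out U})"
  proof (rule contraction_parametrization[where m=dist_sq, OF _ _ _ _ _ K'(1-3) spec[OF K'(4)]
        bspec[OF fibre] spec[OF fibre_surj] B_dom])
    fix U V assume U: "U \<in> ?X" and V: "V \<in> ?X"
    obtain W W' where W: "represents U W" "represents V W'" using rep[OF U] rep[OF V] by blast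
    show "2 * ?q U V = (norm (trace_in U - trace_in V))\<^sup>2 - (norm (trace_out U - trace_out V))\<^sup>2"
      unfolding represents_bnd[OF W(1)] represents_bnd[OF W(2)] n by (rule represents_green[OF W])
    show "?q U V = - dist_sq U V" if "L2_add a b U (?A U) = L2_add a b V (?A V)"
      by (rule resolvent_identity[OF X[OF U] X[OF V] that])
    show "0 \<le> dist_sq U V" by (rule dist_sq_nonneg[OF X(1)[OF U] X(1)[OF V]])
    show "U = V" if "dist_sq U V = 0" by (rule dist_sq_zero[OF X(1)[OF U] X(1)[OF V] that])
  next
    show "(\<lambda>U. L2_add a b U (?A U)) ` ?X \<subseteq> L2_space a b" using L2_add_in X by blast
  qed
  finally show ?thesis by (simp add: contraction_def)
qed

end
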